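(* Let $n$ be a positive integer and $\mathbb{K}$ be a commutative field. A matrix $A \in M_{n}(\mathbb{K})$ can be written as a product $A=NU$ of a nilpotent matrix $N\in M_n(\mathbb{K})$ and an involutive matrix $U\in M_n(\mathbb{K})$ if and only if $\det(A)=0$ and $A$ has at most $\left\lfloor \frac{n}{2}\right\rfloor$ invariant factors (counted with repetition) different from both $1$ and $X^{j}$, with $1 \leq j \leq n$.
   Context: A matrix $U\in M_n(\mathbb{K})$ is involutive if $U^2=I_n$. The invariant factors of $A \in M_n(\mathbb{K})$ are the unique $n$-tuple of monic polynomials $(P_1,\ldots,P_n)$ in $\mathbb{K}[X]$ with $P_1 \mid P_2 \mid \cdots \mid P_n$ such that $A$ is similar to the block diagonal matrix $\mathrm{diag}(C(P_1),\ldots,C(P_n))$, where $C(P)$ is the companion matrix of $P$ and $C(1)$ is the empty matrix. Some of the $P_i$ may equal $1$, and the list is counted with repetition: the number of invariant factors with a given property is the number of indices $i\in\{1,\ldots,n\}$ such that $P_i$ has it. *)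

theory Defs
  imports
    "Jordan_Normal_Form.Determinant"
    "HOL-Computational_Algebra.Polynomial"
begin

definition nilpotent_mat :: "'a::field mat \<Rightarrow> bool" where
  "nilpotent_mat N \<longleftrightarrow>
     square_mat N \<and> (\<exists>k. N ^\<^sub>m k = 0\<^sub>m (dim_row N) (dim_row N))"

definition involutive_mat :: "'a::field mat \<Rightarrow> bool" where
  "involutive_mat U \<longleftrightarrow> square_mat U \<and> U * U = 1\<^sub>m (dim_row U)"

(* Ones below the diagonal, negated coefficients of P in the last column.
   Meant for monic P; for P = 1 it is the empty (0 x 0) matrix. *)
definition companion_mat :: "'a::field poly \<Rightarrow> 'a mat" where
  "companion_mat P = mat (degree P) (degree P)
     (\<lambda>(i, j). if j + 1 = degree P then - coeff P i
               else if i = j + 1 then 1 else 0)"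

definition is_invariant_factors :: "'a::field mat \<Rightarrow> 'a poly list \<Rightarrow> bool" where
  "is_invariant_factors A Ps \<longleftrightarrow>
     length Ps = dim_row A \<and>
     (\<forall>P\<in>set Ps. lead_coeff P = 1) \<and>
     (\<forall>i. i + 1 < length Ps \<longrightarrow> Ps ! i dvd Ps ! (i + 1)) \<and>
     similar_mat A (diag_block_mat (map companion_mat Ps))"

(* Every square matrix over a field has exactly one such list (rational canonical form),
   so the description operator picks it out. *)
definition invariant_factors :: "'a::field mat \<Rightarrow> 'a poly list" where
  "invariant_factors A = (THE Ps. is_invariant_factors A Ps)"

end

(* Necessity. If A = N U has more than n div 2 invariant factors that are not powers of X, then over the algebraic closure
   these share a root l \<noteq> 0, so the l-eigenspace (of the transpose) has dimension > n/2 and meets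
   its image under the involution; on that intersection the nilpotent factor would be invertible.

   Sufficiency. If some invariant factor is a power of X, then every block is singular and each singular
   companion matrix is an involution away from the nilpotent shift. Otherwise there are at most n div 2
   nontrivial blocks, and the chains of their cyclic bases can be recombined into a basis
   w_i, A w_i (i < s) of K^n, with one more vector z such that A z lies in the span of the A w_i when
   n is odd. An involution fixing the w_i then changes A into (0, C; 1, W) with W arbitrary
   and C singular, up to a summand that does not affect nilpotency. Up to similarity C is built from a
   nilpotent part and a matrix - Y Z with Y, Z strictly triangular (an LU decomposition); then W = Y + Z
   makes the block matrix nilpotent, since x^2 - (Y + Z) x + Y Z = (x - Y)(x - Z).

   Invariant factors exist by choosing generators of K^n as a K[X]-module with a relation of minimal
   degree; they are unique because the dimensions of ker p(A) determine them. *)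
theory Submission
  imports Defs "HOL-Algebra.Algebraic_Closure_Type" "HOL-Library.Function_Algebras" "Jordan_Normal_Form.Matrix_Kernel"
begin

hide_const (open) up_ring.coeff up_ring.monom Polynomials.degree Polynomials.lead_coeff
  Coset.order
unbundle no fps_syntax

section \<open>Modules over Euclidean rings\<close>

text \<open>The bound \<open>n div 2\<close> is forced by the shape of the construction. For even
  \<open>n\<close> the vectors w_i generate K^n as a K[X]-module, so there are at least as many of
  them as nontrivial blocks, while w_i and A w_i form a basis only if their number is
  \<open>n div 2\<close>. Blocks of length 1 must therefore be absorbed by the surplus of longer
  ones, and the bound on the number of blocks says that this surplus suffices. The field may be
  finite or of characteristic 2, which rules out generic choices, division by 2 and diagonal forms
  of involutions. Hence the involutions are block triangular with 1 and -1 on the diagonal, and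
  pivots come from conjugating with one elementary matrix. Singularity of C makes the strictly
  triangular product possible: its kernel vector provides one spare coordinate, which leaves room to
  move the triangular factors of the remaining block by one place. Transposes enter because
  companion matrices have explicit left eigenvectors, the rows of powers of a root.\<close>

locale euclidean_module = Modules.module scale
  for scale :: "'r::euclidean_ring \<Rightarrow> 'b::ab_group_add \<Rightarrow> 'b" (infixr "*s" 75)
begin

lemma span_insert_add:
  assumes "y \<in> span B"
  shows "span (insert (x + y) B) = span (insert x B)"
proof (rule span_eq[THEN iffD2], intro conjI subsetI)
  fix v assume "v \<in> insert (x + y) B"
  moreover have "y \<in> span (insert x B)" using assms span_mono[of B "insert x B"] by auto
  ultimately show "v \<in> span (insert x B)" by (auto intro: span_add span_base)
next
  fix v assume v: "v \<in> insert x B"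
  have "y \<in> span (insert (x + y) B)" using assms span_mono[of B "insert (x + y) B"] by auto
  then have "(x + y) - y \<in> span (insert (x + y) B)" by (intro span_diff span_base[of "x + y"]) auto
  with v show "v \<in> span (insert (x + y) B)" by (auto intro: span_base)
qed

lemma span_insert_cong: "span B = span C \<Longrightarrow> span (insert x B) = span (insert x C)"
  by (simp add: span_insert)

lemma image_lessThan_Suc_shift: "f ` {..<Suc k} = insert (f 0) ((\<lambda>i. f (Suc i)) ` {..<k})"
  by (metis image_insert image_image lessThan_Suc_eq_insert_0)

text \<open>No rank or torsion assumption is made: a generator that became 0 gets a unit as
  \<open>d i\<close>, a free one gets \<open>d i = 0\<close>. Choosing a smallest nonzero
  coefficient over all generating tuples of the span replaces the diagonalisation of a relation
  matrix.\<close>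

theorem cyclic_decomposition:
  "\<exists>h d. span (h ` {..<k}) = span (g ` {..<k}) \<and> (\<forall>i. Suc i < k \<longrightarrow> d i dvd d (Suc i)) \<and>
     (\<forall>q. (\<Sum>i<k. q i *s h i) = 0 \<longleftrightarrow> (\<forall>i<k. d i dvd q i))"
proof (induction k arbitrary: g)
  case 0
  then show ?case by auto
next
  case (Suc k)
  let ?S = "span (g ` {..<Suc k})"
  \<comment> \<open>\<open>R h q\<close> leaves the generating tuple \<open>h\<close> free, so that
    minimality below also covers tuples obtained by a change of generators.\<close>
  define R where "R h q \<longleftrightarrow> span (h ` {..<Suc k}) = ?S \<and> (\<Sum>i<Suc k. q i *s h i) = 0" for h q
  show ?case
  proof (cases "\<exists>h q i. R h q \<and> i < Suc k \<and> q i \<noteq> 0")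
    case False
    then have "(\<Sum>i<Suc k. q i *s g i) = 0 \<longleftrightarrow> (\<forall>i<Suc k. q i = 0)" for q
      unfolding R_def by (auto intro!: sum.neutral simp del: sum.lessThan_Suc)
    then show ?thesis by (intro exI[of _ g] exI[of _ "\<lambda>_. 0"]) auto
  next
    case True
    define Q where "Q e \<longleftrightarrow> e \<noteq> 0 \<and> (\<exists>h q i. R h q \<and> i < Suc k \<and> q i = e)" for e
    from True have "\<exists>e. Q e" unfolding Q_def by blast
    then obtain e where e: "Q e" and min: "\<And>e'. Q e' \<Longrightarrow> euclidean_size e \<le> euclidean_size e'"
      using ex_has_least_nat[of Q _ euclidean_size] by blast
    from e have e0: "e \<noteq> 0" by (simp add: Q_def)
    \<comment> \<open>All divisibilities come from here: a remainder modulo \<open>e\<close> that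
      occurs as a coefficient of some relation is smaller than \<open>e\<close>, hence 0.\<close>
    have min0: "q i mod e = 0" if "R h p" "i < Suc k" "p i = q i mod e" for h p q i
      using min[of "q i mod e"] that mod_size_less[OF e0, of "q i"] unfolding Q_def by fastforce
    have dvd_head: "e dvd p 0" if "R h q" "R h p" "q 0 = e" for h q p
    proof -
      have "R h (\<lambda>i. p i - (p 0 div e) * q i)"
        proof -
        have "(\<Sum>i<Suc k. (p i - (p 0 div e) * q i) *s h i)
              = (\<Sum>i<Suc k. p i *s h i) - (p 0 div e) *s (\<Sum>i<Suc k. q i *s h i)"
          by (simp only: scale_left_diff_distrib sum_subtractf scale_sum_right scale_scale)
        then show ?thesis using that unfolding R_def by simp
      qed
      from min0[OF this, of 0 p] that(3) show ?thesis
        by (simp add: minus_div_mult_eq_mod mod_eq_0_iff_dvd)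
    qed
    have dvd_entry: "e dvd q i" if q: "R h q" "q 0 = e" and i: "i < Suc k" for h q i
    proof (cases "i = 0")
      case False
      \<comment> \<open>Trading \<open>h 0\<close> for \<open>h 0 + t h i\<close> keeps the span and
        turns the coefficient \<open>q i\<close> into its remainder modulo \<open>e\<close>.\<close>
      define t where "t = q i div e"
      define h' where "h' = h(0 := h 0 + t *s h i)"
      define q' where "q' = q(i := q i - t * e)"
      have "span (h' ` {..<Suc k}) = span (h ` {..<Suc k})"
      proof -
        have "h i \<in> (\<lambda>i. h (Suc i)) ` {..<k}" using False i by (cases i) auto
        then show ?thesis
          unfolding image_lessThan_Suc_shift h'_def
          by (simp add: span_insert_add span_base span_scale)
      qed
      moreover have "(\<Sum>j<Suc k. q' j *s h' j) - (\<Sum>j<Suc k. q j *s h j) = 0"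
      proof -
        have "(\<Sum>j<Suc k. q' j *s h' j) - (\<Sum>j<Suc k. q j *s h j)
              = (\<Sum>j<Suc k. q' j *s h' j - q j *s h j)" by (simp only: sum_subtractf)
        also have "\<dots> = (\<Sum>j\<in>{0,i}. q' j *s h' j - q j *s h j)"
          using i by (intro sum.mono_neutral_right) (auto simp: q'_def h'_def)
        also have "\<dots> = 0"
          using False q(2) by (simp add: q'_def h'_def algebra_simps)
        finally show ?thesis .
      qed
      ultimately have "R h' q'" using q unfolding R_def by simp
      from min0[OF this i, of q] show ?thesis
        by (simp add: q'_def t_def minus_div_mult_eq_mod mod_eq_0_iff_dvd)
    qed (use q in simp)
    obtain h q where hq: "R h q" "q 0 = e"
    proof -
      from e obtain h q i where *: "R h q" "i < Suc k" "q i = e" unfolding Q_def by blast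
      \<comment> \<open>A swap of generators brings the minimal coefficient to index 0.\<close>
      let ?t = "Transposition.transpose 0 i"
      have bij: "bij_betw ?t {..<Suc k} {..<Suc k}"
        using *(2) by (intro bij_betw_byWitness[of _ ?t]) (auto simp: Transposition.transpose_def)
      have "(\<Sum>j<Suc k. q (?t j) *s h (?t j)) = (\<Sum>j<Suc k. q j *s h j)"
        by (rule sum.reindex_bij_betw[OF bij])
      moreover have "(\<lambda>j. h (?t j)) ` {..<Suc k} = h ` {..<Suc k}"
        using bij_betw_imp_surj_on[OF bij] by (metis image_image)
      ultimately have "R (\<lambda>j. h (?t j)) (\<lambda>j. q (?t j))" using *(1) by (simp add: R_def)
      then show ?thesis using *(3) by (intro that[of "\<lambda>j. h (?t j)" "\<lambda>j. q (?t j)"]) auto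
    qed
    define g' where "g' i = h (Suc i)" for i
    \<comment> \<open>As \<open>e\<close> divides every coefficient of the relation, the relation is
      \<open>e\<close> times this vector. So \<open>h0\<close> can replace \<open>h 0\<close>, and
      \<open>e\<close> annihilates it.\<close>
    define h0 where "h0 = h 0 + (\<Sum>i<k. (q (Suc i) div e) *s g' i)"
    from Suc.IH[of g'] obtain h2 d2 where
      span2: "span (h2 ` {..<k}) = span (g' ` {..<k})" and
      dvd2: "\<And>i. Suc i < k \<Longrightarrow> d2 i dvd d2 (Suc i)" and
      rel2: "\<And>q. (\<Sum>i<k. q i *s h2 i) = 0 \<longleftrightarrow> (\<forall>i<k. d2 i dvd q i)" by blast
    have sum_mem: "(\<Sum>i<k. (q (Suc i) div e) *s g' i) \<in> span (g' ` {..<k})"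
      by (intro span_sum span_scale span_base) auto
    define H where "H i = (case i of 0 \<Rightarrow> h0 | Suc j \<Rightarrow> h2 j)" for i
    define D where "D i = (case i of 0 \<Rightarrow> e | Suc j \<Rightarrow> d2 j)" for i
    have spanH: "span (H ` {..<Suc k}) = ?S"
    proof -
      have "span (H ` {..<Suc k}) = span (insert h0 (g' ` {..<k}))"
        using span_insert_cong[OF span2] by (simp add: image_lessThan_Suc_shift H_def)
      also have "\<dots> = span (insert (h 0) (g' ` {..<k}))"
        unfolding h0_def by (rule span_insert_add[OF sum_mem])
      also have "\<dots> = ?S" using hq(1) unfolding R_def g'_def image_lessThan_Suc_shift by simp
      finally show ?thesis .
    qed
    have e_h0: "e *s h0 = 0"
    proof -
      have "e *s h0 = e *s h 0 + (\<Sum>i<k. q (Suc i) *s g' i)"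
        using dvd_entry[OF hq] by (simp add: h0_def scale_right_distrib scale_sum_right)
      also have "\<dots> = 0" using hq by (simp add: R_def sum.lessThan_Suc_shift g'_def del: sum.lessThan_Suc)
      finally show ?thesis .
    qed
    have kill: "c *s h0 = 0" if "e dvd c" for c
    proof -
      from that obtain t where "c = t * e" by (metis dvdE mult.commute)
      then show ?thesis using e_h0 by (metis scale_scale scale_zero_right)
    qed
    have sumH: "(\<Sum>i<Suc k. p i *s H i) = p 0 *s h0 + (\<Sum>i<k. p (Suc i) *s h2 i)" for p
      by (simp add: sum.lessThan_Suc_shift H_def del: sum.lessThan_Suc)
    \<comment> \<open>The minimal coefficient \<open>e\<close> stands in front, so
      \<open>dvd_head\<close> applies to every relation among the \<open>H i\<close>; this is what
      separates the first summand from the others.\<close>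
    have R0: "R H (\<lambda>i. if i = 0 then e else 0)"
      using spanH e_h0 unfolding R_def sumH by simp
    show ?thesis
    proof (intro exI[of _ H] exI[of _ D] conjI allI impI)
      show "span (H ` {..<Suc k}) = ?S" by (rule spanH)
    next
      fix i assume i: "Suc i < Suc k"
      show "D i dvd D (Suc i)"
      proof (cases i)
        case 0
        \<comment> \<open>The sum of the relations of \<open>h0\<close> and of \<open>h2 0\<close>
          contains both \<open>e\<close> and \<open>d2 0\<close>, so \<open>dvd_entry\<close>
          compares the two.\<close>
        define p where "p j = (case j of 0 \<Rightarrow> e | Suc j' \<Rightarrow> if j' = 0 then d2 0 else 0)" for j
        have "(\<Sum>j<k. p (Suc j) *s h2 j) = 0"
          unfolding rel2 by (simp add: p_def)
        then have "R H p" unfolding R_def sumH using spanH e_h0 by (simp add: p_def)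
        from dvd_entry[OF this, of 1] i 0 show ?thesis by (simp add: p_def D_def)
      qed (use i dvd2 in \<open>simp add: D_def\<close>)
    next
      fix p
      show "(\<Sum>i<Suc k. p i *s H i) = 0 \<longleftrightarrow> (\<forall>i<Suc k. D i dvd p i)"
      proof
        assume *: "(\<Sum>i<Suc k. p i *s H i) = 0"
        then have "R H p" using spanH by (simp add: R_def)
        from dvd_head[OF R0 this] have p0: "e dvd p 0" by simp
        then have "p 0 *s h0 = 0" by (rule kill)
        with * have "(\<Sum>i<k. p (Suc i) *s h2 i) = 0" unfolding sumH by simp
        with p0 show "\<forall>i<Suc k. D i dvd p i"
          unfolding rel2 D_def by (auto split: nat.split)
      next
        assume *: "\<forall>i<Suc k. D i dvd p i"
        then have "e dvd p 0" by (auto simp: D_def)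
        then have "p 0 *s h0 = 0" by (rule kill)
        moreover have "(\<Sum>i<k. p (Suc i) *s h2 i) = 0"
          unfolding rel2 using * by (auto simp: D_def dest: spec[of _ "Suc _"])
        ultimately show "(\<Sum>i<Suc k. p i *s H i) = 0" unfolding sumH by simp
      qed
    qed
  qed
qed

end

section \<open>Polynomials in a matrix\<close>

lemma wide_mat_kernel:
  fixes S :: "'a::field mat"
  assumes S: "S \<in> carrier_mat n m" and "n < m"
  obtains v where "v \<in> carrier_vec m" "v \<noteq> 0\<^sub>v m" "S *\<^sub>v v = 0\<^sub>v n"
proof -
  \<comment> \<open>Zero rows are appended to make the matrix square. Row \<open>n\<close> is one of
    them, so the transpose kills \<open>unit_vec m n\<close> and the determinant is 0.\<close>
  define S' where "S' = mat m m (\<lambda>(i,j). if i < n then S $$ (i,j) else 0)"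
  have S': "S' \<in> carrier_mat m m" by (simp add: S'_def)
  have "transpose_mat S' *\<^sub>v unit_vec m n = 0\<^sub>v m"
    using \<open>n < m\<close> by (intro eq_vecI) (auto simp: S'_def)
  then have "det (transpose_mat S') = 0"
    using \<open>n < m\<close> S' by (subst det_0_iff_vec_prod_zero[of _ m]) (auto intro!: exI[of _ "unit_vec m n"])
  then have "det S' = 0" by (simp add: det_transpose[OF S'])
  then obtain v where v: "v \<in> carrier_vec m" "v \<noteq> 0\<^sub>v m" "S' *\<^sub>v v = 0\<^sub>v m"
    using det_0_iff_vec_prod_zero[OF S'] by auto
  have "S *\<^sub>v v = 0\<^sub>v n"
  proof (intro eq_vecI)
    fix i assume "i < dim_vec (0\<^sub>v n)"
    then have i: "i < n" by simp
    have "(S' *\<^sub>v v) $ i = 0" using v(3) i \<open>n < m\<close> by simp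
    moreover have "row S' i = row S i" using i S \<open>n < m\<close> by (auto simp: S'_def)
    ultimately show "(S *\<^sub>v v) $ i = 0\<^sub>v n $ i" using i S S' \<open>n < m\<close> by simp
  qed (use S in simp)
  with v show ?thesis using that by blast
qed

text \<open>Preimages of the unit vectors are the columns of \<open>Q\<close>. The inequality is
  recorded as well: \<open>Q\<close> is injective because \<open>S * Q\<close> is the identity, so
  it cannot be wider than high.\<close>

lemma surj_mat_right_inverse:
  fixes S :: "'a::field mat"
  assumes S: "S \<in> carrier_mat n m"
    and surj: "\<And>v. v \<in> carrier_vec n \<Longrightarrow> \<exists>x\<in>carrier_vec m. S *\<^sub>v x = v"
  obtains Q where "Q \<in> carrier_mat m n" "S * Q = 1\<^sub>m n" "n \<le> m"
proof -
  have "\<exists>x. x \<in> carrier_vec m \<and> S *\<^sub>v x = unit_vec n j" for j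
    using surj[of "unit_vec n j"] by auto
  then obtain x where x: "\<And>j. x j \<in> carrier_vec m" "\<And>j. S *\<^sub>v x j = unit_vec n j"
    by metis
  define Q where "Q = mat m n (\<lambda>(i,j). x j $ i)"
  have Q: "Q \<in> carrier_mat m n" by (simp add: Q_def)
  have "col Q j = x j" if "j < n" for j using x(1)[of j] that by (auto simp: Q_def)
  then have SQ: "S * Q = 1\<^sub>m n"
    using S Q x by (intro mat_col_eqI) (auto simp: col_mult2[of _ n m _ n] simp del: col_mult)
  have "n \<le> m"
  proof (rule ccontr)
    assume "\<not> n \<le> m"
    with wide_mat_kernel[OF Q] obtain v where v: "v \<in> carrier_vec n" "v \<noteq> 0\<^sub>v n" "Q *\<^sub>v v = 0\<^sub>v m" by auto
    have "(S * Q) *\<^sub>v v = S *\<^sub>v (Q *\<^sub>v v)" using S Q v by (intro assoc_mult_mat_vec)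
    then have "v = S *\<^sub>v 0\<^sub>v m" using v SQ by simp
    also have "\<dots> = 0\<^sub>v n" using S by auto
    finally show False using v by simp
  qed
  with Q SQ that show ?thesis by blast
qed

section \<open>Evaluation of polynomials at a matrix\<close>

text \<open>Horner's scheme, which matches induction over \<open>pCons\<close>. The size is read off
  \<open>A\<close>, so the zero polynomial also yields a matrix of the right dimensions.\<close>

definition poly_mat :: "'a::field mat \<Rightarrow> 'a poly \<Rightarrow> 'a mat" where
  "poly_mat A p = fold_coeffs (\<lambda>a M. a \<cdot>\<^sub>m 1\<^sub>m (dim_row A) + A * M) p (0\<^sub>m (dim_row A) (dim_row A))"

context
  fixes A :: "'a::field mat" and n :: nat
  assumes A: "A \<in> carrier_mat n n"
begin

lemma poly_mat_0 [simp]: "poly_mat A 0 = 0\<^sub>m n n"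
  using A by (simp add: poly_mat_def)

lemma poly_mat_pCons [simp]: "poly_mat A (pCons a p) = a \<cdot>\<^sub>m 1\<^sub>m n + A * poly_mat A p"
\<comment> \<open>\<open>pCons 0 0\<close> is the zero polynomial, whose coefficient list is empty;
  the recursion of \<open>fold_coeffs\<close> does not apply to it.\<close>
proof (cases "p = 0 \<and> a = 0")
  case True
  then show ?thesis using A by auto
next
  case False
  then show ?thesis using A by (auto simp: poly_mat_def)
qed

lemma poly_mat_carrier [simp]: "poly_mat A p \<in> carrier_mat n n"
  using A by (induction p) auto

lemma poly_mat_dim [simp]: "dim_row (poly_mat A p) = n" "dim_col (poly_mat A p) = n"
  using poly_mat_carrier by (auto simp del: poly_mat_carrier)

lemma poly_mat_add: "poly_mat A (p + q) = poly_mat A p + poly_mat A q"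
proof (induction p q rule: poly_induct2)
  case (pCons a p b q)
  have "A * (poly_mat A p + poly_mat A q) = A * poly_mat A p + A * poly_mat A q"
    by (intro mult_add_distrib_mat[OF A]) auto
  then show ?case using A pCons.IH by (auto simp: add_smult_distrib_right_mat algebra_simps)
qed auto

lemma poly_mat_smult: "poly_mat A (smult c p) = c \<cdot>\<^sub>m poly_mat A p"
proof (induction p)
  case (pCons a p)
  have "A * (c \<cdot>\<^sub>m poly_mat A p) = c \<cdot>\<^sub>m (A * poly_mat A p)"
    by (intro mult_smult_distrib[OF A]) auto
  then show ?case using A pCons.IH by (auto simp: algebra_simps)
qed auto

lemma poly_mat_mult: "poly_mat A (p * q) = poly_mat A p * poly_mat A q"
proof (induction p)
  case (pCons a p)
  have "poly_mat A (pCons a p * q) = a \<cdot>\<^sub>m poly_mat A q + A * (poly_mat A p * poly_mat A q)"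
    using A pCons.IH by (auto simp: poly_mat_add poly_mat_smult)
  also have "A * (poly_mat A p * poly_mat A q) = (A * poly_mat A p) * poly_mat A q"
    by (intro assoc_mult_mat[symmetric, OF A]) auto
  also have "a \<cdot>\<^sub>m poly_mat A q = (a \<cdot>\<^sub>m 1\<^sub>m n) * poly_mat A q"
    by (subst mult_smult_assoc_mat[of _ n n _ n]) auto
  also have "\<dots> + (A * poly_mat A p) * poly_mat A q = poly_mat A (pCons a p) * poly_mat A q"
    using A by (subst poly_mat_pCons, intro add_mult_distrib_mat[symmetric, of _ n n _ _ n]) auto
  finally show ?case .
qed (auto intro!: left_mult_zero_mat[symmetric])

lemma poly_mat_1 [simp]: "poly_mat A 1 = 1\<^sub>m n"
  using A by (simp add: one_pCons del: pCons_one) auto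

text \<open>Functions \<open>nat \<Rightarrow> 'a\<close> stand for vectors of length \<open>n\<close>, so that the type-based theory of modules
  applies; on the coordinates \<open>\<ge> n\<close> the indeterminate acts as \<open>0\<close>.\<close>
definition act :: "'a poly \<Rightarrow> (nat \<Rightarrow> 'a) \<Rightarrow> nat \<Rightarrow> 'a" where
  "act p x = (\<lambda>i. if i < n then (poly_mat A p *\<^sub>v vec n x) $ i else coeff p 0 * x i)"

lemma vec_act: "vec n (act p x) = poly_mat A p *\<^sub>v vec n x"
  by (intro eq_vecI) (auto simp: act_def)

lemma vec_plus_fun: "vec n (x + y) = vec n x + vec n y" by auto

lemma euclidean_module_act: "euclidean_module act"
  unfolding euclidean_module_def
proof
  fix p q x y
  show "act p (x + y) = act p x + act p y"
  proof
    fix i show "act p (x + y) i = (act p x + act p y) i"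
      using mult_add_distrib_mat_vec[OF poly_mat_carrier, of "vec n x" "vec n y" p]
      by (auto simp: act_def vec_plus_fun distrib_left simp del: index_mult_mat_vec)
  qed
  show "act (p + q) x = act p x + act q x"
  proof
    fix i show "act (p + q) x i = (act p x + act q x) i"
      using add_mult_distrib_mat_vec[OF poly_mat_carrier poly_mat_carrier, of "vec n x" p q]
      by (auto simp: act_def poly_mat_add distrib_right simp del: index_mult_mat_vec)
  qed
  show "act p (act q x) = act (p * q) x"
  proof
    fix i show "act p (act q x) i = act (p * q) x i"
    proof (cases "i < n")
      case True
      then have "act p (act q x) i = (poly_mat A p *\<^sub>v (poly_mat A q *\<^sub>v vec n x)) $ i"
        unfolding act_def[of p] by (simp only: vec_act if_True)
      also have "\<dots> = act (p * q) x i"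
        using True by (simp add: act_def poly_mat_mult assoc_mult_mat_vec[of _ n n _ n] del: index_mult_mat_vec)
      finally show ?thesis .
    qed (simp add: act_def mult.assoc coeff_mult_0)
  qed
  show "act 1 x = x"
    by (auto simp: act_def fun_eq_iff)
qed

end

lemma sum_fun_apply: "(\<Sum>j\<in>J. f j) i = (\<Sum>j\<in>J. f j i)"
  by (induction J rule: infinite_finite_induct) auto

section \<open>Cyclic bases and companion blocks\<close>

text \<open>Each pair holds a polynomial and a generator meant to be annihilated by it. In a direct
  sum of such cyclic modules this is the basis in which X acts by \<open>companion_blocks\<close>;
  polynomials of degree 0 contribute no vector.\<close>

fun cyclic_basis :: "('a::field poly \<Rightarrow> 'v \<Rightarrow> 'v) \<Rightarrow> ('a poly \<times> 'v) list \<Rightarrow> 'v list" where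
  "cyclic_basis a [] = []"
| "cyclic_basis a ((P, h) # r) = map (\<lambda>j. a (monom 1 j) h) [0..<degree P] @ cyclic_basis a r"

abbreviation companion_blocks :: "'a::field poly list \<Rightarrow> 'a mat" where
  "companion_blocks Ps \<equiv> diag_block_mat (map companion_mat Ps)"

lemma companion_mat_dim [simp]:
  "dim_row (companion_mat P) = degree P" "dim_col (companion_mat P) = degree P"
  by (simp_all add: companion_mat_def)

lemma companion_blocks_dim [simp]:
  "dim_row (companion_blocks Ps) = (\<Sum>P\<leftarrow>Ps. degree P)"
  "dim_col (companion_blocks Ps) = (\<Sum>P\<leftarrow>Ps. degree P)"
  by (simp_all add: dim_diag_block_mat o_def)

lemma length_cyclic_basis [simp]: "length (cyclic_basis a r) = (\<Sum>x\<leftarrow>r. degree (fst x))"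
  by (induction a r rule: cyclic_basis.induct) auto

lemma sum_lessThan_add: "(\<Sum>k<m + n. f k) = (\<Sum>k<m. f k) + (\<Sum>k<n. f (m + k))"
  for f :: "nat \<Rightarrow> 'b::comm_monoid_add"
  by (induction n) (auto simp: add.assoc)

lemma poly_sum_monom: "degree p < n \<or> p = 0 \<Longrightarrow> p = (\<Sum>i<n. monom (coeff p i) i)"
  by (intro poly_eqI) (auto simp: coeff_sum coeff_eq_0 not_less)

lemma coeff_sum_monom: "coeff (\<Sum>i<n. monom (x i) i) k = (if k < n then x k else 0)"
  by (auto simp: coeff_sum)

locale poly_module = euclidean_module scale
  for scale :: "'a::field poly \<Rightarrow> 'v::ab_group_add \<Rightarrow> 'v" (infixr "*s" 75)
begin

lemma const_scale: "[:c:] *s monom 1 j *s h = monom c j *s h"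
  by (simp add: smult_monom)

text \<open>The columns before the last shift \<open>X^j h\<close> to the next power. In the last
  column, \<open>P h = 0\<close> with \<open>P\<close> monic expresses the top power by the lower
  ones.\<close>

lemma companion_intertwine:
  assumes P: "lead_coeff P = 1" "P *s h = 0" and j: "j < degree P"
  shows "[:0,1:] *s monom 1 j *s h = (\<Sum>k<degree P. [:companion_mat P $$ (k,j):] *s monom 1 k *s h)"
proof (cases "j + 1 = degree P")
  case True
  let ?d = "degree P"
  have "P = (\<Sum>k<Suc ?d. monom (coeff P k) k)" by (intro poly_sum_monom) simp
  then have "P = (\<Sum>k<?d. monom (coeff P k) k) + monom 1 ?d" using P(1) by simp
  then have "monom 1 ?d = P - (\<Sum>k<?d. monom (coeff P k) k)" by (metis add_diff_cancel_left')
  then have "monom 1 ?d *s h = (P - (\<Sum>k<?d. monom (coeff P k) k)) *s h" by (rule arg_cong)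
  also have "\<dots> = - (\<Sum>k<?d. monom (coeff P k) k *s h)"
    using P(2) by (simp only: scale_left_diff_distrib scale_sum_left diff_0)
  also have "\<dots> = (\<Sum>k<?d. monom (- coeff P k) k *s h)"
    by (simp only: sum_negf minus_monom[symmetric] scale_minus_left)
  also have "\<dots> = (\<Sum>k<?d. [:companion_mat P $$ (k,j):] *s monom 1 k *s h)"
    using True j by (intro sum.cong) (simp_all add: companion_mat_def smult_monom)
  finally show ?thesis using True by (simp add: monom_Suc[symmetric])
next
  case False
  with j have "Suc j < degree P" by simp
  have "(\<Sum>k<degree P. [:companion_mat P $$ (k,j):] *s monom 1 k *s h)
     = (\<Sum>k<degree P. if k = Suc j then monom 1 k *s h else 0)"
    using False j by (intro sum.cong) (auto simp: companion_mat_def one_pCons[symmetric])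
  also have "\<dots> = monom 1 (Suc j) *s h" using \<open>Suc j < degree P\<close> by simp
  finally show ?thesis by (simp add: monom_Suc)
qed

text \<open>Phrased for a single column, in the form that later becomes the matrix identity
  \<open>A * S = S * D\<close>.\<close>

lemma cyclic_basis_intertwine:
  assumes "\<And>P h. (P,h) \<in> set r \<Longrightarrow> lead_coeff P = 1 \<and> P *s h = 0"
    and "j < (\<Sum>x\<leftarrow>r. degree (fst x))"
  shows "[:0,1:] *s cyclic_basis scale r ! j =
     (\<Sum>k<(\<Sum>x\<leftarrow>r. degree (fst x)). [:companion_blocks (map fst r) $$ (k,j):] *s cyclic_basis scale r ! k)"
  using assms
proof (induction r arbitrary: j)
  case (Cons Ph r)
  obtain P h where Ph: "Ph = (P,h)" by force
  define m where "m = (\<Sum>x\<leftarrow>r. degree (fst x))"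
  define D where "D = companion_blocks (map fst r)"
  have D: "dim_row D = m" "dim_col D = m"
    by (simp_all add: D_def m_def dim_diag_block_mat o_def)
  have block: "companion_blocks (map fst (Ph # r)) =
      four_block_mat (companion_mat P) (0\<^sub>m (degree P) m) (0\<^sub>m m (degree P)) D"
    using D unfolding D_def by (simp add: Ph Let_def)
  have entries: "four_block_mat (companion_mat P) (0\<^sub>m (degree P) m) (0\<^sub>m m (degree P)) D $$ (k,j) =
     (if k < degree P then if j < degree P then companion_mat P $$ (k,j) else 0
      else if j < degree P then 0 else D $$ (k - degree P, j - degree P))"
    if "k < degree P + m" "j < degree P + m" for k j
    using that by (simp add: D)
  have nth: "cyclic_basis scale (Ph # r) ! k =
     (if k < degree P then monom 1 k *s h else cyclic_basis scale r ! (k - degree P))" for k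
    by (simp add: Ph nth_append)
  have len: "(\<Sum>x\<leftarrow>Ph # r. degree (fst x)) = degree P + m" by (simp add: Ph m_def)
  have j: "j < degree P + m" using Cons.prems(2) len by simp
  show ?case
  proof (cases "j < degree P")
    case True
    then show ?thesis
      unfolding len sum_lessThan_add nth block using Cons.prems(1)[of P h] j
      by (simp add: entries Ph companion_intertwine del: scale_scale)
  next
    case False
    then have "j - degree P < m" using j by simp
    then have "[:0,1:] *s cyclic_basis scale r ! (j - degree P) =
        (\<Sum>k<m. [:D $$ (k, j - degree P):] *s cyclic_basis scale r ! k)"
      unfolding m_def D_def by (intro Cons.IH) (use Cons.prems(1) in auto)
    with False j show ?thesis
      unfolding len sum_lessThan_add nth block by (simp add: entries)
  qed
qed simp

text \<open>The scalars belonging to one block are the coefficients of one polynomial of smaller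
  degree than the block's own. The last conjunct serves to carry linear independence over from the
  module relations.\<close>

lemma cyclic_basis_to_polys:
  "\<exists>q. (\<Sum>j<(\<Sum>x\<leftarrow>r. degree (fst x)). [:x j:] *s cyclic_basis scale r ! j) = (\<Sum>l<length r. q l *s snd (r ! l)) \<and>
     (\<forall>l<length r. q l = 0 \<or> degree (q l) < degree (fst (r ! l))) \<and>
     ((\<forall>l<length r. q l = 0) \<longrightarrow> (\<forall>j<(\<Sum>x\<leftarrow>r. degree (fst x)). x j = 0))"
proof (induction r arbitrary: x)
  case (Cons Ph r)
  obtain P h where Ph: "Ph = (P,h)" by force
  define m where "m = (\<Sum>x\<leftarrow>r. degree (fst x))"
  have len: "(\<Sum>x\<leftarrow>Ph # r. degree (fst x)) = degree P + m" by (simp add: Ph m_def)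
  from Cons.IH[of "\<lambda>j. x (degree P + j)", folded m_def] obtain q where
    q: "(\<Sum>j<m. [:x (degree P + j):] *s cyclic_basis scale r ! j) = (\<Sum>l<length r. q l *s snd (r ! l))"
      "\<And>l. l < length r \<Longrightarrow> q l = 0 \<or> degree (q l) < degree (fst (r ! l))"
      "(\<forall>l<length r. q l = 0) \<Longrightarrow> (\<forall>j<m. x (degree P + j) = 0)" by blast
  define q0 where "q0 = (\<Sum>i<degree P. monom (x i) i)"
  have deg: "q0 = 0 \<or> degree q0 < degree P"
  proof (cases "degree P = 0")
    case False
    have "degree q0 \<le> degree P - 1"
      by (intro degree_le) (auto simp: q0_def coeff_sum_monom)
    with False show ?thesis by linarith
  qed (simp add: q0_def)
  have x0: "x j = 0" if "q0 = 0" "j < degree P" for j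
    using coeff_sum_monom[of x "degree P" j] that by (simp add: q0_def)
  define q' where "q' l = (case l of 0 \<Rightarrow> q0 | Suc l \<Rightarrow> q l)" for l
  have "(\<Sum>l<length (Ph # r). q' l *s snd ((Ph # r) ! l)) = q0 *s h + (\<Sum>l<length r. q l *s snd (r ! l))"
    by (simp add: sum.lessThan_Suc_shift q'_def Ph del: sum.lessThan_Suc)
  also have "q0 *s h = (\<Sum>j<degree P. [:x j:] *s monom 1 j *s h)"
    by (simp add: q0_def scale_sum_left const_scale del: scale_scale)
  also have "\<dots> + (\<Sum>l<length r. q l *s snd (r ! l)) =
     (\<Sum>j<degree P + m. [:x j:] *s cyclic_basis scale (Ph # r) ! j)"
    unfolding sum_lessThan_add q(1)[symmetric] by (simp add: Ph nth_append)
  finally have "(\<Sum>j<degree P + m. [:x j:] *s cyclic_basis scale (Ph # r) ! j) =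
      (\<Sum>l<length (Ph # r). q' l *s snd ((Ph # r) ! l))" by (rule sym)
  moreover have "q' l = 0 \<or> degree (q' l) < degree (fst ((Ph # r) ! l))" if "l < length (Ph # r)" for l
    using that q(2) deg by (cases l) (simp_all add: q'_def Ph)
  moreover have "x j = 0" if 0: "\<forall>l<length (Ph # r). q' l = 0" and j: "j < degree P + m" for j
  proof (cases "j < degree P")
    case True
    have "q0 = 0" using spec[OF 0, of 0] by (simp add: q'_def)
    then show ?thesis using True by (rule x0)
  next
    case False
    have "q l = 0" if "l < length r" for l using spec[OF 0, of "Suc l"] that by (simp add: q'_def)
    then have "\<forall>j<m. x (degree P + j) = 0" using q(3) by simp
    from spec[OF this, of "j - degree P"] show ?thesis using False j by simp
  qed
  ultimately show ?case unfolding len by blast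
qed simp

text \<open>Each coefficient may be reduced modulo the annihilating polynomial of its generator,
  after which only the powers in the cyclic basis occur.\<close>

lemma polys_to_cyclic_basis:
  assumes "\<And>P h. (P,h) \<in> set r \<Longrightarrow> lead_coeff P = 1 \<and> P *s h = 0"
  shows "\<exists>x. (\<Sum>l<length r. q l *s snd (r ! l)) =
     (\<Sum>j<(\<Sum>x\<leftarrow>r. degree (fst x)). [:x j:] *s cyclic_basis scale r ! j)"
  using assms
proof (induction r arbitrary: q)
  case (Cons Ph r)
  obtain P h where Ph: "Ph = (P,h)" by force
  define m where "m = (\<Sum>x\<leftarrow>r. degree (fst x))"
  have len: "(\<Sum>x\<leftarrow>Ph # r. degree (fst x)) = degree P + m" by (simp add: Ph m_def)
  have P: "P \<noteq> 0" "P *s h = 0" using Cons.prems[of P h] by (auto simp: Ph)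
  have "\<And>P h. (P,h) \<in> set r \<Longrightarrow> lead_coeff P = 1 \<and> P *s h = 0"
    using Cons.prems by (meson list.set_intros(2))
  from Cons.IH[of "\<lambda>l. q (Suc l)", OF this, folded m_def] obtain x where
    x: "(\<Sum>l<length r. q (Suc l) *s snd (r ! l)) = (\<Sum>j<m. [:x j:] *s cyclic_basis scale r ! j)"
    by blast
  define p where "p = q 0 mod P"
  have p: "p = (\<Sum>i<degree P. monom (coeff p i) i)"
    using degree_mod_less[OF P(1), of "q 0"] by (intro poly_sum_monom) (auto simp: p_def)
  have "q 0 *s h = (q 0 div P * P + p) *s h" by (simp add: p_def)
  also have "\<dots> = (q 0 div P) *s P *s h + p *s h" by (simp only: scale_left_distrib scale_scale)
  also have "\<dots> = (\<Sum>i<degree P. monom (coeff p i) i) *s h" unfolding P(2) p[symmetric] by simp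
  also have "\<dots> = (\<Sum>j<degree P. [:coeff p j:] *s monom 1 j *s h)"
    by (simp only: scale_sum_left const_scale)
  finally have "(\<Sum>l<length (Ph # r). q l *s snd ((Ph # r) ! l)) =
    (\<Sum>j<degree P. [:coeff p j:] *s monom 1 j *s h) + (\<Sum>j<m. [:x j:] *s cyclic_basis scale r ! j)"
    using x by (simp add: sum.lessThan_Suc_shift Ph del: sum.lessThan_Suc)
  also have "\<dots> = (\<Sum>j<degree P + m. [:if j < degree P then coeff p j else x (j - degree P):] *s
      cyclic_basis scale (Ph # r) ! j)"
    unfolding sum_lessThan_add by (simp add: Ph nth_append)
  finally show ?case unfolding len by (rule exI[of _ "\<lambda>j. if j < degree P then coeff p j else x (j - degree P)"])
qed simp

end

section \<open>Existence and uniqueness of the invariant factors\<close>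

lemma intertwining_imp_similar:
  fixes A D S Q :: "'a::field mat"
  assumes "A \<in> carrier_mat n n" "D \<in> carrier_mat n n" "S \<in> carrier_mat n n" "Q \<in> carrier_mat n n"
    and AS: "A * S = S * D" and SQ: "S * Q = 1\<^sub>m n"
  shows "similar_mat A D"
proof (rule similar_matI[of A D S Q n])
  show "Q * S = 1\<^sub>m n" using mat_mult_left_right_inverse[OF _ _ SQ] assms by blast
  have "A = A * (S * Q)" using assms by simp
  also have "\<dots> = S * D * Q" using assms(1-4) by (simp flip: assoc_mult_mat AS)
  finally show "A = S * D * Q" .
qed (use assms in auto)

context
  fixes A :: "'a::field mat" and n :: nat
  assumes A: "A \<in> carrier_mat n n"
begin

interpretation M: poly_module "act A n"
  unfolding poly_module_def by (rule euclidean_module_act[OF A])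

lemma poly_mat_const: "poly_mat A [:c:] = c \<cdot>\<^sub>m 1\<^sub>m n"
  using A by (auto simp: poly_mat_pCons[OF A] poly_mat_0[OF A])

lemma poly_mat_X: "poly_mat A [:0,1:] = A"
proof -
  have "(1 :: 'a) \<cdot>\<^sub>m 1\<^sub>m n = 1\<^sub>m n" "(0 :: 'a) \<cdot>\<^sub>m 1\<^sub>m n = 0\<^sub>m n n" by auto
  then show ?thesis
    using A by (subst poly_mat_pCons[OF A]) (simp only: poly_mat_const, simp)
qed

lemma vec_act_X: "vec n (act A n [:0,1:] x) = A *\<^sub>v vec n x"
  by (simp only: vec_act[OF A] poly_mat_X)

lemma act_const: "act A n [:c:] x = (\<lambda>i. c * x i)"
  by (auto simp: act_def[OF A] poly_mat_const fun_eq_iff row_smult)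

lemma act_outside: "n \<le> i \<Longrightarrow> x i = 0 \<Longrightarrow> act A n p x i = 0"
  by (simp add: act_def[OF A])

text \<open>Functions on all of \<open>nat\<close> form a larger module than K^n; those vanishing
  from \<open>n\<close> on are the copy of K^n to which the decomposition is applied.\<close>

lemma span_units:
  "M.span ((\<lambda>j i. if i = j then 1 else 0) ` {..<n}) = {x. \<forall>i\<ge>n. x i = 0}" (is "M.span ?B = ?S")
proof
  show "M.span ?B \<subseteq> ?S"
    by (intro M.span_minimal M.subspaceI) (auto simp: act_outside)
next
  show "?S \<subseteq> M.span ?B"
  proof
    fix x assume x: "x \<in> ?S"
    have "x = (\<Sum>j<n. act A n [:x j:] (\<lambda>i. if i = j then 1 else 0))"
    proof
      fix i
      have "(\<Sum>j<n. act A n [:x j:] (\<lambda>i. if i = j then 1 else 0)) i = (\<Sum>j<n. if j = i then x j else 0)"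
        unfolding sum_fun_apply act_const by (intro sum.cong) auto
      also have "\<dots> = x i" using x by (auto simp: not_less)
      finally show "x i = (\<Sum>j<n. act A n [:x j:] (\<lambda>i. if i = j then 1 else 0)) i" by simp
    qed
    moreover have "\<dots> \<in> M.span ?B" by (intro M.span_sum M.span_scale M.span_base) auto
    ultimately show "x \<in> M.span ?B" by simp
  qed
qed

text \<open>The n + 1 vectors x, X x, ..., X^n x lie in dimension n and are dependent. This excludes
  free summands, that is, \<open>d i = 0\<close>.\<close>

lemma torsion:
  assumes x: "\<forall>i\<ge>n. x i = 0"
  obtains p where "p \<noteq> 0" "act A n p x = 0"
proof -
  define S where "S = mat n (Suc n) (\<lambda>(i,j). act A n (monom 1 j) x i)"
  have S: "S \<in> carrier_mat n (Suc n)" by (simp add: S_def)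
  then obtain v where v: "v \<in> carrier_vec (Suc n)" "v \<noteq> 0\<^sub>v (Suc n)" "S *\<^sub>v v = 0\<^sub>v n"
    using wide_mat_kernel[of S n "Suc n"] by auto
  define p where "p = (\<Sum>j<Suc n. monom (v $ j) j)"
  have act_p: "act A n p x = (\<Sum>j<Suc n. act A n [:v $ j:] (act A n (monom 1 j) x))"
    unfolding p_def by (simp only: M.scale_sum_left M.const_scale)
  have "act A n p x i = 0" for i
  proof (cases "i < n")
    case True
    have "act A n p x i = (\<Sum>j<Suc n. v $ j * act A n (monom 1 j) x i)"
      unfolding act_p sum_fun_apply act_const ..
    also have "\<dots> = (S *\<^sub>v v) $ i"
      using True v(1) S by (auto simp: scalar_prod_def S_def atLeast0LessThan intro!: sum.cong simp del: sum.lessThan_Suc)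
    finally show ?thesis using True v(3) by simp
  qed (use x act_outside in simp)
  moreover have "p \<noteq> 0"
  proof
    assume "p = 0"
    then have "v $ k = 0" if "k < Suc n" for k
      using that coeff_sum_monom[of "vec_index v" "Suc n" k] by (simp only: p_def) simp
    with v(1,2) show False by (auto simp: vec_eq_iff)
  qed
  ultimately show ?thesis using that by (auto simp: fun_eq_iff)
qed

lemma cyclic_basis_elem:
  "b \<in> set (cyclic_basis a r) \<Longrightarrow> \<exists>p P h. (P,h) \<in> set r \<and> b = a p h"
  by (induction a r rule: cyclic_basis.induct) auto

text \<open>The generators are returned together with the list, because the sufficiency part builds
  its basis from them.\<close>

theorem invariant_factors_generators:
  "\<exists>Ps h. is_invariant_factors A Ps \<and> (\<forall>i<n. act A n (Ps ! i) (h i) = 0) \<and>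
     (\<forall>x. (\<forall>i\<ge>n. x i = 0) \<longrightarrow> (\<exists>q. x = (\<Sum>i<n. act A n (q i) (h i))))"
proof -
  obtain h d where span: "M.span (h ` {..<n}) = {x. \<forall>i\<ge>n. x i = 0}"
    and chain: "\<And>i. Suc i < n \<Longrightarrow> d i dvd d (Suc i)"
    and rel: "\<And>q. (\<Sum>i<n. act A n (q i) (h i)) = 0 \<longleftrightarrow> (\<forall>i<n. d i dvd q i)"
    using M.cyclic_decomposition[of n "\<lambda>j i. if i = j then 1 else 0"] unfolding span_units by blast
  have h: "h i j = 0" if "i < n" "n \<le> j" for i j
    using M.span_base[of "h i" "h ` {..<n}"] that unfolding span by blast
  have ann: "act A n p (h i) = 0 \<longleftrightarrow> d i dvd p" if "i < n" for i p
  proof -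
    have "(\<Sum>j<n. act A n (if j = i then p else 0) (h j)) = (\<Sum>j<n. if j = i then act A n p (h i) else 0)"
      by (intro sum.cong) auto
    then show ?thesis using rel[of "\<lambda>j. if j = i then p else 0"] that by (auto split: if_splits)
  qed
  have d0: "d i \<noteq> 0" if "i < n" for i
  proof -
    have "\<forall>j\<ge>n. h i j = 0" using h[OF that] by blast
    then obtain p where "p \<noteq> 0" "act A n p (h i) = 0" by (rule torsion)
    with ann[OF that] show ?thesis by auto
  qed
  \<comment> \<open>The decomposition determines each divisor up to a unit only; the monic associate
    is the one required of an invariant factor.\<close>
  define P where "P i = smult (inverse (lead_coeff (d i))) (d i)" for i
  have monic: "lead_coeff (P i) = 1" if "i < n" for i using d0[OF that] by (simp add: P_def)
  have dvd: "P i dvd q \<longleftrightarrow> d i dvd q" "q dvd P i \<longleftrightarrow> q dvd d i" if "i < n" for i q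
    using d0[OF that] by (auto simp: P_def smult_dvd_iff dvd_smult_iff)
  define r where "r = map (\<lambda>i. (P i, h i)) [0..<n]"
  have r: "lead_coeff Q = 1 \<and> act A n Q x = 0 \<and> (\<forall>j\<ge>n. x j = 0)" if "(Q,x) \<in> set r" for Q x
    using that monic ann dvd h by (auto simp: r_def)
  have len: "length r = n" by (simp add: r_def)
  define m where "m = (\<Sum>x\<leftarrow>r. degree (fst x))"
  define bs where "bs = cyclic_basis (act A n) r"
  have bs: "(bs ! j) i = 0" if "j < m" "n \<le> i" for j i
  proof -
    have "bs ! j \<in> set bs" using that by (simp add: bs_def m_def)
    then obtain p Q x where "(Q,x) \<in> set r" "bs ! j = act A n p x"
      using cyclic_basis_elem[of "bs ! j" "act A n" r] unfolding bs_def by blast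
    with that show ?thesis using r[of Q x] by (auto intro: act_outside)
  qed
  define S where "S = mat n m (\<lambda>(i,j). (bs ! j) i)"
  have S: "S \<in> carrier_mat n m" by (simp add: S_def)
  have colS: "col S j = vec n (bs ! j)" if "j < m" for j using that by (auto simp: S_def)
  have Sv: "(S *\<^sub>v v) $ i = (\<Sum>j<m. act A n [:v $ j:] (bs ! j)) i" if "v \<in> carrier_vec m" "i < n" for v i
    unfolding sum_fun_apply act_const using that S
    by (auto simp: scalar_prod_def S_def atLeast0LessThan intro!: sum.cong)
  define D where "D = companion_blocks (map P [0..<n])"
  have mapr: "map fst r = map P [0..<n]" by (simp add: r_def o_def)
  have D: "D \<in> carrier_mat m m"
    by (intro carrier_matI) (simp_all add: D_def m_def r_def o_def dim_diag_block_mat)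
  \<comment> \<open>A dependency among the columns gives a relation whose coefficients are divisible
    by \<open>P l\<close> and of smaller degree, hence zero.\<close>
  have inj: "v = 0\<^sub>v m" if v: "v \<in> carrier_vec m" "S *\<^sub>v v = 0\<^sub>v n" for v
  proof -
    obtain q where q: "(\<Sum>j<m. act A n [:v $ j:] (bs ! j)) = (\<Sum>l<length r. act A n (q l) (snd (r ! l)))"
      "\<And>l. l < length r \<Longrightarrow> q l = 0 \<or> degree (q l) < degree (fst (r ! l))"
      "(\<forall>l<length r. q l = 0) \<Longrightarrow> (\<forall>j<m. v $ j = 0)"
      using M.cyclic_basis_to_polys[of "vec_index v" r] unfolding m_def bs_def by blast
    have "(\<Sum>j<m. act A n [:v $ j:] (bs ! j)) i = 0" for i
    proof (cases "i < n")
      case True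
      then show ?thesis using Sv[OF v(1) True] v(2) by simp
    next
      case False
      then show ?thesis using bs unfolding sum_fun_apply act_const by (intro sum.neutral) auto
    qed
    then have "(\<Sum>l<n. act A n (q l) (h l)) = 0"
      using q(1) by (simp add: len r_def fun_eq_iff)
    then have "d l dvd q l" if "l < n" for l using rel that by blast
    then have "P l dvd q l" if "l < n" for l using dvd that by blast
    then have "q l = 0" if "l < n" for l
      using that q(2)[of l] dvd_imp_degree_le[of "P l" "q l"] by (fastforce simp: len r_def)
    then have "\<forall>j<m. v $ j = 0" using q(3) len by blast
    with v(1) show ?thesis by (intro eq_vecI) auto
  qed
  have gen: "\<exists>q. y = (\<Sum>i<n. act A n (q i) (h i))" if y: "\<forall>i\<ge>n. y i = 0" for y
  proof -
    have "y \<in> M.span (h ` {..<n})" using y unfolding span by auto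
    then obtain q where "y = (\<Sum>x\<in>h ` {..<n}. act A n (q x) x)"
      using M.span_finite[of "h ` {..<n}"] by auto
    \<comment> \<open>The span is described by a sum over the set of generators, but
      \<open>h\<close> may take a value twice; repeated indices receive the coefficient 0.\<close>
    moreover have "\<exists>q'. (\<Sum>x\<in>h ` {..<k}. act A n (q x) x) = (\<Sum>i<k. act A n (q' i) (h i))" for k
    proof (induction k)
      case (Suc k)
      then obtain q' where q': "(\<Sum>x\<in>h ` {..<k}. act A n (q x) x) = (\<Sum>i<k. act A n (q' i) (h i))" ..
      show ?case
      proof (cases "h k \<in> h ` {..<k}")
        case True
        then show ?thesis using q'
          by (intro exI[of _ "q'(k := 0)"]) (auto simp: lessThan_Suc insert_absorb)
      next
        case False
        then show ?thesis using q'
          by (intro exI[of _ "q'(k := q (h k))"]) (auto simp: lessThan_Suc)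
      qed
    qed auto
    ultimately show ?thesis by metis
  qed
  have surj: "\<exists>v\<in>carrier_vec m. S *\<^sub>v v = y" if y: "y \<in> carrier_vec n" for y
  proof -
    define y' where "y' i = (if i < n then y $ i else 0)" for i
    obtain q' where "y' = (\<Sum>i<n. act A n (q' i) (h i))" using gen[of y'] by (auto simp: y'_def)
    then have y': "y' = (\<Sum>l<length r. act A n (q' l) (snd (r ! l)))"
      by (simp add: len r_def)
    obtain x where x: "y' = (\<Sum>j<m. act A n [:x j:] (bs ! j))"
      using M.polys_to_cyclic_basis[of r q'] r unfolding y' m_def bs_def by blast
    have "S *\<^sub>v vec m x = y"
    proof (intro eq_vecI)
      fix i assume "i < dim_vec y"
      then have i: "i < n" using y by simp
      have "(S *\<^sub>v vec m x) $ i = (\<Sum>j<m. act A n [:vec m x $ j:] (bs ! j)) i"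
        by (rule Sv[OF _ i]) simp
      also have "\<dots> = y' i" unfolding x by simp
      finally show "(S *\<^sub>v vec m x) $ i = y $ i" using i by (simp add: y'_def)
    qed (use S y in simp)
    then show ?thesis by (intro bexI[of _ "vec m x"]) auto
  qed
  obtain Q where Q: "Q \<in> carrier_mat m n" "S * Q = 1\<^sub>m n" "n \<le> m"
    using surj_mat_right_inverse[OF S surj] by blast
  have "\<not> n < m" using wide_mat_kernel[OF S] inj by metis
  with Q have nm: "m = n" by simp
  have "A * S = S * D"
  proof (rule mat_col_eqI)
    fix j assume "j < dim_col (S * D)"
    then have j: "j < m" using D by simp
    have "col (A * S) j = A *\<^sub>v vec n (bs ! j)" using j A S by (simp add: col_mult2[of _ n n _ m] colS del: col_mult)
    also have "\<dots> = vec n (act A n [:0,1:] (bs ! j))" by (simp only: vec_act_X)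
    also have "act A n [:0,1:] (bs ! j) = (\<Sum>k<m. act A n [:D $$ (k,j):] (bs ! k))"
      using M.cyclic_basis_intertwine[of r j] r j unfolding bs_def m_def D_def mapr by blast
    also have "vec n \<dots> = S *\<^sub>v col D j"
    proof (intro eq_vecI)
      fix i assume "i < dim_vec (S *\<^sub>v col D j)"
      then have i: "i < n" using S by simp
      have "(\<Sum>k<m. act A n [:D $$ (k,j):] (bs ! k)) = (\<Sum>k<m. act A n [:col D j $ k:] (bs ! k))"
        using D j by (intro sum.cong) auto
      then show "vec n (\<Sum>k<m. act A n [:D $$ (k,j):] (bs ! k)) $ i = (S *\<^sub>v col D j) $ i"
        using Sv[of "col D j" i] i D j by simp
    qed (use S in simp)
    also have "\<dots> = col (S * D) j" using j D S by (simp add: col_mult2[of _ n m _ m] del: col_mult)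
    finally show "col (A * S) j = col (S * D) j" .
  qed (use A S D in auto)
  then have "similar_mat A D"
    using A D S Q unfolding nm by (intro intertwining_imp_similar) auto
  moreover have "map P [0..<n] ! i dvd map P [0..<n] ! (i + 1)" if "i + 1 < n" for i
    using that chain[of i] dvd by auto
  ultimately have "is_invariant_factors A (map P [0..<n])"
    using A monic unfolding is_invariant_factors_def D_def by auto
  moreover have "act A n (map P [0..<n] ! i) (h i) = 0" if "i < n" for i
    using that ann dvd by simp
  ultimately show ?thesis using gen by blast
qed

end

section \<open>Kernel dimensions of polynomials in companion blocks\<close>

lemma kernel_dim_le: "kernel_dim A \<le> dim_col A"
  by (simp add: kernel_dim_code)

text \<open>Gauss-Jordan elimination keeps the kernel, whose dimension is \<open>m\<close> minus the
  number of nonzero rows; full dimension leaves no nonzero row.\<close>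

lemma kernel_dim_eq_dim_col_iff:
  fixes A :: "'a::field mat"
  assumes A: "A \<in> carrier_mat n m"
  shows "kernel_dim A = m \<longleftrightarrow> A = 0\<^sub>m n m"
proof -
  let ?G = "gauss_jordan_single A"
  obtain P Q where G: "?G = P * A" "Q * P = 1\<^sub>m n" "P \<in> carrier_mat n n" "Q \<in> carrier_mat n n"
      "?G \<in> carrier_mat n m" "row_echelon_form ?G"
    using gauss_jordan_single[OF A refl] by blast
  interpret K: kernel n m ?G by unfold_locales (rule G)
  interpret KA: kernel n m A by unfold_locales (rule A)
  have "kernel_dim A = K.dim"
    using mat_kernel_mult_eq[OF A G(3,4,2)] by (simp add: G(1))
  also have "K.dim = m - card {i. i < n \<and> row ?G i \<noteq> 0\<^sub>v m}"
    by (rule find_base_vectors(6)[OF G(6,5)])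
  finally have dim: "kernel_dim A = m - card {i. i < n \<and> row ?G i \<noteq> 0\<^sub>v m}" .
  have GA: "?G = 0\<^sub>m n m \<longleftrightarrow> A = 0\<^sub>m n m"
  proof
    assume "?G = 0\<^sub>m n m"
    then have "Q * (P * A) = 0\<^sub>m n m" using G by simp
    then show "A = 0\<^sub>m n m" using G A by (simp flip: assoc_mult_mat)
  qed (use G in simp)
  have "?G = 0\<^sub>m n m \<longleftrightarrow> (\<forall>i<n. row ?G i = 0\<^sub>v m)"
    using G(5) by (auto simp: mat_eq_iff vec_eq_iff)
  also have "\<dots> \<longleftrightarrow> m - card {i. i < n \<and> row ?G i \<noteq> 0\<^sub>v m} = m"
  \<comment> \<open>For \<open>m = 0\<close> the truncated difference carries no information, but
    then all rows are empty vectors and thus zero.\<close>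
  proof (cases "m = 0")
    case True
    then show ?thesis using G(5) by (auto simp: vec_eq_iff)
  next
    case False
    have "(\<forall>i<n. row ?G i = 0\<^sub>v m) \<longleftrightarrow> card {i. i < n \<and> row ?G i \<noteq> 0\<^sub>v m} = 0"
      by (subst card_0_eq) auto
    also have "\<dots> \<longleftrightarrow> m - card {i. i < n \<and> row ?G i \<noteq> 0\<^sub>v m} = m" using False by linarith
    finally show ?thesis .
  qed
  finally show ?thesis using GA dim by simp
qed

lemma kernel_dim_block_diag:
  fixes A :: "'a::field mat"
  assumes A: "A \<in> carrier_mat n n" and B: "B \<in> carrier_mat m m"
  shows "kernel_dim (four_block_mat A (0\<^sub>m n m) (0\<^sub>m m n) B) = kernel_dim A + kernel_dim B"
  unfolding kernel_dim_def using kernel_four_block_0_mat[OF refl A B] A B by simp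

lemma kernel_dim_similar_wit:
  assumes "A \<in> carrier_mat n n" "similar_mat_wit A B P Q"
  shows "kernel_dim A = kernel_dim B"
  unfolding kernel_dim_def using similar_mat_wit_kernel_dim[OF assms] similar_mat_witD2[OF assms] by simp

lemma poly_mat_similar_wit:
  assumes "similar_mat_wit A B P Q" and A: "A \<in> carrier_mat n n"
  shows "similar_mat_wit (poly_mat A p) (poly_mat B p) P Q"
proof -
  note w = similar_mat_witD2[OF A assms(1)]
  have c: "poly_mat A p \<in> carrier_mat n n" "poly_mat B p \<in> carrier_mat n n" for p
    using w poly_mat_carrier by auto
  have "poly_mat A p = P * poly_mat B p * Q"
  proof (induction p)
    case 0
    then show ?case using w by (simp add: poly_mat_0)
  next
    case (pCons a p)
    have "P * poly_mat B (pCons a p) * Q = P * (a \<cdot>\<^sub>m 1\<^sub>m n) * Q + P * (B * poly_mat B p) * Q"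
      using w c[of p]
      by (simp add: poly_mat_pCons mult_add_distrib_mat[of _ n n _ n] add_mult_distrib_mat[of _ n n _ _ n])
    also have "P * (a \<cdot>\<^sub>m 1\<^sub>m n) * Q = a \<cdot>\<^sub>m 1\<^sub>m n"
      using w by (simp add: mult_smult_distrib[of _ n n _ n] mult_smult_assoc_mat[of _ n n _ n])
    also have "P * (B * poly_mat B p) * Q = A * poly_mat A p"
    proof -
      have "A * poly_mat A p = (P * B * Q) * (P * poly_mat B p * Q)" using w pCons by simp
      also have "\<dots> = P * B * (Q * (P * poly_mat B p * Q))"
        using w(4-7) c(2)[of p] by (intro assoc_mult_mat[of _ n n _ n _ n]) auto
      also have "Q * (P * poly_mat B p * Q) = Q * P * poly_mat B p * Q"
        using w(4-7) c(2)[of p] by (simp add: assoc_mult_mat[of _ n n _ n _ n])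
      also have "\<dots> = poly_mat B p * Q" using w(2) c(2)[of p] by simp
      also have "P * B * (poly_mat B p * Q) = P * B * poly_mat B p * Q"
        using w(4-7) c(2)[of p] by (intro assoc_mult_mat[symmetric, of _ n n _ n _ n]) auto
      also have "P * B * poly_mat B p = P * (B * poly_mat B p)"
        using w(4-7) c(2)[of p] by (intro assoc_mult_mat[of _ n n _ n _ n]) auto
      finally show ?thesis by simp
    qed
    finally show ?case using w by (simp add: poly_mat_pCons)
  qed
  then show ?thesis using w c by (intro similar_mat_witI[of _ _ n]) auto
qed

lemma poly_mat_block_diag:
  assumes A: "A \<in> carrier_mat n n" and B: "B \<in> carrier_mat m m"
  shows "poly_mat (four_block_mat A (0\<^sub>m n m) (0\<^sub>m m n) B) p =
    four_block_mat (poly_mat A p) (0\<^sub>m n m) (0\<^sub>m m n) (poly_mat B p)"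
proof (induction p)
  case 0
  have "four_block_mat A (0\<^sub>m n m) (0\<^sub>m m n) B \<in> carrier_mat (n + m) (n + m)" using A B by simp
  then show ?case using A B by (simp add: poly_mat_0)
next
  case (pCons a p)
  let ?D = "four_block_mat A (0\<^sub>m n m) (0\<^sub>m m n) B"
  have D: "?D \<in> carrier_mat (n + m) (n + m)" using A B by simp
  have c: "poly_mat A p \<in> carrier_mat n n" "poly_mat B p \<in> carrier_mat m m"
    using A B poly_mat_carrier by auto
  have "?D * poly_mat ?D p = four_block_mat (A * poly_mat A p) (0\<^sub>m n m) (0\<^sub>m m n) (B * poly_mat B p)"
    unfolding pCons.IH using A B c by (simp add: mult_four_block_mat[of _ n n _ m _ m _ _ n _ m])
  then show ?case unfolding poly_mat_pCons[OF D] poly_mat_pCons[OF A] poly_mat_pCons[OF B]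
    using A B c by (intro eq_matI) auto
qed

lemma companion_carrier: "companion_mat P \<in> carrier_mat (degree P) (degree P)"
  by (simp add: companion_mat_def)

lemma poly_mat_mult_vec_pCons:
  assumes A: "A \<in> carrier_mat n n" and v: "v \<in> carrier_vec n"
  shows "poly_mat A (pCons a p) *\<^sub>v v = a \<cdot>\<^sub>v v + A *\<^sub>v (poly_mat A p *\<^sub>v v)"
proof -
  have c: "poly_mat A p \<in> carrier_mat n n" by (rule poly_mat_carrier[OF A])
  have "(a \<cdot>\<^sub>m 1\<^sub>m n) *\<^sub>v v = a \<cdot>\<^sub>v v" using v by (auto simp: row_smult)
  then show ?thesis unfolding poly_mat_pCons[OF A] using A c v
    by (simp add: add_mult_distrib_mat_vec[of _ n n] assoc_mult_mat_vec[of _ n n _ n])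
qed

text \<open>The first unit vector is cyclic: the matrix shifts a coefficient vector by one place as
  long as its last entry is 0, so that the last column is not touched.\<close>

lemma poly_mat_companion_unit_vec:
  assumes "degree p < degree P"
  shows "poly_mat (companion_mat P) p *\<^sub>v unit_vec (degree P) 0 = vec (degree P) (coeff p)"
  using assms
proof (induction p)
  case 0
  then show ?case by (auto simp: poly_mat_0[OF companion_carrier])
next
  case (pCons a p)
  let ?d = "degree P" let ?C = "companion_mat P"
  have "degree p < ?d" using pCons.prems pCons.hyps by (auto split: if_splits)
  note IH = pCons.IH[OF this]
  have last: "coeff p (?d - 1) = 0"
    using pCons.prems by (cases "p = 0") (auto intro: coeff_eq_0)
  have "?C *\<^sub>v vec ?d (coeff p) = vec ?d (\<lambda>i. case i of 0 \<Rightarrow> 0 | Suc j \<Rightarrow> coeff p j)"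
  proof (intro eq_vecI)
    fix i assume "i < dim_vec (vec ?d (\<lambda>i. case i of 0 \<Rightarrow> 0 | Suc j \<Rightarrow> coeff p j))"
    then have i: "i < ?d" by simp
    have "(?C *\<^sub>v vec ?d (coeff p)) $ i = (\<Sum>j<?d. ?C $$ (i,j) * coeff p j)"
      using i by (simp add: scalar_prod_def atLeast0LessThan)
    also have "\<dots> = (\<Sum>j<?d. if i = Suc j then coeff p j else 0)"
    proof (intro sum.cong refl)
      fix j assume "j \<in> {..<?d}"
      then show "?C $$ (i,j) * coeff p j = (if i = Suc j then coeff p j else 0)"
        using i last by (cases "j = ?d - 1") (auto simp: companion_mat_def)
    qed
    also have "\<dots> = (case i of 0 \<Rightarrow> 0 | Suc j \<Rightarrow> coeff p j)"
      using i by (cases i) auto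
    finally show "(?C *\<^sub>v vec ?d (coeff p)) $ i = vec ?d (\<lambda>i. case i of 0 \<Rightarrow> 0 | Suc j \<Rightarrow> coeff p j) $ i"
      using i by simp
  qed simp
  then show ?case
    unfolding poly_mat_mult_vec_pCons[OF companion_carrier unit_vec_carrier] IH
    by (auto simp: coeff_pCons split: nat.split)
qed

lemma poly_mat_commute:
  assumes A: "A \<in> carrier_mat n n"
  shows "poly_mat A p * poly_mat A q = poly_mat A q * poly_mat A p"
  by (simp add: poly_mat_mult[OF A, symmetric] mult.commute)

text \<open>It is enough to kill the first unit vector, since the other unit vectors arise from it
  by powers of the companion matrix, and these commute with every polynomial in it.\<close>

lemma poly_mat_companion_self:
  assumes P: "lead_coeff P = 1"
  shows "poly_mat (companion_mat P) P = 0\<^sub>m (degree P) (degree P)"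
proof -
  let ?C = "companion_mat P" and ?d = "degree P"
  note C = companion_carrier[of P]
  note cp = poly_mat_carrier[OF C]
  have e0: "poly_mat ?C P *\<^sub>v unit_vec ?d 0 = 0\<^sub>v ?d" if d: "0 < ?d"
  proof -
    \<comment> \<open>The lower part of \<open>P\<close> evaluates at the first unit vector to its
      coefficient vector, and the last column of the companion matrix is the negative of just that
      vector.\<close>
    define r where "r = P - monom 1 ?d"
    have "degree r \<le> ?d - 1"
    proof (intro degree_le allI impI)
      fix i assume "?d - 1 < i"
      then show "coeff r i = 0" using P d by (cases "i = ?d") (auto simp: r_def coeff_eq_0)
    qed
    then have r: "degree r < ?d" using d by linarith
    have "poly_mat ?C (monom 1 ?d) *\<^sub>v unit_vec ?d 0 = ?C *\<^sub>v (poly_mat ?C (monom 1 (?d - 1)) *\<^sub>v unit_vec ?d 0)"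
      using d cp[of "monom 1 (?d - 1)"]
      by (cases ?d) (auto simp: monom_Suc poly_mat_mult_vec_pCons[OF C])
    also have "poly_mat ?C (monom 1 (?d - 1)) *\<^sub>v unit_vec ?d 0 = unit_vec ?d (?d - 1)"
      using d by (subst poly_mat_companion_unit_vec) (auto simp: degree_monom_eq)
    also have "?C *\<^sub>v unit_vec ?d (?d - 1) = - vec ?d (coeff r)"
      using d by (intro eq_vecI) (auto simp: companion_mat_def r_def)
    finally have "poly_mat ?C (monom 1 ?d) *\<^sub>v unit_vec ?d 0 = - vec ?d (coeff r)" .
    then have "poly_mat ?C (monom 1 ?d) *\<^sub>v unit_vec ?d 0 + vec ?d (coeff r) = 0\<^sub>v ?d" by simp
    moreover have "poly_mat ?C P *\<^sub>v unit_vec ?d 0 =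
        poly_mat ?C (monom 1 ?d) *\<^sub>v unit_vec ?d 0 + poly_mat ?C r *\<^sub>v unit_vec ?d 0"
      using cp[of "monom 1 ?d"] cp[of r]
      by (simp add: add_mult_distrib_mat_vec[of _ ?d ?d, symmetric] poly_mat_add[OF C, symmetric] r_def)
    ultimately show ?thesis unfolding poly_mat_companion_unit_vec[OF r] by simp
  qed
  have shift: "unit_vec ?d i = poly_mat ?C (monom 1 i) *\<^sub>v unit_vec ?d 0" if "i < ?d" for i
    using that by (subst poly_mat_companion_unit_vec) (auto simp: degree_monom_eq)
  have "poly_mat ?C P *\<^sub>v unit_vec ?d i = 0\<^sub>v ?d" if i: "i < ?d" for i
  proof -
    have "poly_mat ?C P *\<^sub>v unit_vec ?d i = (poly_mat ?C P * poly_mat ?C (monom 1 i)) *\<^sub>v unit_vec ?d 0"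
      unfolding shift[OF i] using cp[of P] cp[of "monom 1 i"] by (simp add: assoc_mult_mat_vec[of _ ?d ?d _ ?d])
    also have "\<dots> = poly_mat ?C (monom 1 i) *\<^sub>v (poly_mat ?C P *\<^sub>v unit_vec ?d 0)"
      unfolding poly_mat_commute[OF C, of P] using cp[of P] cp[of "monom 1 i"]
      by (simp add: assoc_mult_mat_vec[of _ ?d ?d _ ?d])
    also have "\<dots> = 0\<^sub>v ?d" using e0 i cp[of "monom 1 i"] by auto
    finally show ?thesis .
  qed
  then have "col (poly_mat ?C P) i = 0\<^sub>v ?d" if "i < ?d" for i
    using that cp[of P] by (auto simp: vec_eq_iff)
  then show ?thesis using cp[of P] by (intro mat_col_eqI) auto
qed

lemma poly_mat_companion_eq_0_iff:
  assumes P: "lead_coeff P = 1"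
  shows "poly_mat (companion_mat P) p = 0\<^sub>m (degree P) (degree P) \<longleftrightarrow> P dvd p"
proof
  let ?C = "companion_mat P" and ?d = "degree P"
  note cp = poly_mat_carrier[OF companion_carrier[of P]]
  assume 0: "poly_mat ?C p = 0\<^sub>m ?d ?d"
  define r where "r = p mod P"
  have P0: "P \<noteq> 0" using P by auto
  have "poly_mat ?C p = poly_mat ?C (p div P * P + r)" by (simp add: r_def)
  also have "\<dots> = poly_mat ?C (p div P) * poly_mat ?C P + poly_mat ?C r"
    by (simp only: poly_mat_add[OF companion_carrier] poly_mat_mult[OF companion_carrier])
  also have "\<dots> = poly_mat ?C r"
    unfolding poly_mat_companion_self[OF P] using cp[of "p div P"] cp[of r] by simp
  finally have r0: "poly_mat ?C r = 0\<^sub>m ?d ?d" using 0 by simp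
  have "r = 0"
  proof (rule ccontr)
    assume "r \<noteq> 0"
    then have r: "degree r < ?d" using degree_mod_less[OF P0, of p] by (simp add: r_def)
    have "vec ?d (coeff r) = 0\<^sub>v ?d"
      using r by (subst poly_mat_companion_unit_vec[OF r, symmetric], subst r0) auto
    then have "coeff r (degree r) = 0" using r by (simp add: vec_eq_iff)
    with \<open>r \<noteq> 0\<close> show False by simp
  qed
  then show "P dvd p" by (simp add: r_def mod_eq_0_iff_dvd)
next
  assume "P dvd p"
  then obtain q where "p = q * P" by (metis dvdE mult.commute)
  then show "poly_mat (companion_mat P) p = 0\<^sub>m (degree P) (degree P)"
    using poly_mat_carrier[OF companion_carrier[of P], of q]
    by (simp add: poly_mat_mult[OF companion_carrier] poly_mat_companion_self[OF P])
qed

lemma companion_blocks_carrier: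
  "companion_blocks Ps \<in> carrier_mat (\<Sum>P\<leftarrow>Ps. degree P) (\<Sum>P\<leftarrow>Ps. degree P)"
  by (intro carrier_matI) simp_all

lemma kernel_dim_poly_companion_blocks:
  "kernel_dim (poly_mat (companion_blocks Ps) p) = (\<Sum>P\<leftarrow>Ps. kernel_dim (poly_mat (companion_mat P) p))"
proof (induction Ps)
  case Nil
  have "poly_mat (0\<^sub>m 0 0) p = (0\<^sub>m 0 0 :: 'a mat)"
    using poly_mat_carrier[of "0\<^sub>m 0 0 :: 'a mat" 0 p] by auto
  then show ?case using kernel_dim_le[of "0\<^sub>m 0 0 :: 'a mat"] by simp
next
  case (Cons P Ps)
  have "companion_blocks (P # Ps) = four_block_mat (companion_mat P)
      (0\<^sub>m (degree P) (\<Sum>P\<leftarrow>Ps. degree P)) (0\<^sub>m (\<Sum>P\<leftarrow>Ps. degree P) (degree P)) (companion_blocks Ps)"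
    by (simp add: Let_def)
  then show ?case
    using kernel_dim_block_diag[OF poly_mat_carrier[OF companion_carrier[of P]] poly_mat_carrier[OF companion_blocks_carrier[of Ps]], of p p]
    by (simp add: poly_mat_block_diag[OF companion_carrier companion_blocks_carrier] Cons.IH)
qed

lemma is_invariant_factors_carrier:
  assumes "is_invariant_factors A Ps"
  shows "A \<in> carrier_mat (length Ps) (length Ps)" "(\<Sum>P\<leftarrow>Ps. degree P) = length Ps"
proof -
  have s: "similar_mat A (companion_blocks Ps)" and len: "length Ps = dim_row A"
    using assms by (auto simp: is_invariant_factors_def)
  from similar_matD[OF s] obtain n where n: "A \<in> carrier_mat n n" "companion_blocks Ps \<in> carrier_mat n n"
    by blast
  with len show "A \<in> carrier_mat (length Ps) (length Ps)" by auto
  show "(\<Sum>P\<leftarrow>Ps. degree P) = length Ps" using n len carrier_matD(1)[OF n(2)] by simp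
qed

lemma kernel_dim_invariant_factors:
  assumes "is_invariant_factors A Ps"
  shows "kernel_dim (poly_mat A p) = (\<Sum>i<length Ps. kernel_dim (poly_mat (companion_mat (Ps ! i)) p))"
proof -
  note A = is_invariant_factors_carrier(1)[OF assms]
  obtain P Q where "similar_mat_wit A (companion_blocks Ps) P Q"
    using assms by (auto simp: is_invariant_factors_def similar_mat_def)
  from kernel_dim_similar_wit[OF poly_mat_carrier[OF A] poly_mat_similar_wit[OF this A]]
  show ?thesis
    by (simp add: kernel_dim_poly_companion_blocks sum_list_sum_nth atLeast0LessThan)
qed

text \<open>The tool for uniqueness: the equality case detects divisibility by \<open>P\<close>
  through a dimension, and dimensions of kernels are invariant under similarity.\<close>

lemma kernel_dim_poly_companion:
  assumes "lead_coeff P = 1"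
  shows "kernel_dim (poly_mat (companion_mat P) p) \<le> degree P"
    and "kernel_dim (poly_mat (companion_mat P) p) = degree P \<longleftrightarrow> P dvd p"
proof -
  note c = poly_mat_carrier[OF companion_carrier[of P], of p]
  show "kernel_dim (poly_mat (companion_mat P) p) \<le> degree P"
    using kernel_dim_le[of "poly_mat (companion_mat P) p"] c by simp
  show "kernel_dim (poly_mat (companion_mat P) p) = degree P \<longleftrightarrow> P dvd p"
    using kernel_dim_eq_dim_col_iff[OF c] poly_mat_companion_eq_0_iff[OF assms] by simp
qed

lemma invariant_factors_chain:
  assumes "is_invariant_factors A Ps" "i \<le> j" "j < length Ps"
  shows "Ps ! i dvd Ps ! j"
  using assms(2,3)
proof (induction j rule: dec_induct)
  case (step j)
  then have "Ps ! j dvd Ps ! (j + 1)" using assms(1) by (auto simp: is_invariant_factors_def)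
  with step show ?case using dvd_trans by fastforce
qed simp

text \<open>Comparing \<open>dim ker Ps\<^sub>i(A)\<close> for both lists at the last index \<open>i\<close> where they differ: the terms after
  \<open>i\<close> agree, and up to \<open>i\<close> those of \<open>Ps\<close> attain the upper bound \<open>degree\<close>, hence so do those of \<open>Qs\<close>.\<close>
lemma invariant_factors_dvd:
  assumes Ps: "is_invariant_factors A Ps" and Qs: "is_invariant_factors A Qs"
    and i: "i < length Ps" and eq: "\<And>j. i < j \<Longrightarrow> j < length Ps \<Longrightarrow> Ps ! j = Qs ! j"
  shows "Qs ! i dvd Ps ! i"
proof -
  let ?n = "length Ps"
  have len: "length Qs = ?n" using Ps Qs by (simp add: is_invariant_factors_def)
  define K where "K P = kernel_dim (poly_mat (companion_mat P) (Ps ! i))" for P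
  have monic: "lead_coeff (Ps ! j) = 1" "lead_coeff (Qs ! j) = 1" if "j < ?n" for j
    using that Ps Qs len by (simp_all add: is_invariant_factors_def)
  have split: "(\<Sum>j<?n. f j) = (\<Sum>j<Suc i. f j) + (\<Sum>j=Suc i..<?n. f j)" for f :: "nat \<Rightarrow> nat"
    using i by (metis Suc_leI atLeast0LessThan sum.atLeastLessThan_concat zero_le)
  have "(\<Sum>j<?n. K (Ps ! j)) = (\<Sum>j<?n. K (Qs ! j))"
    using kernel_dim_invariant_factors[OF Ps, of "Ps ! i"] kernel_dim_invariant_factors[OF Qs, of "Ps ! i"]
    unfolding K_def len by simp
  moreover have "(\<Sum>j=Suc i..<?n. K (Ps ! j)) = (\<Sum>j=Suc i..<?n. K (Qs ! j))"
    using eq by (intro sum.cong) auto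
  ultimately have "(\<Sum>j<Suc i. K (Ps ! j)) = (\<Sum>j<Suc i. K (Qs ! j))"
    unfolding split by linarith
  also have "(\<Sum>j<Suc i. K (Ps ! j)) = (\<Sum>j<Suc i. degree (Ps ! j))"
    using i kernel_dim_poly_companion(2)[OF monic(1)] invariant_factors_chain[OF Ps] unfolding K_def
    by (intro sum.cong) auto
  also have "(\<Sum>j<Suc i. degree (Ps ! j)) = (\<Sum>j<Suc i. degree (Qs ! j))"
  proof -
    have "(\<Sum>j<?n. degree (Ps ! j)) = (\<Sum>j<?n. degree (Qs ! j))"
      using is_invariant_factors_carrier(2)[OF Ps] is_invariant_factors_carrier(2)[OF Qs] len
      by (simp add: sum_list_sum_nth atLeast0LessThan)
    moreover have "(\<Sum>j=Suc i..<?n. degree (Ps ! j)) = (\<Sum>j=Suc i..<?n. degree (Qs ! j))"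
      using eq by (intro sum.cong) auto
    ultimately show ?thesis unfolding split by linarith
  qed
  finally have sum_eq: "(\<Sum>j<Suc i. degree (Qs ! j)) = (\<Sum>j<Suc i. K (Qs ! j))" .
  have "K (Qs ! i) = degree (Qs ! i)"
  proof (rule ccontr)
    assume "K (Qs ! i) \<noteq> degree (Qs ! i)"
    then have "K (Qs ! i) < degree (Qs ! i)"
      using kernel_dim_poly_companion(1)[OF monic(2)[OF i], of "Ps ! i"] unfolding K_def by linarith
    moreover have "(\<Sum>j<i. K (Qs ! j)) \<le> (\<Sum>j<i. degree (Qs ! j))"
      using i kernel_dim_poly_companion(1)[OF monic(2)] unfolding K_def by (intro sum_mono) auto
    ultimately show False using sum_eq by simp
  qed
  then show ?thesis using kernel_dim_poly_companion(2)[OF monic(2)[OF i]] unfolding K_def by simp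
qed

lemma monic_dvd_antisym:
  fixes p q :: "'a::field poly"
  assumes "p dvd q" "q dvd p" and monic: "lead_coeff p = 1" "lead_coeff q = 1"
  shows "p = q"
proof -
  obtain c where c: "q = p * c" using assms(1) by (elim dvdE)
  have 0: "p \<noteq> 0" "q \<noteq> 0" using monic by auto
  have "degree q \<le> degree p" using assms(2) 0 by (intro dvd_imp_degree_le)
  moreover have "degree q = degree p + degree c" using c 0 by (auto intro!: degree_mult_eq)
  ultimately have "degree c = 0" by simp
  then obtain a where "c = [:a:]" by (rule degree_eq_zeroE)
  moreover have "lead_coeff c = 1" using c monic by (metis lead_coeff_mult mult_1)
  ultimately show ?thesis using c by simp
qed

theorem invariant_factors_unique:
  assumes Ps: "is_invariant_factors A Ps" and Qs: "is_invariant_factors A Qs"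
  shows "Ps = Qs"
proof -
  let ?n = "length Ps"
  have len: "length Qs = ?n" using Ps Qs by (simp add: is_invariant_factors_def)
  \<comment> \<open>Descending induction: \<open>k\<close> is the number of final entries already
    known to agree.\<close>
  have "\<forall>j. ?n - k \<le> j \<and> j < ?n \<longrightarrow> Ps ! j = Qs ! j" for k
  proof (induction k)
    case (Suc k)
    show ?case
    proof (cases "k < ?n")
      case True
      define i where "i = ?n - Suc k"
      have i: "i < ?n" "?n - k = Suc i" using True by (auto simp: i_def)
      have eq: "Ps ! j = Qs ! j" if "i < j" "j < ?n" for j using Suc.IH that i by auto
      have "Qs ! i dvd Ps ! i" by (rule invariant_factors_dvd[OF Ps Qs i(1) eq])
      moreover have "Ps ! i dvd Qs ! i"
        by (rule invariant_factors_dvd[OF Qs Ps]) (use i eq len in auto)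
      moreover have "lead_coeff (Ps ! i) = 1" "lead_coeff (Qs ! i) = 1"
        using Ps Qs i len by (auto simp: is_invariant_factors_def)
      ultimately have "Ps ! i = Qs ! i" by (intro monic_dvd_antisym) auto
      then show ?thesis using eq unfolding i_def by (metis i_def le_neq_implies_less)
    qed (use Suc in auto)
  qed auto
  from this[of ?n] show ?thesis using len by (intro nth_equalityI) auto
qed

lemma invariant_factors:
  assumes "A \<in> carrier_mat n n"
  shows "is_invariant_factors A (invariant_factors A)"
  unfolding invariant_factors_def
  using invariant_factors_generators[OF assms] invariant_factors_unique by (metis theI)

section \<open>Necessity\<close>

lemma pow_mat_mult_vec:
  assumes "M \<in> carrier_mat n n" "v \<in> carrier_vec n"
  shows "(M ^\<^sub>m k) *\<^sub>v v = (((*\<^sub>v) M) ^^ k) v"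
  using assms(2)
proof (induction k arbitrary: v)
  case (Suc k)
  have "(M ^\<^sub>m Suc k) *\<^sub>v v = (M ^\<^sub>m k) *\<^sub>v (M *\<^sub>v v)"
    using assms(1) Suc.prems by (simp add: assoc_mult_mat_vec[of _ n n _ n])
  also have "\<dots> = (((*\<^sub>v) M) ^^ k) (M *\<^sub>v v)" using assms(1) Suc.prems by (intro Suc.IH) simp
  finally show ?case by (simp add: funpow_swap1)
qed (use assms in simp)

lemma pow_mat_Suc_left:
  assumes "M \<in> carrier_mat n n"
  shows "M ^\<^sub>m Suc k = M * M ^\<^sub>m k"
proof (induction k)
  case (Suc k)
  have "M ^\<^sub>m Suc (Suc k) = M * M ^\<^sub>m k * M" using Suc by simp
  also have "\<dots> = M * (M ^\<^sub>m k * M)" using assms by (intro assoc_mult_mat[of _ n n _ n _ n]) auto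
  finally show ?case by simp
qed (use assms in simp)

text \<open>For the row (1, l, ..., l^(d-1)) the shifting columns multiply by \<open>l\<close>, and
  the last column produces l^d because \<open>P\<close> vanishes at \<open>l\<close>.\<close>

lemma left_eigenvectors_companion:
  fixes P :: "'a::field poly"
  assumes P: "lead_coeff P = 1" "poly P l = 0"
  shows "mat 1 (degree P) (\<lambda>(i,j). l ^ j) * companion_mat P = l \<cdot>\<^sub>m mat 1 (degree P) (\<lambda>(i,j). l ^ j)"
proof (intro eq_matI)
  fix i j assume "i < dim_row (l \<cdot>\<^sub>m mat 1 (degree P) (\<lambda>(i,j). l ^ j))" "j < dim_col (l \<cdot>\<^sub>m mat 1 (degree P) (\<lambda>(i,j). l ^ j))"
  then have i: "i = 0" and j: "j < degree P" by auto
  have "(mat 1 (degree P) (\<lambda>(i,j). l ^ j) * companion_mat P) $$ (i,j) =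
      (\<Sum>k<degree P. l ^ k * companion_mat P $$ (k,j))"
    using i j by (simp add: scalar_prod_def atLeast0LessThan)
  also have "\<dots> = l * l ^ j"
  proof (cases "j + 1 = degree P")
    case True
    have "(\<Sum>k<degree P. l ^ k * companion_mat P $$ (k,j)) = (\<Sum>k<degree P. - (coeff P k * l ^ k))"
      using True j by (intro sum.cong) (auto simp: companion_mat_def)
    also have "\<dots> = l ^ degree P"
      using P by (simp add: poly_altdef sum_negf lessThan_Suc_atMost[symmetric] eq_neg_iff_add_eq_0 add.commute neg_eq_iff_add_eq_0)
    finally show ?thesis by (simp flip: True)
  next
    case False
    have "(\<Sum>k<degree P. l ^ k * companion_mat P $$ (k,j)) = (\<Sum>k<degree P. if k = Suc j then l ^ k else 0)"
      using False j by (intro sum.cong) (auto simp: companion_mat_def)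
    then show ?thesis using False j by simp
  qed
  finally show "(mat 1 (degree P) (\<lambda>(i,j). l ^ j) * companion_mat P) $$ (i,j) =
      (l \<cdot>\<^sub>m mat 1 (degree P) (\<lambda>(i,j). l ^ j)) $$ (i,j)" using i j by simp
qed auto

text \<open>Every block with the root \<open>l\<close> contributes one row of powers, padded with
  zeros. The final conjunct is the independence of these rows.\<close>

lemma left_eigenvectors_companion_blocks:
  fixes Ps :: "'a::field poly list" and l :: 'a
  assumes "\<And>P. P \<in> set Ps \<Longrightarrow> lead_coeff P = 1"
  defines "m \<equiv> \<Sum>P\<leftarrow>Ps. degree P" and "r \<equiv> length (filter (\<lambda>P. poly P l = 0) Ps)"
  shows "\<exists>G\<in>carrier_mat r m. G * companion_blocks Ps = l \<cdot>\<^sub>m G \<and>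
    (\<forall>c. (\<forall>j<m. (\<Sum>i<r. c i * G $$ (i,j)) = 0) \<longrightarrow> (\<forall>i<r. c i = 0))"
  using assms(1) unfolding m_def r_def
proof (induction Ps)
  case Nil
  show ?case by (intro bexI[of _ "0\<^sub>m 0 0"]) auto
next
  case (Cons P Ps)
  define m where "m = (\<Sum>P\<leftarrow>Ps. degree P)"
  define r where "r = length (filter (\<lambda>P. poly P l = 0) Ps)"
  \<comment> \<open>A block without the root \<open>l\<close> contributes a matrix with no rows, so
    both cases share one block computation.\<close>
  define t :: nat where "t = (if poly P l = 0 then 1 else 0)"
  let ?d = "degree P"
  obtain G where G: "G \<in> carrier_mat r m" "G * companion_blocks Ps = l \<cdot>\<^sub>m G"
    and inj: "\<And>c. (\<forall>j<m. (\<Sum>i<r. c i * G $$ (i,j)) = 0) \<Longrightarrow> (\<forall>i<r. c i = 0)"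
    using Cons unfolding m_def r_def by auto
  define R where "R = mat t ?d (\<lambda>(i,j). l ^ j)"
  have R: "R \<in> carrier_mat t ?d" by (simp add: R_def)
  have RC: "R * companion_mat P = l \<cdot>\<^sub>m R"
    using left_eigenvectors_companion[of P l] Cons.prems[of P] by (auto simp: R_def t_def)
  have deg: "t \<le> ?d" 
  proof (cases "poly P l = 0")
    case True
    have "?d \<noteq> 0"
    proof
      assume "?d = 0"
      then obtain a where "P = [:a:]" by (rule degree_eq_zeroE)
      with True Cons.prems[of P] show False by simp
    qed
    then show ?thesis by (simp add: t_def)
  qed (simp add: t_def)
  let ?G = "four_block_mat R (0\<^sub>m t m) (0\<^sub>m r ?d) G"
  have "?G * four_block_mat (companion_mat P) (0\<^sub>m ?d m) (0\<^sub>m m ?d) (companion_blocks Ps) = l \<cdot>\<^sub>m ?G"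
    using R G companion_blocks_carrier[of Ps, folded m_def] companion_carrier[of P]
    by (subst mult_four_block_mat[of _ t ?d _ m _ r _ _ ?d _ m]) (auto simp: RC intro!: eq_matI)
  moreover have "companion_blocks (P # Ps) = four_block_mat (companion_mat P) (0\<^sub>m ?d m) (0\<^sub>m m ?d) (companion_blocks Ps)"
    by (simp add: Let_def m_def)
  moreover have "c i = 0" if c: "\<forall>j<?d + m. (\<Sum>i<t + r. c i * ?G $$ (i,j)) = 0" and i: "i < t + r" for c i
  proof -
    have entry: "?G $$ (i,j) = (if i < t then if j < ?d then l ^ j else 0 else if j < ?d then 0 else G $$ (i - t, j - ?d))"
      if "i < t + r" "j < ?d + m" for i j using that R G by (auto simp: R_def)
    have "(\<Sum>i<r. c (t + i) * G $$ (i,j)) = 0" if "j < m" for j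
    proof -
      have "(\<Sum>i<t + r. c i * ?G $$ (i,?d + j)) = (\<Sum>i<r. c (t + i) * G $$ (i,j))"
        using that unfolding sum_lessThan_add by (simp add: entry del: index_mat_four_block)
      then show ?thesis using c that by simp
    qed
    then have 1: "\<forall>i<r. c (t + i) = 0" using inj[of "\<lambda>i. c (t + i)"] by blast
    have 2: "c i = 0" if "i < t" for i
    proof -
      \<comment> \<open>The row of powers starts with 1 and the rows of \<open>G\<close> are padded
        there, so column 0 isolates \<open>c 0\<close>.\<close>
      have t: "t = 1" and i: "i = 0" using that by (simp_all add: t_def split: if_splits)
      have "?G $$ (i,0) = (if i < t then 1 else 0)" if "i < t + r" for i
        using t deg that by (subst entry) auto
      then have "(\<Sum>i<t + r. c i * ?G $$ (i,0)) = (\<Sum>i<t + r. c i * (if i < t then 1 else 0))"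
        by (intro sum.cong refl) (simp only: lessThan_iff)
      also have "\<dots> = c 0" unfolding sum_lessThan_add using t by simp
      finally have "(\<Sum>i<t + r. c i * ?G $$ (i,0)) = c 0" .
      then show ?thesis using c deg t i by auto
    qed
    show ?thesis
    proof (cases "i < t")
      case False
      then show ?thesis using spec[OF 1, of "i - t"] i by simp
    qed (rule 2)
  qed
  moreover have "length (filter (\<lambda>P. poly P l = 0) (P # Ps)) = t + r" by (simp add: t_def r_def)
  moreover have "(\<Sum>P\<leftarrow>P # Ps. degree P) = ?d + m" by (simp add: m_def)
  moreover have "?G \<in> carrier_mat (t + r) (?d + m)" using R G by simp
  ultimately show ?case by (intro bexI[of _ ?G]) auto
qed

text \<open>The columns of \<open>E\<close> and those of \<open>V * E\<close> are too many to be independent, so the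
  \<open>l\<close>-eigenspace of \<open>V * M\<close> contains a nonzero \<open>w\<close> together with \<open>V w\<close>; then \<open>M\<^sup>2 w = l\<^sup>2 w\<close>.\<close>
lemma involution_nilpotent_eigenvectors:
  fixes M V E :: "'a::field mat"
  assumes M: "M \<in> carrier_mat n n" "M ^\<^sub>m k = 0\<^sub>m n n"
    and V: "V \<in> carrier_mat n n" "V * V = 1\<^sub>m n"
    and E: "E \<in> carrier_mat n r" "V * M * E = l \<cdot>\<^sub>m E"
    and inj: "\<And>c. c \<in> carrier_vec r \<Longrightarrow> E *\<^sub>v c = 0\<^sub>v n \<Longrightarrow> c = 0\<^sub>v r"
    and l: "l \<noteq> 0"
  shows "2 * r \<le> n"
proof (rule ccontr)
  assume "\<not> 2 * r \<le> n"
  define Z where "Z = V * E"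
  have Z: "Z \<in> carrier_mat n r" using V E by (simp add: Z_def)
  \<comment> \<open>\<open>H\<close> is \<open>E\<close> and \<open>V * E\<close> side by side. With
    more columns than rows it has a kernel vector, whose halves \<open>c\<close> and
    \<open>d\<close> give \<open>w = E c\<close> and \<open>u = E d\<close> with
    \<open>w + V u = 0\<close>.\<close>
  define H where "H = mat n (r + r) (\<lambda>(i,j). if j < r then E $$ (i,j) else Z $$ (i,j - r))"
  have H: "H \<in> carrier_mat n (r + r)" by (simp add: H_def)
  obtain x where x: "x \<in> carrier_vec (r + r)" "x \<noteq> 0\<^sub>v (r + r)" "H *\<^sub>v x = 0\<^sub>v n"
    using wide_mat_kernel[OF H] \<open>\<not> 2 * r \<le> n\<close> by auto
  define c where "c = vec r (\<lambda>i. x $ i)"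
  define d where "d = vec r (\<lambda>i. x $ (r + i))"
  define w where "w = E *\<^sub>v c"
  define u where "u = E *\<^sub>v d"
  have car: "c \<in> carrier_vec r" "d \<in> carrier_vec r" "w \<in> carrier_vec n" "u \<in> carrier_vec n"
    using E(1) by (auto simp: c_def d_def w_def u_def)
  have "w + V *\<^sub>v u = H *\<^sub>v x"
  proof (intro eq_vecI)
    fix i assume "i < dim_vec (H *\<^sub>v x)"
    then have i: "i < n" using H by simp
    have "(H *\<^sub>v x) $ i = (\<Sum>j<r + r. H $$ (i,j) * x $ j)"
      using i H x(1) by (simp add: scalar_prod_def atLeast0LessThan)
    also have "\<dots> = (E *\<^sub>v c) $ i + (Z *\<^sub>v d) $ i"
      using i E(1) Z unfolding sum_lessThan_add
      by (simp add: scalar_prod_def atLeast0LessThan H_def c_def d_def)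
    also have "Z *\<^sub>v d = (V * E) *\<^sub>v d" by (simp only: Z_def)
    also have "(V * E) *\<^sub>v d = V *\<^sub>v u"
      unfolding u_def by (rule assoc_mult_mat_vec[OF V(1) E(1) car(2)])
    finally show "(w + V *\<^sub>v u) $ i = (H *\<^sub>v x) $ i" using i car V by (simp add: w_def)
  qed (use H car V in auto)
  then have "w + V *\<^sub>v u = 0\<^sub>v n" using x by simp
  then have w: "w = - (V *\<^sub>v u)"
    using car V by (auto simp: vec_eq_iff eq_neg_iff_add_eq_0)
  have VV: "V *\<^sub>v (V *\<^sub>v y) = y" if "y \<in> carrier_vec n" for y
    using that V by (simp flip: assoc_mult_mat_vec[of _ n n _ n])
  have neg: "V *\<^sub>v (- y) = - (V *\<^sub>v y)" if "y \<in> carrier_vec n" for y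
    using that V(1) by (intro eq_vecI) auto
  have u: "u = - (V *\<^sub>v w)"
    unfolding w using V(1) car VV[of u] by (simp add: neg)
  have "w \<noteq> 0\<^sub>v n"
  proof
    assume w0: "w = 0\<^sub>v n"
    then have "c = 0\<^sub>v r" using inj car unfolding w_def by simp
    moreover have "u = 0\<^sub>v n" unfolding u w0 using V by auto
    then have "d = 0\<^sub>v r" using inj car unfolding u_def by simp
    ultimately have 0: "\<forall>i<r. x $ i = 0" "\<forall>i<r. x $ (r + i) = 0"
      by (auto simp: c_def d_def vec_eq_iff)
    have "x $ i = 0" if "i < r + r" for i
      using that 0(1) spec[OF 0(2), of "i - r"] by (cases "i < r") auto
    with x(1,2) show False by (auto simp: vec_eq_iff)
  qed
  have eig: "M *\<^sub>v (E *\<^sub>v y) = l \<cdot>\<^sub>v (V *\<^sub>v (E *\<^sub>v y))" if y: "y \<in> carrier_vec r" for y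
  proof -
    have Ey: "E *\<^sub>v y \<in> carrier_vec n" using E(1) y by simp
    have "V *\<^sub>v (M *\<^sub>v (E *\<^sub>v y)) = (V * M) *\<^sub>v (E *\<^sub>v y)"
      by (rule assoc_mult_mat_vec[OF V(1) M(1) Ey, symmetric])
    also have "\<dots> = (V * M * E) *\<^sub>v y"
      using V M E(1) y by (intro assoc_mult_mat_vec[of _ n n _ r, symmetric]) auto
    also have "\<dots> = l \<cdot>\<^sub>v (E *\<^sub>v y)"
      unfolding E(2) using E y by (auto simp: row_smult)
    finally have "V *\<^sub>v (V *\<^sub>v (M *\<^sub>v (E *\<^sub>v y))) = V *\<^sub>v (l \<cdot>\<^sub>v (E *\<^sub>v y))" by simp
    then show ?thesis using VV[of "M *\<^sub>v (E *\<^sub>v y)"] M V Ey by (simp add: mult_mat_vec[of _ n n])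
  qed
  \<comment> \<open>Both \<open>w\<close> and \<open>u\<close> are eigenvectors of
    \<open>V * M\<close>, and \<open>V\<close> exchanges them up to sign. Cancelling
    \<open>V\<close> shows that \<open>M\<close> exchanges them up to the factor
    \<open>- l\<close>.\<close>
  have Mw: "M *\<^sub>v w = - (l \<cdot>\<^sub>v u)"
    using eig[OF car(1)] car V unfolding w_def[symmetric] u by (auto simp: mult_mat_vec_carrier[of _ n n])
  have Mu: "M *\<^sub>v u = - (l \<cdot>\<^sub>v w)"
    using eig[OF car(2)] car V unfolding u_def[symmetric] w by (auto simp: mult_mat_vec_carrier[of _ n n])
  have MM: "M *\<^sub>v (M *\<^sub>v (a \<cdot>\<^sub>v w)) = (a * (l * l)) \<cdot>\<^sub>v w" for a
  proof -
    have "M *\<^sub>v (a \<cdot>\<^sub>v w) = (- (a * l)) \<cdot>\<^sub>v u" using M car by (auto simp: mult_mat_vec[of _ n n] Mw)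
    then have "M *\<^sub>v (M *\<^sub>v (a \<cdot>\<^sub>v w)) = (- (a * l)) \<cdot>\<^sub>v (M *\<^sub>v u)" using M car by (simp add: mult_mat_vec[of _ n n])
    then show ?thesis unfolding Mu using car by (auto simp: mult.assoc)
  qed
  have "(((*\<^sub>v) M) ^^ (2 * j)) w = (l * l) ^ j \<cdot>\<^sub>v w" for j
  proof (induction j)
    case (Suc j)
    then show ?case using MM[of "(l * l) ^ j"] by (simp add: mult.commute)
  qed (use car in simp)
  from this[of k] have "(l * l) ^ k \<cdot>\<^sub>v w = (((*\<^sub>v) M) ^^ (2 * k)) w" by simp
  also have "\<dots> = (((*\<^sub>v) M) ^^ k) ((((*\<^sub>v) M) ^^ k) w)" by (simp add: mult_2 funpow_add)
  also have "(((*\<^sub>v) M) ^^ k) w = 0\<^sub>v n"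
    unfolding pow_mat_mult_vec[OF M(1) car(3), symmetric] M(2) using car by (intro eq_vecI) auto
  also have "(((*\<^sub>v) M) ^^ k) (0\<^sub>v n) = 0\<^sub>v n"
    unfolding pow_mat_mult_vec[OF M(1) zero_carrier_vec, symmetric] M(2) by (intro eq_vecI) auto
  finally have "w = 0\<^sub>v n" using l car by (auto simp: vec_eq_iff)
  with \<open>w \<noteq> 0\<^sub>v n\<close> show False ..
qed

section \<open>Base change to the algebraic closure\<close>

text \<open>The size is taken from \<open>A\<close> so that diagonal blocks of any size, including
  0, can be treated by one predicate.\<close>

definition nilpotent_involution_product :: "'a::field mat \<Rightarrow> bool" where
  "nilpotent_involution_product A \<longleftrightarrow> (\<exists>N U. N \<in> carrier_mat (dim_row A) (dim_row A) \<and>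
     U \<in> carrier_mat (dim_row A) (dim_row A) \<and> nilpotent_mat N \<and> involutive_mat U \<and> A = N * U)"

interpretation to_ac: inj_comm_ring_hom "to_ac :: 'a::field \<Rightarrow> 'a alg_closure"
  by unfold_locales auto

lemma map_mat_companion_blocks:
  "map_mat to_ac (companion_blocks Ps) = companion_blocks (map (map_poly to_ac) Ps)"
proof (induction Ps)
  case (Cons P Ps)
  have deg: "degree (map_poly to_ac p) = degree p" for p :: "'a poly"
    by (rule degree_map_poly) simp
  have "map_mat to_ac (companion_mat P) = companion_mat (map_poly to_ac P)"
    by (rule eq_matI) (auto simp: companion_mat_def deg coeff_map_poly)
  with Cons.IH[symmetric] show ?case
    by (simp add: Let_def map_four_block_mat[OF companion_carrier _ _ companion_blocks_carrier])
       (intro arg_cong2[of _ _ _ _ "\<lambda>x y. four_block_mat _ x y _"]; auto simp: deg)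
qed auto

text \<open>The transpose of \<open>A = N * U\<close> is the transpose of \<open>U\<close> times
  that of \<open>N\<close>, again an involution times a nilpotent matrix, and left eigenvectors of
  \<open>A\<close> become its eigenvectors.\<close>

lemma nilpotent_involution_product_bound:
  fixes A :: "'a::field mat"
  assumes Ps: "is_invariant_factors A Ps" and A: "A \<in> carrier_mat n n"
    and prod: "nilpotent_involution_product A"
    and l: "l \<noteq> 0"
  shows "2 * length (filter (\<lambda>P. poly (map_poly to_ac P) l = 0) Ps) \<le> n"
proof -
  have dA: "dim_row A = n" using A by simp
  obtain N U where NU: "N \<in> carrier_mat n n" "U \<in> carrier_mat n n" "nilpotent_mat N" "involutive_mat U"
      and AN: "A = N * U"
    using prod unfolding nilpotent_involution_product_def dA by blast
  have U: "U \<in> carrier_mat n n" "U * U = 1\<^sub>m n" using NU by (auto simp: involutive_mat_def)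
  obtain k where N: "N \<in> carrier_mat n n" "N ^\<^sub>m k = 0\<^sub>m n n"
    using NU(1,3) by (auto simp: nilpotent_mat_def)
  let ?h = "map_mat to_ac :: 'a mat \<Rightarrow> _" and ?D = "companion_blocks Ps"
  let ?Ps = "map (map_poly to_ac) Ps"
  define r where "r = length (filter (\<lambda>P. poly P l = 0) ?Ps)"
  have deg: "degree (map_poly to_ac p) = degree p" for p :: "'a poly"
    by (rule degree_map_poly) simp
  have lead: "lead_coeff P = 1" if "P \<in> set ?Ps" for P
    using that Ps by (auto simp: is_invariant_factors_def deg coeff_map_poly)
  have dims: "(\<Sum>P\<leftarrow>?Ps. degree P) = n"
    using is_invariant_factors_carrier(2)[OF Ps] carrier_matD(1)[OF is_invariant_factors_carrier(1)[OF Ps]] dA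
    by (simp add: deg o_def)
  obtain G where G: "G \<in> carrier_mat r n" "G * ?h ?D = l \<cdot>\<^sub>m G"
    and inj: "\<And>c. (\<forall>j<n. (\<Sum>i<r. c i * G $$ (i,j)) = 0) \<Longrightarrow> (\<forall>i<r. c i = 0)"
    using left_eigenvectors_companion_blocks[of ?Ps l, OF lead]
    unfolding r_def map_mat_companion_blocks dims by blast
  obtain P Q where "similar_mat_wit A ?D P Q"
    using Ps by (auto simp: is_invariant_factors_def similar_mat_def)
  note w = similar_mat_witD2[OF A this]
  \<comment> \<open>Right multiplication by \<open>Q\<close> carries left eigenvectors of the
    companion blocks to left eigenvectors of \<open>A\<close>.\<close>
  define E where "E = transpose_mat (G * ?h Q)"
  have E: "E \<in> carrier_mat n r" using G w by (simp add: E_def)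
  have hAG: "G * ?h Q * ?h A = l \<cdot>\<^sub>m (G * ?h Q)"
  proof -
    have "G * ?h Q * ?h A = G * (?h Q * ?h A)"
      using G w by (intro assoc_mult_mat[of _ r n _ n _ n]) auto
    also have "?h Q * ?h A = ?h (Q * A)" using w by (intro to_ac.mat_hom_mult[of _ n n _ n, symmetric]) auto
    also have "Q * A = ?D * Q"
    proof -
      have "Q * A = Q * (P * (?D * Q))" unfolding w(3) using w(5-7) by (subst assoc_mult_mat[of _ n n _ n _ n]) auto
      also have "\<dots> = (Q * P) * (?D * Q)" using w(5-7) by (intro assoc_mult_mat[symmetric, of _ n n _ n _ n]) auto
      also have "\<dots> = ?D * Q" unfolding w(2) using w(5-7) by (intro left_mult_one_mat[of _ n n]) auto
      finally show ?thesis .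
    qed
    also have "?h (?D * Q) = ?h ?D * ?h Q" using w by (intro to_ac.mat_hom_mult[of _ n n _ n]) auto
    also have "G * \<dots> = (G * ?h ?D) * ?h Q"
      using G w by (intro assoc_mult_mat[symmetric, of _ r n _ n _ n]) auto
    also have "\<dots> = l \<cdot>\<^sub>m (G * ?h Q)" unfolding G(2) using G(1) w by (intro mult_smult_assoc_mat) auto
    finally show ?thesis .
  qed
  let ?M = "transpose_mat (?h N)" and ?V = "transpose_mat (?h U)"
  have "2 * r \<le> n"
  proof (rule involution_nilpotent_eigenvectors[of ?M n k ?V E r l])
    have "transpose_mat (?h N) ^\<^sub>m j = transpose_mat (?h (N ^\<^sub>m j))" for j
    proof (induction j)
      case (Suc j)
      have "?h (N ^\<^sub>m Suc j) = ?h N * ?h (N ^\<^sub>m j)"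
        unfolding pow_mat_Suc_left[OF N(1)] using N by (intro to_ac.mat_hom_mult[of _ n n _ n]) auto
      then have "transpose_mat (?h (N ^\<^sub>m Suc j)) = transpose_mat (?h (N ^\<^sub>m j)) * transpose_mat (?h N)"
        using N by (simp add: transpose_mult[of _ n n _ n] del: pow_mat.simps)
      then show ?case using Suc by simp
    qed (use N in \<open>simp add: to_ac.mat_hom_one\<close>)
    then have "?M ^\<^sub>m k = transpose_mat (?h (N ^\<^sub>m k))" .
    also have "\<dots> = 0\<^sub>m n n" unfolding N(2) by (auto intro!: eq_matI)
    finally show "?M ^\<^sub>m k = 0\<^sub>m n n" .
    have "?V * ?V = transpose_mat (?h U * ?h U)"
      using U(1) by (intro transpose_mult[of _ n n _ n, symmetric]) auto
    also have "?h U * ?h U = ?h (U * U)" using U(1) by (intro to_ac.mat_hom_mult[of _ n n _ n, symmetric]) auto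
    finally show "?V * ?V = 1\<^sub>m n" unfolding U(2) to_ac.mat_hom_one by simp
    have "?V * ?M = transpose_mat (?h N * ?h U)"
      using N U by (intro transpose_mult[of _ n n _ n, symmetric]) auto
    also have "?h N * ?h U = ?h A"
      unfolding AN using N U by (intro to_ac.mat_hom_mult[of _ n n _ n, symmetric]) auto
    also have "transpose_mat (?h A) * E = transpose_mat (G * ?h Q * ?h A)"
      unfolding E_def using A G w by (intro transpose_mult[of _ r n _ n, symmetric]) auto
    finally have "?V * ?M * E = transpose_mat (G * ?h Q * ?h A)" .
    then show "?V * ?M * E = l \<cdot>\<^sub>m E" unfolding hAG E_def by (auto intro!: eq_matI)
    fix c assume c: "c \<in> carrier_vec r" "E *\<^sub>v c = 0\<^sub>v n"
    \<comment> \<open>Multiplication by the transpose of \<open>P\<close> undoes this transport and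
      reduces injectivity of \<open>E\<close> to the independence of the rows of
      \<open>G\<close>.\<close>
    have "transpose_mat (?h P) *\<^sub>v (E *\<^sub>v c) = (transpose_mat (?h P) * E) *\<^sub>v c"
      using w E c by (intro assoc_mult_mat_vec[of _ n n _ r, symmetric]) auto
    also have "transpose_mat (?h P) * E = transpose_mat (G * ?h Q * ?h P)"
      using w G unfolding E_def by (intro transpose_mult[of _ r n _ n, symmetric]) auto
    also have "G * ?h Q * ?h P = G * (?h Q * ?h P)"
      using w G by (intro assoc_mult_mat[of _ r n _ n _ n]) auto
    also have "?h Q * ?h P = ?h (Q * P)" using w by (intro to_ac.mat_hom_mult[of _ n n _ n, symmetric]) auto
    also have "\<dots> = 1\<^sub>m n" unfolding w(2) by (rule to_ac.mat_hom_one)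
    also have "transpose_mat (?h P) *\<^sub>v (E *\<^sub>v c) = 0\<^sub>v n" unfolding c(2) using w by auto
    finally have Gc: "transpose_mat G *\<^sub>v c = 0\<^sub>v n" using G by simp
    have "(\<Sum>i<r. c $ i * G $$ (i,j)) = 0" if "j < n" for j
    proof -
      have "(transpose_mat G *\<^sub>v c) $ j = (\<Sum>i<r. c $ i * G $$ (i,j))"
        using that G c by (simp add: scalar_prod_def atLeast0LessThan mult.commute)
      then show ?thesis using Gc that by simp
    qed
    then have "\<forall>i<r. c $ i = 0" by (intro inj) blast
    then show "c = 0\<^sub>v r" using c(1) by auto
  qed (use N U E l in auto)
  then show ?thesis by (simp add: r_def filter_map o_def)
qed

section \<open>Nilpotent completions of a singular matrix\<close>

lemma det_nonzero_inverse:
  fixes A :: "'a::field mat"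
  assumes A: "A \<in> carrier_mat n n" and "det A \<noteq> 0"
  obtains B where "B \<in> carrier_mat n n" "A * B = 1\<^sub>m n" "B * A = 1\<^sub>m n"
  using det_non_zero_imp_unit[OF assms, of "()"] by (auto simp: Units_def ring_mat_def)

lemma similar_conjugate:
  assumes "{B, P, Q} \<subseteq> carrier_mat n n" "P * Q = 1\<^sub>m n" "Q * P = 1\<^sub>m n"
  shows "similar_mat B (P * B * Q)"
  using assms by (intro similar_mat_sym[OF similar_matI[of _ _ P Q n]]) auto

text \<open>A row exchange alone is not a similarity. Instead row \<open>i\<close> is added to row
  0; the compensating column operation subtracts column 0 from column \<open>i\<close> and thus
  leaves column 0, which holds the new pivot, alone.\<close>

lemma similar_nonzero_pivot:
  fixes B :: "'a::field mat"
  assumes B: "B \<in> carrier_mat (Suc n) (Suc n)" and det: "det B \<noteq> 0"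
  obtains B' where "B' \<in> carrier_mat (Suc n) (Suc n)" "similar_mat B B'" "B' $$ (0,0) \<noteq> 0"
proof (cases "B $$ (0,0) = 0")
  case True
  have "\<exists>i<Suc n. B $$ (i,0) \<noteq> 0"
  proof (rule ccontr)
    assume "\<not> (\<exists>i<Suc n. B $$ (i,0) \<noteq> 0)"
    then have "B *\<^sub>v unit_vec (Suc n) 0 = 0\<^sub>v (Suc n)" using B by (intro eq_vecI) auto
    moreover have "unit_vec (Suc n) 0 \<noteq> (0\<^sub>v (Suc n) :: 'a vec)" by (auto simp: vec_eq_iff)
    ultimately show False using det det_0_iff_vec_prod_zero[OF B] unit_vec_carrier[of "Suc n" 0] by blast
  qed
  then obtain i where i: "i < Suc n" "B $$ (i,0) \<noteq> 0" by blast
  with True have "0 \<noteq> i" by (intro notI) simp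
  define E :: "'a mat" where "E = addrow_mat (Suc n) 1 0 i"
  define F :: "'a mat" where "F = addrow_mat (Suc n) (- 1) 0 i"
  have E: "E \<in> carrier_mat (Suc n) (Suc n)" and F: "F \<in> carrier_mat (Suc n) (Suc n)"
    by (simp_all add: E_def F_def)
  have EF: "E * F = 1\<^sub>m (Suc n)" unfolding E_def F_def
    by (rule addrow_mat_inv) (use i \<open>0 \<noteq> i\<close> in auto)
  have EB: "E * B = addrow 1 0 i B"
    unfolding E_def using addrow_mat[OF B i(1)] by simp
  have colF: "col F 0 = unit_vec (Suc n) 0" using i \<open>0 \<noteq> i\<close> by (intro eq_vecI) (auto simp: F_def)
  have "(addrow 1 0 i B * F) $$ (0,0) = row (addrow 1 0 i B) 0 \<bullet> col F 0"
    using B F by simp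
  also have "\<dots> = B $$ (i,0)" unfolding colF using B i True by simp
  finally have "(E * B * F) $$ (0,0) \<noteq> 0" using i unfolding EB by simp
  moreover have "similar_mat B (E * B * F)"
    using B E F EF mat_mult_left_right_inverse[OF E F EF] by (intro similar_conjugate[of _ _ _ "Suc n"]) auto
  moreover have "E * B * F \<in> carrier_mat (Suc n) (Suc n)" using B E F by simp
  ultimately show ?thesis by (intro that)
qed (use that B similar_mat_refl in blast)

text \<open>An LU factorisation of \<open>B\<close> itself may not exist. Conjugating by diag(1, P)
  keeps the pivot and replaces the Schur complement \<open>S\<close> by \<open>Q * S * P\<close>, so
  the similarity found for \<open>S\<close> extends to the whole matrix.\<close>

lemma similar_LU:
  fixes B :: "'a::field mat"
  assumes "B \<in> carrier_mat n n" "det B \<noteq> 0"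
  shows "\<exists>L R. L \<in> carrier_mat n n \<and> R \<in> carrier_mat n n \<and> similar_mat B (L * R) \<and>
    (\<forall>i j. i < j \<longrightarrow> j < n \<longrightarrow> L $$ (i,j) = 0) \<and> (\<forall>i j. j < i \<longrightarrow> i < n \<longrightarrow> R $$ (i,j) = 0)"
  using assms
proof (induction n arbitrary: B)
  case 0
  have "B * B = B" using 0 by (intro eq_matI) auto
  with 0 show ?case using similar_mat_refl[of B 0] by (intro exI[of _ B]) auto
next
  case (Suc n)
  obtain B1 where B1: "B1 \<in> carrier_mat (Suc n) (Suc n)" "similar_mat B B1" "B1 $$ (0,0) \<noteq> 0"
    using similar_nonzero_pivot[OF Suc.prems] .
  define b where "b = B1 $$ (0,0)"
  obtain B11 r c D where sb: "split_block B1 1 1 = (B11, r, c, D)" by (cases "split_block B1 1 1") auto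
  have dims: "dim_row B1 = 1 + n" "dim_col B1 = 1 + n" using B1 by auto
  note blocks = split_block[OF sb dims]
  have "B11 $$ (0,0) = b" using sb by (auto simp: split_block_def Let_def b_def)
  then have B11: "B11 = b \<cdot>\<^sub>m 1\<^sub>m 1" using blocks(1) by (intro eq_matI) auto
  have b0: "b \<noteq> 0" using B1(3) by (simp add: b_def)
  \<comment> \<open>The Schur complement of the pivot; it is invertible because
    \<open>det B1\<close> is \<open>b\<close> times its determinant.\<close>
  define S where "S = D - inverse b \<cdot>\<^sub>m (c * r)"
  have S: "S \<in> carrier_mat n n" using blocks mult_carrier_mat[of c n 1 r n] by (simp add: S_def minus_carrier_mat)
  have D: "D = inverse b \<cdot>\<^sub>m (c * r) + S"
    using blocks unfolding S_def by (intro eq_matI) auto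
  have "B1 = four_block_mat (1\<^sub>m 1) (0\<^sub>m 1 n) (inverse b \<cdot>\<^sub>m c) (1\<^sub>m n) * four_block_mat B11 r (0\<^sub>m n 1) S"
    unfolding blocks(5) using blocks(1-4) S b0
    by (subst mult_four_block_mat[of _ 1 1 _ n _ n _ _ 1 _ n])
      (auto simp: B11 mult_smult_distrib[of _ n 1 _ 1] mult_smult_assoc_mat[of _ n 1 _ n] D[symmetric]
        intro!: cong_four_block_mat)
  then have "det B1 = det (four_block_mat (1\<^sub>m 1) (0\<^sub>m 1 n) (inverse b \<cdot>\<^sub>m c) (1\<^sub>m n)) *
      det (four_block_mat B11 r (0\<^sub>m n 1) S)"
    using blocks(1-3) S by (simp only:) (intro det_mult[of _ "1 + n"] four_block_carrier_mat; simp)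
  also have "det (four_block_mat B11 r (0\<^sub>m n 1) S) = det B11 * det S"
    using blocks S by (intro det_four_block_mat_lower_left_zero) auto
  finally have "det S \<noteq> 0" using Suc.prems(2) det_similar[OF B1(2)] by auto
  from Suc.IH[OF S this] obtain L R where LR: "L \<in> carrier_mat n n" "R \<in> carrier_mat n n" "similar_mat S (L * R)"
    "\<And>i j. i < j \<Longrightarrow> j < n \<Longrightarrow> L $$ (i,j) = 0" "\<And>i j. j < i \<Longrightarrow> i < n \<Longrightarrow> R $$ (i,j) = 0" by blast
  from LR(3) obtain P Q where "similar_mat_wit S (L * R) P Q" by (auto simp: similar_mat_def)
  note w = similar_mat_witD2[OF S this]
  have QSP: "Q * S * P = L * R"
  proof -
    have "Q * S * P = Q * (P * (L * R) * Q) * P" unfolding w(3) ..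
    also have "\<dots> = (Q * P) * (L * R) * (Q * P)"
      using w(5-7) by (simp add: assoc_mult_mat[of _ n n _ n _ n] del: w(2))
    also have "\<dots> = L * R"
      by (simp only: w(2) left_mult_one_mat[OF w(5)] right_mult_one_mat[OF w(5)])
    finally show ?thesis .
  qed
  let ?P = "four_block_mat (1\<^sub>m 1) (0\<^sub>m 1 n) (0\<^sub>m n 1) P" and ?Q = "four_block_mat (1\<^sub>m 1) (0\<^sub>m 1 n) (0\<^sub>m n 1) Q"
  let ?L = "four_block_mat (1\<^sub>m 1) (0\<^sub>m 1 n) (inverse b \<cdot>\<^sub>m (Q * c)) L"
  let ?R = "four_block_mat B11 (r * P) (0\<^sub>m n 1) R"
  have QP: "?Q * ?P = 1\<^sub>m (Suc n)" "?P * ?Q = 1\<^sub>m (Suc n)"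
    using w four_block_one_mat[of 1 n] by (simp_all add: mult_four_block_mat[of _ 1 1 _ n _ n _ _ 1 _ n])
  have "?Q * B1 * ?P = four_block_mat B11 (r * P) (Q * c) (Q * D * P)"
    unfolding blocks(5) using blocks(1-4) w(6,7)
    by (simp add: mult_four_block_mat[of _ 1 1 _ n _ n _ _ 1 _ n])
  also have "Q * D * P = inverse b \<cdot>\<^sub>m (Q * c) * (r * P) + L * R"
  proof -
    have "Q * D * P = Q * (inverse b \<cdot>\<^sub>m (c * r)) * P + Q * S * P"
      unfolding D using w(6,7) S blocks
      by (simp add: mult_add_distrib_mat[of _ n n _ n] add_mult_distrib_mat[of _ n n _ _ n])
    also have "Q * (inverse b \<cdot>\<^sub>m (c * r)) * P = inverse b \<cdot>\<^sub>m (Q * c) * (r * P)"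
    proof -
      have "Q * (inverse b \<cdot>\<^sub>m (c * r)) * P = inverse b \<cdot>\<^sub>m (Q * (c * r) * P)"
        using w(6,7) blocks(2,3)
        by (simp add: mult_smult_distrib[of _ n n _ n] mult_smult_assoc_mat[of _ n n _ n])
      also have "Q * (c * r) = Q * c * r"
        using w(7) blocks(2,3) by (intro assoc_mult_mat[symmetric, of _ n n _ 1 _ n]) auto
      also have "Q * c * r * P = Q * c * (r * P)"
        using w(6,7) blocks(2,3) by (intro assoc_mult_mat[of _ n 1 _ n _ n]) auto
      also have "inverse b \<cdot>\<^sub>m (Q * c * (r * P)) = inverse b \<cdot>\<^sub>m (Q * c) * (r * P)"
        using w(6,7) blocks(2,3) by (intro mult_smult_assoc_mat[symmetric, of _ n 1 _ n]) auto
      finally show ?thesis .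
    qed
    finally show ?thesis unfolding QSP .
  qed
  also have "four_block_mat B11 (r * P) (Q * c) (inverse b \<cdot>\<^sub>m (Q * c) * (r * P) + L * R) = ?L * ?R"
    using blocks w(6,7) LR(1,2) b0
    by (subst mult_four_block_mat[of _ 1 1 _ n _ n _ _ 1 _ n])
      (auto simp: B11 mult_smult_distrib[of _ n 1 _ 1] intro!: cong_four_block_mat)
  finally have "?Q * B1 * ?P = ?L * ?R" .
  moreover have "similar_mat B1 (?Q * B1 * ?P)"
    using B1(1) w(6,7) QP by (intro similar_conjugate[of _ _ _ "Suc n"]) auto
  ultimately have "similar_mat B (?L * ?R)" using B1(2) similar_mat_trans by metis
  moreover have "?L $$ (i,j) = 0" if "i < j" "j < Suc n" for i j
    using that LR(1,4) w(6) blocks by auto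
  moreover have "?R $$ (i,j) = 0" if "j < i" "i < Suc n" for i j
    using that LR(2,5) w(7) blocks by (auto simp: less_diff_conv2)
  moreover have "?L \<in> carrier_mat (Suc n) (Suc n)" "?R \<in> carrier_mat (Suc n) (Suc n)"
    using LR(1,2) blocks(1) by auto
  ultimately show ?case by blast
qed

text \<open>The matrices \<open>C\<close> for which some block matrix \<open>(0, C; 1, W)\<close> is nilpotent: iterating it on a pair of
  vectors produces the second-order recurrence below in the second component.\<close>
definition nilpotent_completion :: "nat \<Rightarrow> 'a::field mat \<Rightarrow> bool" where
  "nilpotent_completion n C \<longleftrightarrow> (\<exists>W\<in>carrier_mat n n. \<exists>k. \<forall>q.
     (\<forall>t. q t \<in> carrier_vec n) \<and> (\<forall>t. q (Suc (Suc t)) = C *\<^sub>v q t + W *\<^sub>v q (Suc t)) \<longrightarrow>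
     (\<forall>t\<ge>k. q t = 0\<^sub>v n))"

text \<open>Conjugating \<open>W\<close> by the same witnesses makes \<open>Q\<close> map solutions
  of the recurrence for \<open>C\<close> to solutions of the one for \<open>D\<close>.\<close>

lemma nilpotent_completion_similar:
  assumes C: "C \<in> carrier_mat n n" and sim: "similar_mat C D" and D: "nilpotent_completion n D"
  shows "nilpotent_completion n C"
proof -
  from sim obtain P Q where "similar_mat_wit C D P Q" by (auto simp: similar_mat_def)
  note w = similar_mat_witD2[OF C this]
  from D obtain W k where W: "W \<in> carrier_mat n n" and
    van: "\<And>q. (\<forall>t. q t \<in> carrier_vec n) \<Longrightarrow> (\<forall>t. q (Suc (Suc t)) = D *\<^sub>v q t + W *\<^sub>v q (Suc t)) \<Longrightarrow> \<forall>t\<ge>k. q t = 0\<^sub>v n"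
    unfolding nilpotent_completion_def by blast
  have conj: "Q *\<^sub>v ((P * Y * Q) *\<^sub>v v) = Y *\<^sub>v (Q *\<^sub>v v)"
    if "Y \<in> carrier_mat n n" "v \<in> carrier_vec n" for Y v
  proof -
    have "Q *\<^sub>v ((P * Y * Q) *\<^sub>v v) = Q *\<^sub>v (P *\<^sub>v (Y *\<^sub>v (Q *\<^sub>v v)))"
      using that w(6,7) by (simp add: assoc_mult_mat_vec[of _ n n _ n])
    also have "\<dots> = (Q * P) *\<^sub>v (Y *\<^sub>v (Q *\<^sub>v v))"
      using that w(6,7) by (intro assoc_mult_mat_vec[symmetric, of _ n n _ n]) auto
    finally show ?thesis using that w(2,7) by simp
  qed
  show ?thesis unfolding nilpotent_completion_def
  proof (intro bexI[of _ "P * W * Q"] exI[of _ k] allI impI)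
    fix q t
    assume q: "(\<forall>t. q t \<in> carrier_vec n) \<and> (\<forall>t. q (Suc (Suc t)) = C *\<^sub>v q t + P * W * Q *\<^sub>v q (Suc t))" and t: "k \<le> t"
    have qc: "q t \<in> carrier_vec n" for t using q by blast
    have PWQ: "P * W * Q \<in> carrier_mat n n" using W w(6,7) by simp
    have "Q *\<^sub>v q (Suc (Suc t)) = D *\<^sub>v (Q *\<^sub>v q t) + W *\<^sub>v (Q *\<^sub>v q (Suc t))" for t
    proof -
      have "q (Suc (Suc t)) = C *\<^sub>v q t + P * W * Q *\<^sub>v q (Suc t)" using q by blast
      also have "Q *\<^sub>v \<dots> = Q *\<^sub>v (C *\<^sub>v q t) + Q *\<^sub>v (P * W * Q *\<^sub>v q (Suc t))"
        using q w(4) mult_mat_vec_carrier[OF PWQ] by (intro mult_add_distrib_mat_vec[OF w(7)]) auto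
      also have "Q *\<^sub>v (C *\<^sub>v q t) = D *\<^sub>v (Q *\<^sub>v q t)" unfolding w(3) using qc by (rule conj[OF w(5)])
      also have "Q *\<^sub>v (P * W * Q *\<^sub>v q (Suc t)) = W *\<^sub>v (Q *\<^sub>v q (Suc t))" using qc by (rule conj[OF W])
      finally show ?thesis .
    qed
    moreover have "Q *\<^sub>v q t \<in> carrier_vec n" for t using qc w(7) by simp
    ultimately have "\<forall>t\<ge>k. Q *\<^sub>v q t = 0\<^sub>v n" by (intro van) auto
    then have "Q *\<^sub>v q t = 0\<^sub>v n" using t by blast
    then have "P *\<^sub>v (Q *\<^sub>v q t) = 0\<^sub>v n" using w(6) by auto
    moreover have "P *\<^sub>v (Q *\<^sub>v q t) = (P * Q) *\<^sub>v q t"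
      using q w(6,7) by (intro assoc_mult_mat_vec[symmetric, of _ n n _ n]) auto
    ultimately show "q t = 0\<^sub>v n" using qc[of t] w(1) by simp
  qed (use W w in simp)
qed

section \<open>Recurrences given by strictly triangular matrices\<close>

text \<open>The rank \<open>f\<close> makes each coordinate of \<open>Y r\<close> depend on
  coordinates of smaller rank only, so coordinate \<open>i\<close> is 0 once \<open>f i + 1\<close>
  steps have passed. A rank treats lower and upper triangular matrices alike; \<open>a\<close> is
  the time from which \<open>Y\<close> governs the sequence.\<close>

lemma strictly_triangular_orbit_vanishes:
  fixes Y :: "'a::field mat" and f :: "nat \<Rightarrow> nat"
  assumes Y: "Y \<in> carrier_mat n n"
    and tri: "\<And>i j. i < n \<Longrightarrow> j < n \<Longrightarrow> Y $$ (i,j) \<noteq> 0 \<Longrightarrow> f j < f i"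
    and f: "\<And>i. i < n \<Longrightarrow> f i < m"
    and r: "\<And>t. r t \<in> carrier_vec n" "\<And>t. a \<le> t \<Longrightarrow> r (Suc t) = Y *\<^sub>v r t"
    and t: "a + m \<le> t"
  shows "r t = 0\<^sub>v n"
proof -
  have "r t $ i = 0" if "i < n" "a + f i < t" for t i
    using that
  proof (induction t arbitrary: i)
    case (Suc t)
    have "r (Suc t) $ i = (\<Sum>j<n. Y $$ (i,j) * r t $ j)"
      using Suc.prems r(1)[of t] r(2)[of t] Y by (simp add: scalar_prod_def atLeast0LessThan)
    also have "\<dots> = 0"
    proof (intro sum.neutral ballI)
      fix j assume j: "j \<in> {..<n}"
      show "Y $$ (i,j) * r t $ j = 0"
      proof (cases "Y $$ (i,j) = 0")
        case False
        then have "f j < f i" using tri[of i j] Suc.prems j by simp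
        then show ?thesis using Suc.IH[of j] Suc.prems j by simp
      qed simp
    qed
    finally show ?case .
  qed simp
  note zero = this
  show ?thesis
  proof (rule eq_vecI)
    fix i assume "i < dim_vec (0\<^sub>v n)"
    then have i: "i < n" by simp
    then have "a + f i < t" using f[OF i] t by linarith
    then show "r t $ i = 0\<^sub>v n $ i" using zero i by simp
  qed (use r(1)[of t] in simp)
qed

text \<open>The recurrence factors: the defect \<open>r t = q (Suc t) - Z q t\<close> satisfies
  \<open>r (Suc t) = Y r t\<close>. It dies within \<open>n\<close> steps, after which
  \<open>q\<close> follows \<open>Z\<close> and dies within \<open>n\<close> more, whence
  \<open>2 * n\<close>.\<close>

lemma nilpotent_completion_product:
  fixes Y Z :: "'a::field mat"
  assumes Y: "Y \<in> carrier_mat n n" and Z: "Z \<in> carrier_mat n n"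
    and low: "\<And>i j. i < n \<Longrightarrow> j < n \<Longrightarrow> Y $$ (i,j) \<noteq> 0 \<Longrightarrow> j < i"
    and up: "\<And>i j. i < n \<Longrightarrow> j < n \<Longrightarrow> Z $$ (i,j) \<noteq> 0 \<Longrightarrow> i < j"
  shows "nilpotent_completion n (- (Y * Z))"
  unfolding nilpotent_completion_def
proof (intro bexI[of _ "Y + Z"] exI[of _ "2 * n"] allI impI)
  fix q t
  assume q: "(\<forall>t. q t \<in> carrier_vec n) \<and> (\<forall>t. q (Suc (Suc t)) = - (Y * Z) *\<^sub>v q t + (Y + Z) *\<^sub>v q (Suc t))"
    and t: "2 * n \<le> t"
  then have qc: "q t \<in> carrier_vec n" for t by blast
  define r where "r t = q (Suc t) - Z *\<^sub>v q t" for t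
  have rc: "r t \<in> carrier_vec n" for t using qc Z by (simp add: r_def)
  have step: "r (Suc t) = Y *\<^sub>v r t" for t
  proof -
    have cancel: "- u + (y + z) - z = y - u"
      if "u \<in> carrier_vec n" "y \<in> carrier_vec n" "z \<in> carrier_vec n" for u y z :: "'a vec"
      using that by (intro eq_vecI) auto
    have "- (Y * Z) *\<^sub>v q t = - (Y *\<^sub>v (Z *\<^sub>v q t))"
      using assoc_mult_mat_vec[OF Y Z qc] carrier_vecD[OF qc] Z by simp
    moreover have "(Y + Z) *\<^sub>v q (Suc t) = Y *\<^sub>v q (Suc t) + Z *\<^sub>v q (Suc t)"
      by (rule add_mult_distrib_mat_vec[OF Y Z qc])
    moreover have "q (Suc (Suc t)) = - (Y * Z) *\<^sub>v q t + (Y + Z) *\<^sub>v q (Suc t)" using q by blast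
    ultimately have q2: "q (Suc (Suc t)) = - (Y *\<^sub>v (Z *\<^sub>v q t)) + (Y *\<^sub>v q (Suc t) + Z *\<^sub>v q (Suc t))"
      by simp
    have "r (Suc t) = Y *\<^sub>v q (Suc t) - Y *\<^sub>v (Z *\<^sub>v q t)"
      unfolding r_def[of "Suc t"] q2 using Y Z qc by (intro cancel mult_mat_vec_carrier)
    also have "\<dots> = Y *\<^sub>v r t"
      unfolding r_def using Y Z qc by (intro mult_minus_distrib_mat_vec[symmetric, of _ n n]) auto
    finally show ?thesis .
  qed
  have r0: "r t = 0\<^sub>v n" if "n \<le> t" for t
    by (rule strictly_triangular_orbit_vanishes[OF Y, of "\<lambda>i. i" n r 0 t]) (use low rc that step in auto)
  have stepq: "q (Suc t) = Z *\<^sub>v q t" if "n \<le> t" for t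
  proof (rule eq_vecI)
    fix i assume "i < dim_vec (Z *\<^sub>v q t)"
    then have i: "i < n" using Z by simp
    have "r t $ i = 0" using r0[OF that] i by simp
    then show "q (Suc t) $ i = (Z *\<^sub>v q t) $ i"
      using i Z carrier_vecD[OF qc] unfolding r_def by (simp del: index_mult_mat_vec)
  qed (use Z carrier_vecD[OF qc] in auto)
  have up': "n - Suc j < n - Suc i" if "i < n" "j < n" "Z $$ (i,j) \<noteq> 0" for i j
    using up[OF that] that(2) by linarith
  show "q t = 0\<^sub>v n"
    by (rule strictly_triangular_orbit_vanishes[OF Z, of "\<lambda>i. n - Suc i" n q n t])
      (use up' qc t stepq in auto)
qed (use Y Z in auto)

lemma similar_kernel_first:
  fixes C :: "'a::field mat"
  assumes C: "C \<in> carrier_mat (Suc n) (Suc n)" and det: "det C = 0"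
  obtains D where "D \<in> carrier_mat (Suc n) (Suc n)" "similar_mat C D" "\<And>i. i < Suc n \<Longrightarrow> D $$ (i,0) = 0"
proof -
  obtain v where v: "v \<in> carrier_vec (Suc n)" "v \<noteq> 0\<^sub>v (Suc n)" "C *\<^sub>v v = 0\<^sub>v (Suc n)"
    using det det_0_iff_vec_prod_zero[OF C] by auto
  then obtain i where i: "i < Suc n" "v $ i \<noteq> 0" by (auto simp: vec_eq_iff)
  \<comment> \<open>The kernel vector \<open>v\<close> becomes the first basis vector. It stands in
    for the unit vector of a coordinate \<open>i\<close> where it is nonzero; the displaced first
    unit vector moves to column \<open>i\<close> unless \<open>i = 0\<close>.\<close>
  define P where "P = mat (Suc n) (Suc n) (\<lambda>(k,j). if j = 0 then v $ k else
    if j = i then (if k = 0 then 1 else 0) else if k = j then 1 else 0)"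
  have P: "P \<in> carrier_mat (Suc n) (Suc n)" by (simp add: P_def)
  have "det P \<noteq> 0"
  proof
    assume "det P = 0"
    then obtain x where x: "x \<in> carrier_vec (Suc n)" "x \<noteq> 0\<^sub>v (Suc n)" "P *\<^sub>v x = 0\<^sub>v (Suc n)"
      using det_0_iff_vec_prod_zero[OF P] by auto
    have Px: "(\<Sum>j<Suc n. P $$ (k,j) * x $ j) = 0" if "k < Suc n" for k
    proof -
      have "(P *\<^sub>v x) $ k = (\<Sum>j<Suc n. P $$ (k,j) * x $ j)"
        using that P x(1) by (simp add: scalar_prod_def atLeast0LessThan del: sum.lessThan_Suc)
      then show ?thesis using x(3) that by simp
    qed
    have "(\<Sum>j<Suc n. P $$ (i,j) * x $ j) = (\<Sum>j<Suc n. if j = 0 then v $ i * x $ 0 else 0)"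
      using i by (intro sum.cong) (auto simp: P_def)
    then have x0: "x $ 0 = 0" using Px[OF i(1)] i(2) by (simp del: sum.lessThan_Suc)
    have "x $ k = 0" if k: "k < Suc n" "k \<noteq> 0" for k
    proof (cases "k = i")
      case True
      have "(\<Sum>j<Suc n. P $$ (0,j) * x $ j) = (\<Sum>j<Suc n. if j = i then x $ i else 0)"
        using i k True x0 by (intro sum.cong) (auto simp: P_def)
      then show ?thesis using Px[of 0] i True by (simp del: sum.lessThan_Suc)
    next
      case False
      have "(\<Sum>j<Suc n. P $$ (k,j) * x $ j) = (\<Sum>j<Suc n. if j = k then x $ k else 0)"
        using i k False x0 by (intro sum.cong) (auto simp: P_def)
      then show ?thesis using Px[of k] k by (simp del: sum.lessThan_Suc)
    qed
    with x0 x(1,2) show False by (metis eq_vecI carrier_vecD index_zero_vec)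
  qed
  then obtain Q where Q: "Q \<in> carrier_mat (Suc n) (Suc n)" "P * Q = 1\<^sub>m (Suc n)" "Q * P = 1\<^sub>m (Suc n)"
    using det_nonzero_inverse[OF P] by blast
  have "col P 0 = v" using v(1) by (intro eq_vecI) (auto simp: P_def)
  have "col (Q * C * P) 0 = (Q * C) *\<^sub>v col P 0"
    using P Q C by (intro col_mult2[of _ "Suc n" "Suc n" _ "Suc n"]) auto
  also have "\<dots> = Q *\<^sub>v (C *\<^sub>v v)"
    unfolding \<open>col P 0 = v\<close> using Q C v by (intro assoc_mult_mat_vec) auto
  also have "\<dots> = 0\<^sub>v (Suc n)" unfolding v(3) using Q by auto
  finally have col0: "col (Q * C * P) 0 = 0\<^sub>v (Suc n)" .
  have "(Q * C * P) $$ (k,0) = 0" if "k < Suc n" for k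
  proof -
    have "(Q * C * P) $$ (k,0) = col (Q * C * P) 0 $ k" using that Q P by (simp del: col_mult)
    then show ?thesis using that unfolding col0 by simp
  qed
  moreover have "similar_mat C (Q * C * P)"
    using C P Q by (intro similar_conjugate[of _ _ _ "Suc n"]) auto
  moreover have "Q * C * P \<in> carrier_mat (Suc n) (Suc n)" using C P Q by auto
  ultimately show ?thesis using that by blast
qed

theorem singular_nilpotent_completion:
  fixes C :: "'a::field mat"
  assumes "C \<in> carrier_mat n n" "det C = 0"
  shows "nilpotent_completion n C"
  using assms
proof (induction n arbitrary: C)
  case 0
  then show ?case by (simp add: det_dim_zero)
next
  case (Suc n)
  obtain D where D: "D \<in> carrier_mat (Suc n) (Suc n)" "similar_mat C D" "\<And>i. i < Suc n \<Longrightarrow> D $$ (i,0) = 0"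
    using similar_kernel_first[OF Suc.prems] by blast
  define D' where "D' = mat n n (\<lambda>(i,j). D $$ (Suc i, Suc j))"
  have D': "D' \<in> carrier_mat n n" by (simp add: D'_def)
  have "nilpotent_completion (Suc n) D"
  proof (cases "det D' = 0")
    case True
    from Suc.IH[OF D' this] obtain W k where W: "W \<in> carrier_mat n n" and
      van: "\<And>q. (\<forall>t. q t \<in> carrier_vec n) \<Longrightarrow> (\<forall>t. q (Suc (Suc t)) = D' *\<^sub>v q t + W *\<^sub>v q (Suc t)) \<Longrightarrow> \<forall>t\<ge>k. q t = 0\<^sub>v n"
      unfolding nilpotent_completion_def by blast
    \<comment> \<open>\<open>W\<close> is padded with zeros. The first coordinate then depends on
      the other coordinates two steps earlier and has no influence on them, which accounts for
      \<open>k + 2\<close>.\<close>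
    define W' where "W' = mat (Suc n) (Suc n) (\<lambda>(i,j). if i = 0 \<or> j = 0 then 0 else W $$ (i - 1, j - 1))"
    have W': "W' \<in> carrier_mat (Suc n) (Suc n)" by (simp add: W'_def)
    show ?thesis unfolding nilpotent_completion_def
    proof (intro bexI[of _ W'] exI[of _ "k + 2"] allI impI)
      fix q t
      assume q: "(\<forall>t. q t \<in> carrier_vec (Suc n)) \<and> (\<forall>t. q (Suc (Suc t)) = D *\<^sub>v q t + W' *\<^sub>v q (Suc t))"
        and t: "k + 2 \<le> t"
      have qc: "q t \<in> carrier_vec (Suc n)" for t using q by blast
      define q' where "q' t = vec n (\<lambda>i. q t $ Suc i)" for t
      have q2: "q (Suc (Suc t)) $ i = (\<Sum>j<n. D $$ (i, Suc j) * q' t $ j) +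
          (if i = 0 then 0 else \<Sum>j<n. W $$ (i - 1, j) * q' (Suc t) $ j)" if i: "i < Suc n" for t i
      proof -
        have "q (Suc (Suc t)) = D *\<^sub>v q t + W' *\<^sub>v q (Suc t)" using q by blast
        then have "q (Suc (Suc t)) $ i = (D *\<^sub>v q t) $ i + (W' *\<^sub>v q (Suc t)) $ i"
          using i W' by (simp del: index_mult_mat_vec)
        also have "(D *\<^sub>v q t) $ i = (\<Sum>j<Suc n. D $$ (i,j) * q t $ j)"
          using i D(1) qc[of t] by (simp add: scalar_prod_def atLeast0LessThan del: sum.lessThan_Suc)
        also have "\<dots> = (\<Sum>j<n. D $$ (i, Suc j) * q' t $ j)"
          unfolding sum.lessThan_Suc_shift using D(3)[OF i] by (simp add: q'_def)
        also have "(W' *\<^sub>v q (Suc t)) $ i = (\<Sum>j<Suc n. W' $$ (i,j) * q (Suc t) $ j)"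
          using i W' qc[of "Suc t"] by (simp add: scalar_prod_def atLeast0LessThan del: sum.lessThan_Suc)
        also have "\<dots> = (if i = 0 then 0 else \<Sum>j<n. W $$ (i - 1, j) * q' (Suc t) $ j)"
          unfolding sum.lessThan_Suc_shift using i by (simp add: q'_def W'_def)
        finally show ?thesis .
      qed
      have "q' (Suc (Suc t)) = D' *\<^sub>v q' t + W *\<^sub>v q' (Suc t)" for t
      proof (intro eq_vecI)
        fix i assume "i < dim_vec (D' *\<^sub>v q' t + W *\<^sub>v q' (Suc t))"
        then have i: "i < n" using W by simp
        have "q' (Suc (Suc t)) $ i = q (Suc (Suc t)) $ Suc i" using i by (simp add: q'_def)
        also have "\<dots> = (D' *\<^sub>v q' t + W *\<^sub>v q' (Suc t)) $ i"
          using i W q2[of "Suc i" t] D' by (simp add: scalar_prod_def atLeast0LessThan q'_def D'_def)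
        finally show "q' (Suc (Suc t)) $ i = (D' *\<^sub>v q' t + W *\<^sub>v q' (Suc t)) $ i" .
      qed (use W in \<open>simp add: q'_def\<close>)
      then have q'0: "\<forall>t\<ge>k. q' t = 0\<^sub>v n" by (intro van) (auto simp: q'_def)
      define u where "u = t - 2"
      have u: "t = Suc (Suc u)" "k \<le> u" using t by (simp_all add: u_def)
      show "q t = 0\<^sub>v (Suc n)"
      proof (rule eq_vecI)
        fix i assume "i < dim_vec (0\<^sub>v (Suc n))"
        then have i: "i < Suc n" by simp
        have "q' u = 0\<^sub>v n" "q' (Suc u) = 0\<^sub>v n" using q'0 u(2) by simp_all
        then show "q t $ i = 0\<^sub>v (Suc n) $ i" unfolding u(1) using q2[OF i, of u] i by simp
      qed (use qc[of t] in simp)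
    qed (rule W')
  next
    case False
    obtain L R where LR: "L \<in> carrier_mat n n" "R \<in> carrier_mat n n" "similar_mat D' (L * R)"
      "\<And>i j. i < j \<Longrightarrow> j < n \<Longrightarrow> L $$ (i,j) = 0" "\<And>i j. j < i \<Longrightarrow> i < n \<Longrightarrow> R $$ (i,j) = 0"
      using similar_LU[OF D' False] by blast
    obtain E where E: "E \<in> carrier_mat n n" "D' * E = 1\<^sub>m n" "E * D' = 1\<^sub>m n"
      using det_nonzero_inverse[OF D' False] by blast
    define b where "b = mat 1 n (\<lambda>(i,j). D $$ (0, Suc j))"
    have b: "b \<in> carrier_mat 1 n" by (simp add: b_def)
    have D_block: "D = four_block_mat (0\<^sub>m 1 1) b (0\<^sub>m n 1) D'"
      using D by (intro eq_matI) (auto simp: b_def D'_def)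
    \<comment> \<open>\<open>b\<close> is a combination of the rows of the invertible
      \<open>D'\<close>, so conjugation by a unitriangular matrix with entry \<open>g\<close>
      removes it.\<close>
    define g where "g = b * E"
    have g: "g \<in> carrier_mat 1 n" using b E by (simp add: g_def)
    have gD: "g * D' = b" unfolding g_def using b E D' by (simp add: assoc_mult_mat[of _ 1 n _ n _ n])
    let ?P = "four_block_mat (1\<^sub>m 1) g (0\<^sub>m n 1) (1\<^sub>m n)" and ?Q = "four_block_mat (1\<^sub>m 1) (- g) (0\<^sub>m n 1) (1\<^sub>m n)"
    let ?D0 = "four_block_mat (0\<^sub>m 1 1) (0\<^sub>m 1 n) (0\<^sub>m n 1) D'"
    let ?D1 = "four_block_mat (0\<^sub>m 1 1) (0\<^sub>m 1 n) (0\<^sub>m n 1) (L * R)"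
    have m0: "- 0\<^sub>m k l = (0\<^sub>m k l :: 'a mat)" for k l by auto
    have PQ: "?P * ?Q = 1\<^sub>m (Suc n)" "?Q * ?P = 1\<^sub>m (Suc n)"
    proof -
      have 0: "- g + g = 0\<^sub>m 1 n" "g + - g = 0\<^sub>m 1 n" using g by (auto intro!: eq_matI)
      show "?P * ?Q = 1\<^sub>m (Suc n)" "?Q * ?P = 1\<^sub>m (Suc n)"
        using g 0 four_block_one_mat[of 1 n] by (simp_all add: m0 mult_four_block_mat[of _ 1 1 _ n _ n _ _ 1 _ n])
    qed
    have "?P * ?D0 * ?Q = D"
    proof -
      have "?P * ?D0 = four_block_mat (0\<^sub>m 1 1) b (0\<^sub>m n 1) D'"
        using g D' b by (simp add: m0 mult_four_block_mat[of _ 1 1 _ n _ n _ _ 1 _ n] gD)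
      also have "\<dots> * ?Q = D" unfolding D_block
        using g D' b by (simp add: m0 mult_four_block_mat[of _ 1 1 _ n _ n _ _ 1 _ n])
      finally show ?thesis .
    qed
    then have "similar_mat D ?D0"
      using D PQ g D' by (intro similar_matI[of _ _ ?P ?Q "Suc n"]) auto
    moreover have "similar_mat ?D0 ?D1"
      by (rule similar_mat_four_block_0_0[OF similar_mat_refl LR(3)]) (use D' in auto)
    ultimately have sim: "similar_mat D ?D1" using similar_mat_trans by blast
    \<comment> \<open>\<open>- L\<close> is moved down by one row and \<open>R\<close> to the right
      by one column. The inner index is unaffected, so the product is diag(0, - L R), while both
      triangular factors become strictly triangular.\<close>
    define Y where "Y = mat (Suc n) (Suc n) (\<lambda>(i,j). if i = 0 \<or> j = n then 0 else - L $$ (i - 1, j))"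
    define Z where "Z = mat (Suc n) (Suc n) (\<lambda>(i,j). if i = n \<or> j = 0 then 0 else R $$ (i, j - 1))"
    have YZ: "Y \<in> carrier_mat (Suc n) (Suc n)" "Z \<in> carrier_mat (Suc n) (Suc n)" by (simp_all add: Y_def Z_def)
    have "- (Y * Z) = ?D1"
    proof (rule eq_matI)
      fix i j assume "i < dim_row ?D1" "j < dim_col ?D1"
      then have i: "i < Suc n" and j: "j < Suc n" using LR(1,2) by auto
      have "(- (Y * Z)) $$ (i,j) = - (\<Sum>k<Suc n. Y $$ (i,k) * Z $$ (k,j))"
        using i j YZ by (simp add: scalar_prod_def atLeast0LessThan del: sum.lessThan_Suc)
      also have "\<dots> = - (\<Sum>k<n. Y $$ (i,k) * Z $$ (k,j))"
        using i by (simp add: Y_def)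
      also have "\<dots> = ?D1 $$ (i,j)"
        using i j LR(1,2)
        by (cases i; cases j) (auto simp: Y_def Z_def scalar_prod_def atLeast0LessThan sum_negf[symmetric])
      finally show "(- (Y * Z)) $$ (i,j) = ?D1 $$ (i,j)" .
    qed (use YZ LR in auto)
    moreover have "nilpotent_completion (Suc n) (- (Y * Z))"
    proof (rule nilpotent_completion_product[OF YZ])
      fix i j assume ij: "i < Suc n" "j < Suc n"
      show "j < i" if "Y $$ (i,j) \<noteq> 0"
      proof (rule ccontr)
        assume "\<not> j < i"
        moreover have "i \<noteq> 0" "j \<noteq> n" using that ij by (simp_all add: Y_def split: if_splits)
        ultimately have "L $$ (i - 1, j) = 0" using ij by (intro LR(4)) auto
        then show False using that ij by (simp add: Y_def split: if_splits)
      qed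
      show "i < j" if "Z $$ (i,j) \<noteq> 0"
      proof (rule ccontr)
        assume "\<not> i < j"
        moreover have "i \<noteq> n" "j \<noteq> 0" using that ij by (simp_all add: Z_def split: if_splits)
        ultimately have "R $$ (i, j - 1) = 0" using ij by (intro LR(5)) auto
        then show False using that ij by (simp add: Z_def split: if_splits)
      qed
    qed
    ultimately show ?thesis using nilpotent_completion_similar[OF D(1) sim] by simp
  qed
  then show ?case by (rule nilpotent_completion_similar[OF Suc.prems(1) D(2)])
qed

section \<open>Transfer along similarity, and the block form of the product\<close>

lemma similar_nilpotent_involution_product:
  assumes "similar_mat A B" and "nilpotent_involution_product B"
  shows "nilpotent_involution_product A"
proof -
  define n where "n = dim_row A"
  from assms(1) obtain P Q where "similar_mat_wit A B P Q" by (auto simp: similar_mat_def)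
  note w = similar_mat_witD[OF n_def this]
  have dB: "dim_row B = n" using w(5) by simp
  from assms(2) obtain N U where NU: "N \<in> carrier_mat n n" "U \<in> carrier_mat n n"
      "nilpotent_mat N" "involutive_mat U" "B = N * U"
    unfolding nilpotent_involution_product_def dB by blast
  have UU: "U * U = 1\<^sub>m n" using NU by (simp add: involutive_mat_def)
  obtain k where Nk: "N ^\<^sub>m k = 0\<^sub>m n n" using NU by (auto simp: nilpotent_mat_def)
  let ?N = "P * N * Q" and ?U = "P * U * Q"
  have car: "?N \<in> carrier_mat n n" "?U \<in> carrier_mat n n" using w NU by auto
  have conj: "(P * M * Q) * (P * L * Q) = P * (M * L) * Q"
    if "M \<in> carrier_mat n n" "L \<in> carrier_mat n n" for M L
  proof -
    have "(P * M * Q) * (P * L * Q) = P * M * (Q * (P * L * Q))"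
      using w that by (intro assoc_mult_mat[of _ n n _ n _ n]) auto
    also have "Q * (P * L * Q) = Q * P * L * Q"
      using w(6,7) that by (simp add: assoc_mult_mat[of _ n n _ n _ n])
    also have "\<dots> = L * Q" using w(2) that by simp
    also have "P * M * (L * Q) = P * (M * L) * Q"
    proof -
      have "P * M * (L * Q) = P * M * L * Q"
        using w that by (intro assoc_mult_mat[symmetric, of _ n n _ n _ n]) auto
      also have "P * M * L = P * (M * L)" using w that by (intro assoc_mult_mat[of _ n n _ n _ n]) auto
      finally show ?thesis .
    qed
    finally show ?thesis .
  qed
  have "similar_mat_wit ?N N P Q"
    using w NU by (intro similar_mat_witI[of _ _ n]) auto
  from similar_mat_wit_pow_id[OF this, of k] have "?N ^\<^sub>m k = 0\<^sub>m n n"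
    using w by (simp add: Nk)
  then have "nilpotent_mat ?N" using w(6,7) by (auto simp: nilpotent_mat_def intro!: exI[of _ k])
  moreover have "?U * ?U = 1\<^sub>m n" using conj[OF NU(2,2)] w UU by simp
  then have "involutive_mat ?U" using w(6,7) by (auto simp: involutive_mat_def)
  moreover have "A = ?N * ?U" using conj[OF NU(1,2)] w(3) NU(5) by simp
  ultimately show ?thesis
    unfolding nilpotent_involution_product_def n_def[symmetric] using car by blast
qed

lemma nilpotent_matI:
  assumes N: "N \<in> carrier_mat n n" and van: "\<And>v. v \<in> carrier_vec n \<Longrightarrow> (((*\<^sub>v) N) ^^ k) v = 0\<^sub>v n"
  shows "nilpotent_mat N"
proof -
  have "N ^\<^sub>m k = 0\<^sub>m n n"
  proof (rule mat_col_eqI)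
    fix j assume "j < dim_col (0\<^sub>m n n :: 'a mat)"
    then have j: "j < n" by simp
    have c: "N ^\<^sub>m k \<in> carrier_mat n n" using N by simp
    have "col (N ^\<^sub>m k) j = (N ^\<^sub>m k) *\<^sub>v unit_vec n j"
      using c j by (intro eq_vecI) auto
    also have "\<dots> = 0\<^sub>v n" using pow_mat_mult_vec[OF N, of "unit_vec n j" k] van by simp
    finally show "col (N ^\<^sub>m k) j = col (0\<^sub>m n n) j" using j by simp
  qed (use N in auto)
  then show ?thesis using N by (auto simp: nilpotent_mat_def)
qed

lemma funpow_mult_vec_carrier:
  assumes "N \<in> carrier_mat n n" "v \<in> carrier_vec n"
  shows "(((*\<^sub>v) N) ^^ t) v \<in> carrier_vec n"
  using assms by (induction t) auto

text \<open>With respect to a basis \<open>w\<^sub>i, A w\<^sub>i, z\<^sub>l\<close> such that \<open>A z\<^sub>l\<close> lies in the span of the \<open>A w\<^sub>i\<close>, the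
  involution may add arbitrary combinations of the \<open>w\<^sub>i\<close> to the other basis vectors; this changes the
  middle block of the matrix arbitrarily and kills the last columns.\<close>
lemma block_nilpotent_involution_product:
  fixes M :: "'a::field mat"
  assumes M: "M \<in> carrier_mat (s + (s + m)) (s + (s + m))"
    and shift: "\<And>i j. i < s + (s + m) \<Longrightarrow> j < s \<Longrightarrow> M $$ (i,j) = (if i = s + j then 1 else 0)"
    and rest: "\<And>i j. i < s + (s + m) \<Longrightarrow> j < m \<Longrightarrow> i < s \<or> s + s \<le> i \<Longrightarrow> M $$ (i, s + (s + j)) = 0"
    and sing: "det (mat s s (\<lambda>(i,j). M $$ (i, s + j))) = 0"
  shows "nilpotent_involution_product M"
proof -
  let ?n = "s + (s + m)"
  \<comment> \<open>The involution carries \<open>- 1\<close> on the lower blocks, so the upper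
    middle block of \<open>M * U\<close> is the negative of that of \<open>M\<close>.\<close>
  define C where "C = - mat s s (\<lambda>(i,j). M $$ (i, s + j))"
  have C: "C \<in> carrier_mat s s" by (simp add: C_def)
  have "det C = 0" unfolding C_def using sing by (subst det_0_negate[of _ s]) auto
  from singular_nilpotent_completion[OF C this] obtain W k where W: "W \<in> carrier_mat s s" and
    van: "\<And>q. (\<forall>t. q t \<in> carrier_vec s) \<Longrightarrow> (\<forall>t. q (Suc (Suc t)) = C *\<^sub>v q t + W *\<^sub>v q (Suc t)) \<Longrightarrow> \<forall>t\<ge>k. q t = 0\<^sub>v s"
    unfolding nilpotent_completion_def by blast
  \<comment> \<open>The middle rows of \<open>M * U\<close> become (1, W, 0): \<open>V\<close> adds
    the middle rows of \<open>M\<close>, which cancel against the sign from \<open>- 1\<close>, and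
    the extra \<open>W\<close>.\<close>
  define V where "V = mat s (s + m) (\<lambda>(i,j). M $$ (s + i, s + j) + (if j < s then W $$ (i,j) else 0))"
  have V: "V \<in> carrier_mat s (s + m)" by (simp add: V_def)
  define U where "U = four_block_mat (1\<^sub>m s) V (0\<^sub>m (s + m) s) (- 1\<^sub>m (s + m))"
  have U: "U \<in> carrier_mat ?n ?n" using V by (simp add: U_def)
  have "U * U = four_block_mat (1\<^sub>m s) (0\<^sub>m s (s + m)) (0\<^sub>m (s + m) s) (1\<^sub>m (s + m))"
    unfolding U_def using V
    by (subst mult_four_block_mat[of _ s s _ "s + m" _ "s + m" _ _ s _ "s + m"])
      (auto intro!: cong_four_block_mat eq_matI)
  then have UU: "U * U = 1\<^sub>m ?n" by simp
  define N where "N = M * U"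
  have N: "N \<in> carrier_mat ?n ?n" using M U by (simp add: N_def)
  have Uv: "(U *\<^sub>v v) $ i = (if i < s then v $ i + (\<Sum>j<s + m. V $$ (i,j) * v $ (s + j)) else - v $ i)"
    if "v \<in> carrier_vec ?n" "i < ?n" for v i
  proof -
    have "(U *\<^sub>v v) $ i = (\<Sum>j<s. U $$ (i,j) * v $ j) + (\<Sum>j<s + m. U $$ (i, s + j) * v $ (s + j))"
      unfolding sum_lessThan_add[symmetric, of "\<lambda>j. U $$ (i,j) * v $ j"] using that U
      by (simp add: scalar_prod_def atLeast0LessThan)
    also have "\<dots> = (if i < s then v $ i + (\<Sum>j<s + m. V $$ (i,j) * v $ (s + j)) else - v $ i)"
    proof (cases "i < s")
      case True
      have "(\<Sum>j<s. U $$ (i,j) * v $ j) = (\<Sum>j<s. if j = i then v $ i else 0)"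
        using True V by (intro sum.cong) (auto simp: U_def)
      moreover have "(\<Sum>j<s + m. U $$ (i, s + j) * v $ (s + j)) = (\<Sum>j<s + m. V $$ (i,j) * v $ (s + j))"
        using True V by (intro sum.cong) (auto simp: U_def)
      ultimately show ?thesis using True by simp
    next
      case False
      have "(\<Sum>j<s. U $$ (i,j) * v $ j) = 0"
        using False V that by (intro sum.neutral) (auto simp: U_def)
      moreover have "(\<Sum>j<s + m. U $$ (i, s + j) * v $ (s + j)) = (\<Sum>j<s + m. if j = i - s then - v $ i else 0)"
        using False V that by (intro sum.cong) (auto simp: U_def)
      ultimately show ?thesis using False that by simp
    qed
    finally show ?thesis .
  qed
  have Nv: "(N *\<^sub>v v) $ i = (\<Sum>j<s. M $$ (i,j) * (U *\<^sub>v v) $ j) -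
      (\<Sum>j<s + m. M $$ (i, s + j) * v $ (s + j))"
    if v: "v \<in> carrier_vec ?n" and i: "i < ?n" for v i
  proof -
    have "N *\<^sub>v v = M *\<^sub>v (U *\<^sub>v v)" unfolding N_def using M U v by (intro assoc_mult_mat_vec) auto
    then have "(N *\<^sub>v v) $ i = (\<Sum>j<?n. M $$ (i,j) * (U *\<^sub>v v) $ j)"
      using i M U by (simp add: scalar_prod_def[of "row M i"] atLeast0LessThan del: index_mult_mat_vec add: index_mult_mat_vec[of i M])
    then show ?thesis
      unfolding sum_lessThan_add[of _ s] using Uv[OF v] by (simp add: sum_negf del: index_mult_mat_vec)
  qed
  have N_low: "(N *\<^sub>v v) $ i = (\<Sum>j<s. C $$ (i,j) * v $ (s + j))"
    if v: "v \<in> carrier_vec ?n" and i: "i < s" for v i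
  proof -
    have "(\<Sum>j<s. M $$ (i,j) * (U *\<^sub>v v) $ j) = 0"
      using i shift by (intro sum.neutral) auto
    moreover have "(\<Sum>j<s + m. M $$ (i, s + j) * v $ (s + j)) = (\<Sum>j<s. M $$ (i, s + j) * v $ (s + j))"
      unfolding sum_lessThan_add using i rest by simp
    moreover have "(\<Sum>j<s. C $$ (i,j) * v $ (s + j)) = - (\<Sum>j<s. M $$ (i, s + j) * v $ (s + j))"
      using i by (simp add: C_def sum_negf)
    ultimately show ?thesis using Nv[OF v, of i] i by simp
  qed
  have N_mid: "(N *\<^sub>v v) $ (s + i) = v $ i + (\<Sum>j<s. W $$ (i,j) * v $ (s + j))"
    if v: "v \<in> carrier_vec ?n" and i: "i < s" for v i
  proof -
    have "(\<Sum>j<s. M $$ (s + i,j) * (U *\<^sub>v v) $ j) = (\<Sum>j<s. if j = i then (U *\<^sub>v v) $ i else 0)"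
      using i shift by (intro sum.cong) auto
    also have "\<dots> = v $ i + (\<Sum>j<s + m. V $$ (i,j) * v $ (s + j))"
      using i Uv[OF v, of i] by (simp del: index_mult_mat_vec)
    also have "(\<Sum>j<s + m. V $$ (i,j) * v $ (s + j)) =
        (\<Sum>j<s + m. M $$ (s + i, s + j) * v $ (s + j)) + (\<Sum>j<s + m. (if j < s then W $$ (i,j) else 0) * v $ (s + j))"
      using i unfolding sum.distrib[symmetric] by (intro sum.cong) (auto simp: V_def distrib_right)
    also have "(\<Sum>j<s + m. (if j < s then W $$ (i,j) else 0) * v $ (s + j)) = (\<Sum>j<s. W $$ (i,j) * v $ (s + j))"
      unfolding sum_lessThan_add by simp
    finally show ?thesis using Nv[OF v, of "s + i"] i by simp
  qed
  have N_high: "(N *\<^sub>v v) $ i = - (\<Sum>j<s. M $$ (i, s + j) * v $ (s + j))"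
    if v: "v \<in> carrier_vec ?n" and i: "s + s \<le> i" "i < ?n" for v i
  proof -
    have "(\<Sum>j<s. M $$ (i,j) * (U *\<^sub>v v) $ j) = 0"
      using i shift by (intro sum.neutral) auto
    moreover have "(\<Sum>j<s + m. M $$ (i, s + j) * v $ (s + j)) = (\<Sum>j<s. M $$ (i, s + j) * v $ (s + j))"
      unfolding sum_lessThan_add using i rest by simp
    ultimately show ?thesis using Nv[OF v, of i] i by simp
  qed
  have "nilpotent_mat N"
  proof (rule nilpotent_matI[OF N])
    fix v :: "'a vec" assume v: "v \<in> carrier_vec ?n"
    define x where "x t = (((*\<^sub>v) N) ^^ t) v" for t
    have x: "x t \<in> carrier_vec ?n" for t unfolding x_def by (rule funpow_mult_vec_carrier[OF N v])
    have xS: "x (Suc t) = N *\<^sub>v x t" for t by (simp add: x_def)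
    \<comment> \<open>The middle part of the orbit. Its upper part is \<open>C\<close> applied to
      the previous middle part, so substitution yields the second-order recurrence.\<close>
    define q where "q t = vec s (\<lambda>i. x t $ (s + i))" for t
    have "q (Suc (Suc t)) = C *\<^sub>v q t + W *\<^sub>v q (Suc t)" for t
    proof (rule eq_vecI)
      fix i assume "i < dim_vec (C *\<^sub>v q t + W *\<^sub>v q (Suc t))"
      then have i: "i < s" using W by simp
      have "q (Suc (Suc t)) $ i = x (Suc t) $ i + (\<Sum>j<s. W $$ (i,j) * x (Suc t) $ (s + j))"
        using i N_mid[OF x i, of "Suc t"] by (simp add: q_def xS del: index_mult_mat_vec)
      also have "x (Suc t) $ i = (\<Sum>j<s. C $$ (i,j) * x t $ (s + j))"
        using N_low[OF x i, of t] by (simp add: xS del: index_mult_mat_vec)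
      finally show "q (Suc (Suc t)) $ i = (C *\<^sub>v q t + W *\<^sub>v q (Suc t)) $ i"
        using i C W by (simp add: scalar_prod_def atLeast0LessThan q_def)
    qed (use W in \<open>simp add: q_def\<close>)
    then have q0: "\<forall>t\<ge>k. q t = 0\<^sub>v s" by (intro van) (auto simp: q_def)
    have mid0: "x t $ (s + i) = 0" if "k \<le> t" "i < s" for t i
    proof -
      have "q t $ i = 0" using q0 that by simp
      then show ?thesis using that by (simp add: q_def)
    qed
    \<comment> \<open>Upper and last parts depend only on the middle part one step earlier, so they
      vanish one step after it.\<close>
    have "x (Suc k) = 0\<^sub>v ?n"
    proof (rule eq_vecI)
      fix i assume "i < dim_vec (0\<^sub>v ?n :: 'a vec)"
      then have i: "i < ?n" by simp
      consider "i < s" | j where "j < s" "i = s + j" | "s + s \<le> i"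
        by (metis add_less_cancel_left le_add_diff_inverse not_less)
      then show "x (Suc k) $ i = 0\<^sub>v ?n $ i"
      proof cases
        case 1
        then show ?thesis using N_low[OF x 1, of k] mid0[of k] by (simp add: xS del: index_mult_mat_vec)
      next
        case 2
        then show ?thesis using mid0[of "Suc k" j] by simp
      next
        case 3
        then show ?thesis using N_high[OF x 3 i, of k] mid0[of k] i by (simp add: xS del: index_mult_mat_vec)
      qed
    qed (use x[of "Suc k"] in simp)
    then show "(((*\<^sub>v) N) ^^ Suc k) v = 0\<^sub>v ?n" by (simp only: x_def)
  qed
  moreover have "involutive_mat U" using U UU by (auto simp: involutive_mat_def)
  moreover have "M = N * U"
  proof -
    have "N * U = M * (U * U)" unfolding N_def using M U by (intro assoc_mult_mat) auto
    then show ?thesis using M UU by simp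
  qed
  ultimately show ?thesis
    unfolding nilpotent_involution_product_def using M N U by (intro exI[of _ N] exI[of _ U]) simp
qed

section \<open>Halving a cyclic basis\<close>

text \<open>Only spans are tracked here; independence follows later from a spanning set of n vectors
  in dimension n.\<close>

locale additive_operator = Modules.module scale
  for scale :: "'r::comm_ring_1 \<Rightarrow> 'b::ab_group_add \<Rightarrow> 'b" +
  fixes T :: "'b \<Rightarrow> 'b"
  assumes T_add: "T (x + y) = T x + T y"
begin

text \<open>The invariant of the construction: \<open>S\<close> is covered so far, a vector in
  \<open>ws\<close> covers itself and its image, and a vector in \<open>ps\<close> is still waiting
  for a partner. The condition on \<open>T p\<close> ensures that once \<open>p\<close> is covered
  by \<open>ws\<close>, its image is covered as well.\<close>

definition halving_state :: "'b set \<Rightarrow> 'b list \<Rightarrow> 'b list \<Rightarrow> 'b set \<Rightarrow> bool" where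
  "halving_state Z ws ps S \<longleftrightarrow> S \<subseteq> span (Z \<union> set ws \<union> T ` set ws \<union> set ps) \<and>
     (\<forall>p\<in>set ps. T p \<in> span (insert p (Z \<union> set ws \<union> T ` set ws)))"

lemma span_mono_mem: "x \<in> span A \<Longrightarrow> A \<subseteq> B \<Longrightarrow> x \<in> span B"
  using span_mono by blast

lemma span_subset_trans: "x \<in> span A \<Longrightarrow> A \<subseteq> span B \<Longrightarrow> x \<in> span B"
  using span_mono[of A "span B"] by (auto simp: span_span)

text \<open>\<open>u\<close> vectors of the chain are already covered by \<open>ws\<close>. As long
  as vectors wait, each further chain vector is paired with one of them; afterwards the chain is
  taken in consecutive pairs and may leave one vector waiting.\<close>

lemma halving_step:
  assumes "halving_state Z ws ps S"
    and "\<And>j. j < u \<Longrightarrow> (T ^^ j) h \<in> span (Z \<union> set ws \<union> T ` set ws)"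
    and "0 < u" "u \<le> d"
    and top: "(T ^^ d) h \<in> span (Z \<union> (\<lambda>j. (T ^^ j) h) ` {..<d})"
  shows "\<exists>ws' ps'. halving_state Z ws' ps' (S \<union> (\<lambda>j. (T ^^ j) h) ` {..<d}) \<and>
     2 * length ws' + length ps' = 2 * length ws + length ps + (d - u) \<and>
     length ps' \<le> max (length ps - (d - u)) 1"
  using assms(1-4)
proof (induction "d - u" arbitrary: u ws ps rule: less_induct)
  case less
  let ?B = "\<lambda>ws. Z \<union> set ws \<union> T ` set ws"
  have S: "S \<subseteq> span (?B ws \<union> set ps)" and Tp: "\<And>p. p \<in> set ps \<Longrightarrow> T p \<in> span (insert p (?B ws))"
    using less.prems(1) by (auto simp: halving_state_def)
  consider "u = d" | p ps2 where "u < d" "ps = p # ps2" | "u + 2 \<le> d" "ps = []" | "Suc u = d" "ps = []"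
    using less.prems(4) by (cases ps) force+
  then show ?case
  proof cases
    case 1
    have "(\<lambda>j. (T ^^ j) h) ` {..<d} \<subseteq> span (?B ws \<union> set ps)"
      using less.prems(2) 1 by (auto intro: span_mono_mem)
    with 1 less.prems(1) show ?thesis
      by (intro exI[of _ ws] exI[of _ ps]) (auto simp: halving_state_def)
  next
    case 2
    \<comment> \<open>One new vector covers two: \<open>p\<close> by subtracting a covered chain
      vector from \<open>w\<close>, and \<open>(T ^^ u) h\<close> by subtracting \<open>T p\<close>
      from \<open>T w\<close>.\<close>
    define w where "w = p + (T ^^ (u - 1)) h"
    have old: "x \<in> span (?B (w # ws))" if "x \<in> span (?B ws)" for x
      using that by (rule span_mono_mem) auto
    have wB: "w \<in> span (?B (w # ws))" "T w \<in> span (?B (w # ws))" by (auto intro: span_base)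
    have "w - (T ^^ (u - 1)) h \<in> span (?B (w # ws))"
      using wB(1) old[OF less.prems(2)[of "u - 1"]] less.prems(3) by (intro span_diff) auto
    then have p: "p \<in> span (?B (w # ws))" by (simp add: w_def)
    have "T p \<in> span (?B (w # ws))"
      by (rule span_subset_trans[OF Tp[of p]]) (use 2 p old in \<open>auto intro: span_base\<close>)
    then have "T w - T p \<in> span (?B (w # ws))" using wB(2) by (intro span_diff)
    moreover have "T w - T p = (T ^^ u) h"
      using less.prems(3) by (cases u) (simp_all add: w_def T_add)
    ultimately have new: "(T ^^ u) h \<in> span (?B (w # ws))" by simp
    have "halving_state Z (w # ws) ps2 S"
      unfolding halving_state_def
    proof (intro conjI ballI subsetI)
      fix x assume "x \<in> S"
      with S have "x \<in> span (?B ws \<union> set ps)" by blast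
      then show "x \<in> span (?B (w # ws) \<union> set ps2)"
      proof (rule span_subset_trans)
        have "p \<in> span (?B (w # ws) \<union> set ps2)" using p by (rule span_mono_mem) auto
        then show "?B ws \<union> set ps \<subseteq> span (?B (w # ws) \<union> set ps2)"
          using 2 by (auto intro: span_base)
      qed
    next
      fix p' assume "p' \<in> set ps2"
      then have "T p' \<in> span (insert p' (?B ws))" using Tp 2 by simp
      then show "T p' \<in> span (insert p' (?B (w # ws)))" by (rule span_mono_mem) auto
    qed
    moreover have "(T ^^ j) h \<in> span (?B (w # ws))" if "j < Suc u" for j
      using that less.prems(2) old new by (cases "j = u") auto
    ultimately obtain ws' ps' where "halving_state Z ws' ps' (S \<union> (\<lambda>j. (T ^^ j) h) ` {..<d})"
      "2 * length ws' + length ps' = 2 * length (w # ws) + length ps2 + (d - Suc u)"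
      "length ps' \<le> max (length ps2 - (d - Suc u)) 1"
      using less.hyps[of "Suc u" "w # ws" ps2] 2 by (meson diff_less_mono2 lessI Suc_leI zero_less_Suc)
    then show ?thesis using 2 by (intro exI[of _ ws'] exI[of _ ps']) auto
  next
    case 3
    \<comment> \<open>Nothing waits and two chain vectors remain, so this one and its image cover
      both.\<close>
    define w where "w = (T ^^ u) h"
    have old: "x \<in> span (?B (w # ws))" if "x \<in> span (?B ws)" for x
      using that by (rule span_mono_mem) auto
    have "halving_state Z (w # ws) [] S"
      unfolding halving_state_def using S 3 old by auto
    moreover have "(T ^^ j) h \<in> span (?B (w # ws))" if "j < u + 2" for j
    proof -
      have "j < u \<or> j = u \<or> j = Suc u" using that by linarith
      then show ?thesis using less.prems(2) old by (auto simp: w_def intro: span_base)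
    qed
    ultimately obtain ws' ps' where "halving_state Z ws' ps' (S \<union> (\<lambda>j. (T ^^ j) h) ` {..<d})"
      "2 * length ws' + length ps' = 2 * length (w # ws) + length ([] :: 'b list) + (d - (u + 2))"
      "length ps' \<le> max (length ([] :: 'b list) - (d - (u + 2))) 1"
      using less.hyps[of "u + 2" "w # ws" "[]"] 3 diff_less_mono2[of u "u + 2" d] by auto
    then show ?thesis using 3 by (intro exI[of _ ws'] exI[of _ ps']) auto
  next
    case 4
    \<comment> \<open>The last vector of an odd remainder has to wait. Its image is the end of the
      chain, which \<open>top\<close> puts into the span required of a waiting vector.\<close>
    define p where "p = (T ^^ u) h"
    have all: "(T ^^ j) h \<in> span (insert p (?B ws))" if "j < d" for j
    proof (cases "j = u")
      case False
      then have "(T ^^ j) h \<in> span (?B ws)" using less.prems(2) that 4 by auto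
      then show ?thesis by (rule span_mono_mem) auto
    qed (auto simp: p_def intro: span_base)
    have "T p \<in> span (insert p (?B ws))"
    proof -
      have "T p = (T ^^ d) h" using 4 by (auto simp: p_def)
      moreover have "(T ^^ d) h \<in> span (insert p (?B ws))"
        by (rule span_subset_trans[OF top]) (use all in \<open>auto intro: span_base\<close>)
      ultimately show ?thesis by simp
    qed
    moreover have "x \<in> span (insert p (?B ws))" if "x \<in> S" for x
    proof -
      have "x \<in> span (?B ws)" using S 4 that by auto
      then show ?thesis by (rule span_mono_mem) auto
    qed
    ultimately have "halving_state Z ws [p] (S \<union> (\<lambda>j. (T ^^ j) h) ` {..<d})"
      using all unfolding halving_state_def by (auto simp: insert_commute)
    then show ?thesis using 4 by (intro exI[of _ ws] exI[of _ "[p]"]) auto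
  qed
qed

text \<open>A chain of length at least 2 is opened by taking \<open>h\<close> itself, which covers
  \<open>h\<close> and \<open>T h\<close>. This gives the start \<open>u = 2\<close>, and the
  surplus available to waiting vectors is \<open>d - 2\<close>.\<close>

lemma halving_blocks:
  assumes "halving_state Z ws ps S"
    and "\<And>h d. (h,d) \<in> set bl \<Longrightarrow> 2 \<le> d \<and> (T ^^ d) h \<in> span (Z \<union> (\<lambda>j. (T ^^ j) h) ` {..<d})"
  shows "\<exists>ws' ps'. halving_state Z ws' ps' (S \<union> (\<Union>(h,d)\<in>set bl. (\<lambda>j. (T ^^ j) h) ` {..<d})) \<and>
     2 * length ws' + length ps' = 2 * length ws + length ps + (\<Sum>x\<leftarrow>bl. snd x) \<and>
     length ps' \<le> max (length ps - (\<Sum>x\<leftarrow>bl. snd x - 2)) (if bl = [] then length ps else 1)"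
  using assms(1,2)
proof (induction bl arbitrary: ws ps S)
  case Nil
  then show ?case by (intro exI[of _ ws] exI[of _ ps]) auto
next
  case (Cons x bl)
  obtain h d where x: "x = (h,d)" by force
  have d: "2 \<le> d" "(T ^^ d) h \<in> span (Z \<union> (\<lambda>j. (T ^^ j) h) ` {..<d})" using Cons.prems(2)[of h d] x by auto
  have "halving_state Z (h # ws) ps S"
    using Cons.prems(1) unfolding halving_state_def by (auto intro: span_mono_mem)
  moreover have "(T ^^ j) h \<in> span (Z \<union> set (h # ws) \<union> T ` set (h # ws))" if "j < 2" for j
    using that by (auto simp: less_2_cases_iff intro: span_base)
  ultimately obtain ws1 ps1 where 1: "halving_state Z ws1 ps1 (S \<union> (\<lambda>j. (T ^^ j) h) ` {..<d})"
    "2 * length ws1 + length ps1 = 2 * length (h # ws) + length ps + (d - 2)"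
    "length ps1 \<le> max (length ps - (d - 2)) 1"
    using halving_step[of Z "h # ws" ps S 2 h d] d by auto
  from Cons.IH[OF 1(1)] Cons.prems(2) obtain ws' ps' where
    2: "halving_state Z ws' ps' (S \<union> (\<lambda>j. (T ^^ j) h) ` {..<d} \<union> (\<Union>(h,d)\<in>set bl. (\<lambda>j. (T ^^ j) h) ` {..<d}))"
      "2 * length ws' + length ps' = 2 * length ws1 + length ps1 + (\<Sum>x\<leftarrow>bl. snd x)"
      "length ps' \<le> max (length ps1 - (\<Sum>x\<leftarrow>bl. snd x - 2)) (if bl = [] then length ps1 else 1)"
    by (metis (no_types, lifting) list.set_intros(2))
  have "length ps' \<le> max (length ps - (\<Sum>x\<leftarrow>x # bl. snd x - 2)) 1"
    using 1(3) 2(3) x by (auto split: if_splits)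
  moreover have "2 * length ws' + length ps' = 2 * length ws + length ps + (\<Sum>x\<leftarrow>x # bl. snd x)"
    using 1(2) 2(2) x d(1) by simp
  ultimately show ?case using 2(1) x by (intro exI[of _ ws'] exI[of _ ps']) (auto simp: Un_assoc)
qed

text \<open>Blocks of length one wait until a longer block provides a vector \<open>x\<close> already reached, whose
  image is not: for such a waiting \<open>p\<close>, the vector \<open>w = p + x\<close> reaches both \<open>p\<close> and \<open>T x\<close>.\<close>
theorem halving:
  assumes bl: "\<And>h d. (h,d) \<in> set bl \<Longrightarrow> 1 \<le> d \<and> (T ^^ d) h \<in> span (Z \<union> (\<lambda>j. (T ^^ j) h) ` {..<d})"
    and sum: "(\<Sum>x\<leftarrow>bl. snd x) = 2 * s" and len: "length bl \<le> s"
  obtains ws where "length ws = s"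
    "\<And>h d j. (h,d) \<in> set bl \<Longrightarrow> j < d \<Longrightarrow> (T ^^ j) h \<in> span (Z \<union> set ws \<union> T ` set ws)"
proof -
  define os where "os = filter (\<lambda>x. snd x = 1) bl"
  define bs where "bs = filter (\<lambda>x. snd x \<noteq> 1) bl"
  have sums: "length os + (\<Sum>x\<leftarrow>bs. snd x) = 2 * s" "length os + length bs \<le> s"
  proof -
    have "length os + (\<Sum>x\<leftarrow>bs. snd x) = (\<Sum>x\<leftarrow>bl. snd x)" unfolding os_def bs_def by (induction bl) auto
    then show "length os + (\<Sum>x\<leftarrow>bs. snd x) = 2 * s" using sum by simp
    have "length os + length bs = length bl" unfolding os_def bs_def by (rule sum_length_filter_compl)
    then show "length os + length bs \<le> s" using len by simp
  qed
  have big: "2 \<le> d \<and> (T ^^ d) h \<in> span (Z \<union> (\<lambda>j. (T ^^ j) h) ` {..<d})" if "(h,d) \<in> set bs" for h d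
    using bl[of h d] that by (auto simp: bs_def)
  have excess: "(\<Sum>x\<leftarrow>bs. snd x - 2) + 2 * length bs = (\<Sum>x\<leftarrow>bs. snd x)"
    using big by (induction bs) (auto, fastforce)
  have "halving_state Z [] (map fst os) (fst ` set os)"
    unfolding halving_state_def
  proof (intro conjI ballI)
    fix p assume "p \<in> set (map fst os)"
    then have "(p,1) \<in> set bl" by (auto simp: os_def)
    from bl[OF this] show "T p \<in> span (insert p (Z \<union> set [] \<union> T ` set []))"
      by (auto elim: span_mono_mem)
  qed (auto intro: span_base)
  from halving_blocks[OF this, of bs] big obtain ws ps where
    st: "halving_state Z ws ps (fst ` set os \<union> (\<Union>(h,d)\<in>set bs. (\<lambda>j. (T ^^ j) h) ` {..<d}))"
    and l1: "2 * length ws + length ps = 2 * length ([] :: 'b list) + length (map fst os) + (\<Sum>x\<leftarrow>bs. snd x)"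
    and l2: "length ps \<le> max (length (map fst os) - (\<Sum>x\<leftarrow>bs. snd x - 2)) (if bs = [] then length (map fst os) else 1)"
    by blast
  \<comment> \<open>The total surplus of the long blocks is
    \<open>2 * s - length os - 2 * length bs\<close>, which is at least \<open>length os\<close>
    because there are at most \<open>s\<close> blocks. So at most one vector is left waiting, and
    parity excludes it.\<close>
  have "length ps \<le> 1" using l2 excess sums by (auto split: if_splits)
  moreover have "2 * length ws + length ps = 2 * s" using l1 sums(1) by simp
  ultimately have "length ps = 0" "length ws = s" by presburger+
  show ?thesis
  proof (rule that)
    show "length ws = s" by fact
    fix h d j assume hd: "(h,d) \<in> set bl" "j < d"
    have "(T ^^ j) h \<in> fst ` set os \<union> (\<Union>(h,d)\<in>set bs. (\<lambda>j. (T ^^ j) h) ` {..<d})"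
    proof (cases "d = 1")
      case True
      then show ?thesis using hd by (force simp: os_def)
    next
      case False
      then show ?thesis using hd by (auto simp: bs_def)
    qed
    moreover have "\<dots> \<subseteq> span (Z \<union> set ws \<union> T ` set ws)"
      using st \<open>length ps = 0\<close> by (simp add: halving_state_def)
    ultimately show "(T ^^ j) h \<in> span (Z \<union> set ws \<union> T ` set ws)" by (rule subsetD[rotated])
  qed
qed

end

section \<open>Adapted bases of K^n\<close>

context
  fixes A :: "'a::field mat" and n :: nat
  assumes A: "A \<in> carrier_mat n n"
begin

interpretation M: poly_module "act A n"
  unfolding poly_module_def by (rule euclidean_module_act[OF A])

abbreviation (input) "T \<equiv> act A n [:0,1:]"

lemma additive_operator_act: "additive_operator (\<lambda>c. act A n [:c:]) T"
proof
  fix a b :: 'a and x y :: "nat \<Rightarrow> 'a"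
  show "act A n [:a:] (x + y) = act A n [:a:] x + act A n [:a:] y" by (rule M.scale_right_distrib)
  show "act A n [:a + b:] x = act A n [:a:] x + act A n [:b:] x"
    using M.scale_left_distrib[of "[:a:]" "[:b:]" x] by simp
  show "act A n [:a:] (act A n [:b:] x) = act A n [:a * b:] x" by (simp add: mult.commute)
  show "act A n [:1:] x = x" using M.scale_one[of x] by (simp add: one_pCons)
  show "T (x + y) = T x + T y" by (rule M.scale_right_distrib)
qed

interpretation H: additive_operator "\<lambda>c. act A n [:c:]" T
  by (rule additive_operator_act)

lemma span_coefficients:
  assumes "x \<in> H.span ((!) bs ` J)" "J \<subseteq> {..<m}"
  shows "\<exists>c. (\<forall>j. j \<notin> J \<longrightarrow> c j = 0) \<and> (\<forall>i. x i = (\<Sum>j<m. c j * (bs ! j) i))"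
  using assms(1)
proof (induction rule: H.span_induct_alt)
  case base
  show ?case by (intro exI[of _ "\<lambda>_. 0"]) auto
next
  case (step a y z)
  then obtain k c where k: "k \<in> J" "y = bs ! k"
    and c: "\<forall>j. j \<notin> J \<longrightarrow> c j = 0" "\<forall>i. z i = (\<Sum>j<m. c j * (bs ! j) i)" by blast
  have "(\<Sum>j<m. (c j + (if j = k then a else 0)) * (bs ! j) i) = z i + a * y i" for i
  proof -
    have "(\<Sum>j<m. (if j = k then a else 0) * (bs ! j) i) = (\<Sum>j<m. if j = k then a * (bs ! k) i else 0)"
      by (intro sum.cong) auto
    also have "\<dots> = a * y i" using k assms(2) by auto
    finally show ?thesis using c(2) by (simp add: distrib_right sum.distrib)
  qed
  then show ?case using c(1) k(1)
    by (intro exI[of _ "\<lambda>j. c j + (if j = k then a else 0)"]) (auto simp: act_const[OF A])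
qed

text \<open>Two ways to make the upper middle block singular are provided: for \<open>m = 0\<close>
  it inherits a kernel vector from \<open>A\<close>; alternatively its first column vanishes,
  because \<open>T (T w_0)\<close> has no component along the w_i.\<close>

lemma basis_nilpotent_involution_product:
  assumes ws: "length ws = s" and zs: "length zs = m" and n: "n = s + (s + m)"
    and span: "\<And>x. \<forall>i\<ge>n. x i = 0 \<Longrightarrow> x \<in> H.span (set ws \<union> T ` set ws \<union> set zs)"
    and T_zs: "\<And>z. z \<in> set zs \<Longrightarrow> T z \<in> H.span (T ` set ws)"
    and sing: "m = 0 \<and> det A = 0 \<or> 0 < s \<and> T (T (ws ! 0)) \<in> H.span (T ` set ws \<union> set zs)"
  shows "nilpotent_involution_product A"
proof -
  define bs where "bs = ws @ map T ws @ zs"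
  have len: "length bs = n" using ws zs n by (simp add: bs_def)
  have set_bs: "set bs = (!) bs ` {..<n}" using len by (auto simp: set_conv_nth)
  have bs1: "bs ! (s + j) = T (bs ! j)" if "j < s" for j
    using that ws by (simp add: bs_def nth_append)
  have bs2: "bs ! (s + (s + j)) = zs ! j" if "j < m" for j
    using that ws by (simp add: bs_def nth_append)
  have T_ws: "T ` set ws = (!) bs ` {s..<s + s}"
  proof -
    have "T ` set ws = (\<lambda>j. bs ! (s + j)) ` {..<s}"
      using ws bs1 by (force simp: set_conv_nth bs_def nth_append)
    also have "\<dots> = (!) bs ` ((+) s ` {..<s})" by (simp only: image_image)
    also have "(+) s ` {..<s} = {s..<s + s}" by (simp add: lessThan_atLeast0)
    finally show ?thesis .
  qed
  have zs_bs: "set zs = (!) bs ` {s + s..<n}"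
  proof -
    have "set zs = (\<lambda>j. bs ! (s + s + j)) ` {..<m}"
      using zs bs2 by (force simp: set_conv_nth add.assoc)
    also have "\<dots> = (!) bs ` ((+) (s + s) ` {..<m})" by (simp only: image_image)
    also have "(+) (s + s) ` {..<m} = {s + s..<n}"
      unfolding lessThan_atLeast0 image_add_atLeastLessThan using n by (simp add: ac_simps)
    finally show ?thesis .
  qed
  define S where "S = mat n n (\<lambda>(i,j). (bs ! j) i)"
  have S: "S \<in> carrier_mat n n" by (simp add: S_def)
  have colS: "col S j = vec n (bs ! j)" if "j < n" for j using that by (auto simp: S_def)
  have Sc: "S *\<^sub>v vec n c = vec n x" if "\<And>i. x i = (\<Sum>j<n. c j * (bs ! j) i)" for c x
    using that by (intro eq_vecI) (auto simp: S_def scalar_prod_def atLeast0LessThan mult.commute)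
  have "\<exists>v\<in>carrier_vec n. S *\<^sub>v v = y" if y: "y \<in> carrier_vec n" for y
  proof -
    define y' where "y' i = (if i < n then y $ i else 0)" for i
    have "set ws \<union> T ` set ws \<union> set zs = (!) bs ` {..<n}"
      unfolding set_bs[symmetric] by (auto simp: bs_def)
    then have "y' \<in> H.span ((!) bs ` {..<n})" using span[of y'] by (simp add: y'_def)
    then obtain c where "\<forall>i. y' i = (\<Sum>j<n. c j * (bs ! j) i)" using span_coefficients[of y' bs "{..<n}" n] by blast
    then have "S *\<^sub>v vec n c = vec n y'" by (intro Sc) blast
    also have "\<dots> = y" using y by (intro eq_vecI) (auto simp: y'_def)
    finally show ?thesis by (intro bexI[of _ "vec n c"]) auto
  qed
  then obtain Q where Q: "Q \<in> carrier_mat n n" "S * Q = 1\<^sub>m n"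
    using surj_mat_right_inverse[OF S] by blast
  have QS: "Q * S = 1\<^sub>m n" using mat_mult_left_right_inverse[OF S Q] .
  define D where "D = Q * (A * S)"
  have D: "D \<in> carrier_mat n n" using Q S A by (simp add: D_def)
  have "S * D = (S * Q) * (A * S)"
    unfolding D_def using Q(1) S A by (intro assoc_mult_mat[symmetric, of _ n n _ n _ n]) auto
  then have "A * S = S * D" unfolding Q(2) using S A by simp
  then have sim: "similar_mat A D" using A D S Q by (intro intertwining_imp_similar) auto
  have colD: "col D j = vec n c" if j: "j < n" and c: "\<And>i. T (bs ! j) i = (\<Sum>k<n. c k * (bs ! k) i)" for j c
  proof -
    have "col D j = Q *\<^sub>v col (A * S) j"
      unfolding D_def using Q(1) S A j by (intro col_mult2[of _ n n _ n]) auto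
    also have "col (A * S) j = A *\<^sub>v col S j"
      using S A j by (intro col_mult2[of _ n n _ n]) auto
    also have "\<dots> = vec n (T (bs ! j))" unfolding colS[OF j] by (simp only: vec_act_X[OF A])
    also have "\<dots> = S *\<^sub>v vec n c" using Sc[of "T (bs ! j)" c] c by simp
    also have "Q *\<^sub>v \<dots> = (Q * S) *\<^sub>v vec n c"
      using Q S by (intro assoc_mult_mat_vec[symmetric]) auto
    finally show ?thesis by (simp add: QS)
  qed
  have D_entry: "D $$ (i,j) = c i"
    if "i < n" "j < n" "\<And>i. T (bs ! j) i = (\<Sum>k<n. c k * (bs ! k) i)" for i j c
  proof -
    have "D $$ (i,j) = col D j $ i" using that D by simp
    then show ?thesis using colD[OF that(2,3)] that(1) by simp
  qed
  have D_zero: "D $$ (i,j) = 0"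
    if ij: "i < n" "j < n" and J: "T (bs ! j) \<in> H.span ((!) bs ` J)" "J \<subseteq> {..<n}" "i \<notin> J" for i j J
  proof -
    obtain c where "\<forall>j. j \<notin> J \<longrightarrow> c j = 0" "\<forall>i. T (bs ! j) i = (\<Sum>k<n. c k * (bs ! k) i)"
      using span_coefficients[OF J(1,2)] by blast
    then show ?thesis using D_entry[OF ij, of c] J(3) by simp
  qed
  have shift: "D $$ (i,j) = (if i = s + j then 1 else 0)" if "i < n" "j < s" for i j
  proof (rule D_entry[of i j "\<lambda>k. if k = s + j then 1 else 0"])
    fix i
    have "(\<Sum>k<n. (if k = s + j then 1 else 0) * (bs ! k) i) = (\<Sum>k<n. if k = s + j then (bs ! k) i else 0)"
      by (intro sum.cong) auto
    also have "\<dots> = (bs ! (s + j)) i" using that n by simp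
    finally show "T (bs ! j) i = (\<Sum>k<n. (if k = s + j then 1 else 0) * (bs ! k) i)"
      using bs1[OF that(2)] by simp
  qed (use that n in auto)
  have rest: "D $$ (i, s + (s + j)) = 0" if "i < n" "j < m" "i < s \<or> s + s \<le> i" for i j
  proof (rule D_zero[of i _ "{s..<s + s}"])
    show "T (bs ! (s + (s + j))) \<in> H.span ((!) bs ` {s..<s + s})"
      unfolding T_ws[symmetric] bs2[OF that(2)] using that zs by (intro T_zs) simp
  qed (use that n in auto)
  define B where "B = mat s s (\<lambda>(i,j). D $$ (i, s + j))"
  have B: "B \<in> carrier_mat s s" by (simp add: B_def)
  have "\<exists>v. v \<in> carrier_vec s \<and> v \<noteq> 0\<^sub>v s \<and> B *\<^sub>v v = 0\<^sub>v s"
    using sing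
  proof
    assume *: "0 < s \<and> T (T (ws ! 0)) \<in> H.span (T ` set ws \<union> set zs)"
    have "T (bs ! s) \<in> H.span ((!) bs ` {s..<n})"
    proof -
      have "T ` set ws \<union> set zs = (!) bs ` ({s..<s + s} \<union> {s + s..<n})"
        unfolding T_ws zs_bs by blast
      also have "{s..<s + s} \<union> {s + s..<n} = {s..<n}" using n by auto
      finally show ?thesis using * bs1[of 0] ws by (simp add: bs_def nth_append)
    qed
    then have "D $$ (i,s) = 0" if "i < s" for i
      by (rule D_zero[rotated 2]) (use that n in auto)
    then have "B *\<^sub>v unit_vec s 0 = 0\<^sub>v s"
      using * by (intro eq_vecI) (auto simp: B_def)
    then show ?thesis using * by (intro exI[of _ "unit_vec s 0"]) auto
  next
    assume m: "m = 0 \<and> det A = 0"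
    then have "det D = 0" using det_similar[OF sim] by simp
    then obtain v where v: "v \<in> carrier_vec n" "v \<noteq> 0\<^sub>v n" "D *\<^sub>v v = 0\<^sub>v n"
      using det_0_iff_vec_prod_zero[OF D] by auto
    \<comment> \<open>The part of the kernel vector along the \<open>T w_i\<close>. It is nonzero,
      since the rows \<open>s + i\<close> would otherwise force the part along the w_i to vanish
      too.\<close>
    define u where "u = vec s (\<lambda>i. v $ (s + i))"
    have Dv: "(\<Sum>j<s. D $$ (i,j) * v $ j) + (\<Sum>j<s. D $$ (i, s + j) * v $ (s + j)) = 0" if "i < n" for i
    proof -
      have "(D *\<^sub>v v) $ i = (\<Sum>j<s + s. D $$ (i,j) * v $ j)"
        using that D v(1) m n by (simp add: scalar_prod_def atLeast0LessThan)
      then show ?thesis using v(3) that unfolding sum_lessThan_add by simp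
    qed
    have "B *\<^sub>v u = 0\<^sub>v s"
    proof (rule eq_vecI)
      fix i assume "i < dim_vec (0\<^sub>v s)"
      then have i: "i < s" by simp
      have "(\<Sum>j<s. D $$ (i,j) * v $ j) = 0" using i n shift by (intro sum.neutral) auto
      then show "(B *\<^sub>v u) $ i = 0\<^sub>v s $ i" using Dv[of i] i n
        by (simp add: B_def u_def scalar_prod_def atLeast0LessThan)
    qed (use B in simp)
    moreover have "u \<noteq> 0\<^sub>v s"
    proof
      assume u0: "u = 0\<^sub>v s"
      have v_high: "v $ (s + i) = 0" if "i < s" for i
      proof -
        have "u $ i = 0" using u0 that by simp
        then show ?thesis using that by (simp add: u_def)
      qed
      have v_low: "v $ i = 0" if i: "i < s" for i
      proof -
        have "(\<Sum>j<s. D $$ (s + i,j) * v $ j) = (\<Sum>j<s. if j = i then v $ i else 0)"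
          using i n shift by (intro sum.cong) auto
        then show ?thesis using Dv[of "s + i"] i n v_high by simp
      qed
      have "v = 0\<^sub>v n"
      proof (rule eq_vecI)
        fix i assume "i < dim_vec (0\<^sub>v n)"
        then have i: "i < n" by simp
        show "v $ i = 0\<^sub>v n $ i"
        proof (cases "i < s")
          case False
          then show ?thesis using v_high[of "i - s"] i m n by simp
        qed (use v_low i in simp)
      qed (use v in simp)
      with v(2) show False ..
    qed
    ultimately show ?thesis by (intro exI[of _ u]) (simp add: u_def)
  qed
  then have "det B = 0" using det_0_iff_vec_prod_zero[OF B] by blast
  then have "nilpotent_involution_product D"
    using D shift rest unfolding n B_def by (intro block_nilpotent_involution_product) auto
  with sim show ?thesis by (rule similar_nilpotent_involution_product)
qed

lemma span_subsetI: "B \<subseteq> H.span C \<Longrightarrow> x \<in> H.span B \<Longrightarrow> x \<in> H.span C"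
  by (rule H.span_subset_trans)

lemma T_scale: "T (act A n [:c:] x) = act A n [:c:] (T x)"
  by (rule M.scale_left_commute)

lemma T_span: "x \<in> H.span B \<Longrightarrow> T x \<in> H.span (T ` B)"
proof (induction rule: H.span_induct_alt)
  case base
  have "T 0 = 0" by (rule M.scale_zero_right)
  then show ?case using H.span_zero by metis
next
  case (step c x y)
  have "T x \<in> H.span (T ` B)" using step.hyps by (intro H.span_base imageI)
  then show ?case unfolding H.T_add T_scale by (rule H.span_add[OF H.span_scale step.IH])
qed

lemma scale_inverse: "c \<noteq> 0 \<Longrightarrow> act A n [:inverse c:] (act A n [:c:] x) = x"
  by (simp add: one_pCons[symmetric])

text \<open>In \<open>T (T w_0) = d + c z0 + b\<close> with \<open>d\<close> in the span of the
  \<open>T w_i\<close> and \<open>b\<close> in that of the w_i, the part \<open>b\<close> would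
  obstruct a zero column. It is hidden in the extra basis vector \<open>z\<close>, whose image still
  lies in the span of the \<open>T w_i\<close> because \<open>T z0 = 0\<close>.\<close>

lemma kernel_vector_adjustment:
  assumes z0: "T z0 = 0" and ws: "0 < length ws"
    and gen: "T (T (ws ! 0)) \<in> H.span (insert z0 (set ws \<union> T ` set ws))"
  obtains ws' z where "length ws' = length ws"
    "insert z0 (set ws \<union> T ` set ws) \<subseteq> H.span (set ws' \<union> T ` set ws' \<union> {z})"
    "T z \<in> H.span (T ` set ws')" "T (T (ws' ! 0)) \<in> H.span (T ` set ws' \<union> {z})"
proof -
  obtain c where "T (T (ws ! 0)) - act A n [:c:] z0 \<in> H.span (set ws \<union> T ` set ws)"
    using gen unfolding H.span_insert by blast
  then obtain b d where b: "b \<in> H.span (set ws)" and d: "d \<in> H.span (T ` set ws)"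
    and "T (T (ws ! 0)) - act A n [:c:] z0 = b + d" unfolding H.span_Un by blast
  then have TT: "T (T (ws ! 0)) = d + (act A n [:c:] z0 + b)" by (simp add: algebra_simps)
  have Tcb: "T (act A n [:c:] z0 + b) \<in> H.span (T ` set ws)"
    unfolding H.T_add T_scale z0 using T_span[OF b] by simp
  consider "c \<noteq> 0" | "c = 0" "b = 0" | "c = 0" "b \<noteq> 0" by blast
  then show ?thesis
  proof cases
    case 1
    \<comment> \<open>As \<open>c\<close> is invertible, \<open>z0\<close> is recovered from
      \<open>z\<close> and \<open>b\<close>, so nothing is lost from the span.\<close>
    define z where "z = act A n [:c:] z0 + b"
    let ?B = "set ws \<union> T ` set ws \<union> {z}"
    have bB: "b \<in> H.span ?B" using b by (rule H.span_mono_mem) auto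
    have "z - b \<in> H.span ?B" by (rule H.span_diff[OF H.span_base bB]) simp
    then have "act A n [:inverse c:] (z - b) \<in> H.span ?B" by (rule H.span_scale)
    also have "act A n [:inverse c:] (z - b) = z0" unfolding z_def using scale_inverse[OF 1, of z0] by simp
    finally have "insert z0 (set ws \<union> T ` set ws) \<subseteq> H.span ?B" by (auto intro: H.span_base)
    moreover have "T (T (ws ! 0)) \<in> H.span (T ` set ws \<union> {z})"
      unfolding TT z_def[symmetric]
      by (rule H.span_add[OF H.span_mono_mem[OF d] H.span_base]) auto
    ultimately show ?thesis using Tcb that[of ws z] by (simp add: z_def)
  next
    case 2
    have "T (T (ws ! 0)) \<in> H.span (T ` set ws \<union> {z0})"
      unfolding TT 2 using d by (auto intro: H.span_mono_mem)
    moreover have "insert z0 (set ws \<union> T ` set ws) \<subseteq> H.span (set ws \<union> T ` set ws \<union> {z0})"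
      by (auto intro: H.span_base)
    ultimately show ?thesis using that[of ws z0] z0 by (simp add: H.span_zero)
  next
    case 3
    obtain f where f: "b = (\<Sum>w\<in>set ws. act A n [:f w:] w)" using b H.span_finite[of "set ws"] by auto
    with 3(2) obtain w where w: "w \<in> set ws" "f w \<noteq> 0"
      by (metis (no_types, lifting) M.scale_zero_left pCons_0_0 sum.neutral)
    \<comment> \<open>Here \<open>z = b\<close> alone would lose \<open>z0\<close>. Adding
      \<open>z0\<close> to one w with nonzero coefficient in \<open>b\<close> changes no image, and
      comparing the old with the new combination recovers a nonzero multiple of
      \<open>z0\<close>.\<close>
    define e where "e x = (if x = w then x + z0 else x)" for x
    define ws' where "ws' = map e ws"
    have Te: "T (e x) = T x" for x by (simp add: e_def H.T_add z0)
    have T_ws': "T ` set ws' = T ` set ws" by (simp add: ws'_def image_image Te)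
    let ?B = "set ws' \<union> T ` set ws' \<union> {b}"
    have "(\<Sum>x\<in>set ws. act A n [:f x:] (e x)) \<in> H.span ?B"
      by (intro H.span_sum H.span_scale H.span_base) (simp add: ws'_def)
    also have "(\<Sum>x\<in>set ws. act A n [:f x:] (e x)) = b + act A n [:f w:] z0"
    proof -
      have "(\<Sum>x\<in>set ws. act A n [:f x:] (e x)) =
          (\<Sum>x\<in>set ws. act A n [:f x:] x + (if x = w then act A n [:f w:] z0 else 0))"
        by (intro sum.cong) (auto simp: e_def M.scale_right_distrib)
      then show ?thesis using w(1) f by (simp add: sum.distrib)
    qed
    finally have "b + act A n [:f w:] z0 - b \<in> H.span ?B" by (rule H.span_diff[OF _ H.span_base]) simp
    then have "act A n [:f w:] z0 \<in> H.span ?B" by (simp only: add_diff_cancel_left')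
    then have "act A n [:inverse (f w):] (act A n [:f w:] z0) \<in> H.span ?B" by (rule H.span_scale)
    then have z0B: "z0 \<in> H.span ?B" unfolding scale_inverse[OF w(2)] .
    have "x \<in> H.span ?B" if "x \<in> set ws" for x
    proof -
      have ex: "e x \<in> H.span ?B" using that by (intro H.span_base) (simp add: ws'_def)
      show ?thesis
      proof (cases "x = w")
        case True
        then have "e x - z0 = x" by (simp add: e_def)
        then show ?thesis using H.span_diff[OF ex z0B] by simp
      next
        case False
        then show ?thesis using ex by (simp add: e_def)
      qed
    qed
    then have "insert z0 (set ws \<union> T ` set ws) \<subseteq> H.span ?B"
      using z0B T_ws' by (auto intro: H.span_base)
    moreover have "T (T (ws' ! 0)) \<in> H.span (T ` set ws' \<union> {b})"
    proof -
      have "T (T (ws' ! 0)) = d + b" using TT 3(1) ws by (simp add: ws'_def Te)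
      moreover have "d \<in> H.span (T ` set ws' \<union> {b})" using d T_ws' by (auto intro: H.span_mono_mem)
      ultimately show ?thesis by (simp add: H.span_add H.span_base)
    qed
    moreover have "T b \<in> H.span (T ` set ws')" unfolding T_ws' by (rule T_span[OF b])
    ultimately show ?thesis using that[of ws' b] by (simp add: ws'_def)
  qed
qed

lemma funpow_T: "(T ^^ j) h = act A n (monom 1 j) h"
proof (induction j)
  case 0
  then show ?case using M.scale_one[of h] by (simp add: monom_0 one_pCons)
next
  case (Suc j)
  then show ?case by (simp add: monom_Suc)
qed

lemma act_span: "degree q < d \<or> q = 0 \<Longrightarrow> act A n q h \<in> H.span ((\<lambda>j. (T ^^ j) h) ` {..<d})"
proof -
  assume "degree q < d \<or> q = 0"
  then have "act A n q h = act A n (\<Sum>i<d. monom (coeff q i) i) h" using poly_sum_monom[of q d] by simp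
  also have "\<dots> = (\<Sum>i<d. act A n [:coeff q i:] ((T ^^ i) h))"
    by (simp only: M.scale_sum_left M.const_scale funpow_T)
  also have "\<dots> \<in> H.span ((\<lambda>j. (T ^^ j) h) ` {..<d})"
    by (intro H.span_sum H.span_scale H.span_base) auto
  finally show ?thesis .
qed

text \<open>The vector \<open>P h\<close> is kept in the span instead of being assumed zero: for a
  proper divisor of the last invariant factor it will be the kernel vector.\<close>

lemma monic_top_span:
  assumes "lead_coeff P = 1"
  shows "(T ^^ degree P) h \<in> H.span (insert (act A n P h) ((\<lambda>j. (T ^^ j) h) ` {..<degree P}))" (is "_ \<in> H.span ?B")
proof -
  define r where "r = P - monom 1 (degree P)"
  have "degree r < degree P \<or> r = 0"
  proof (cases "degree P = 0")
    case True
    then show ?thesis using assms by (auto elim!: degree_eq_zeroE simp: r_def monom_0)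
  next
    case False
    have "degree r \<le> degree P - 1"
    proof (intro degree_le allI impI)
      fix i assume "degree P - 1 < i"
      then show "coeff r i = 0" using assms False by (cases "i = degree P") (auto simp: r_def coeff_eq_0)
    qed
    with False show ?thesis by linarith
  qed
  then have r: "act A n r h \<in> H.span ?B" by (rule H.span_mono_mem[OF act_span]) auto
  have "act A n P h - act A n r h \<in> H.span ?B" by (rule H.span_diff[OF H.span_base r]) simp
  moreover have "act A n P h - act A n r h = (T ^^ degree P) h"
    unfolding funpow_T M.scale_left_diff_distrib[symmetric] by (simp add: r_def)
  ultimately show ?thesis by simp
qed

theorem few_invariant_factors_product:
  assumes Ps: "is_invariant_factors A Ps" and n: "0 < n" and det: "det A = 0"
    and sing: "poly (Ps ! (n - 1)) 0 = 0"
    and few: "card {i. i < n \<and> degree (Ps ! i) \<noteq> 0} \<le> n div 2"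
  shows "nilpotent_involution_product A"
proof -
  obtain Ps' h where "is_invariant_factors A Ps'" and h0: "\<And>i. i < n \<Longrightarrow> act A n (Ps' ! i) (h i) = 0"
    and gen: "\<And>x. \<forall>i\<ge>n. x i = 0 \<Longrightarrow> \<exists>q. x = (\<Sum>i<n. act A n (q i) (h i))"
    using invariant_factors_generators[OF A] by blast
  with invariant_factors_unique[OF Ps] have [simp]: "Ps' = Ps" by simp
  have len: "length Ps = n" using is_invariant_factors_carrier(1)[OF Ps] A by auto
  have monic: "lead_coeff (Ps ! i) = 1" if "i < n" for i
    using that Ps len by (simp add: is_invariant_factors_def)
  define d where "d i = degree (Ps ! i)" for i
  define l where "l = n - 1"
  have l: "l < n" using n by (simp add: l_def)
  have sum_d: "(\<Sum>i<n. d i) = n"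
    using is_invariant_factors_carrier(2)[OF Ps] len by (simp add: sum_list_sum_nth atLeast0LessThan d_def)
  \<comment> \<open>If all degrees were at most 1, their sum \<open>n\<close> would equal the number
    of nontrivial factors, which is at most \<open>n div 2\<close>.\<close>
  have dl: "2 \<le> d l"
  proof (rule ccontr)
    assume "\<not> 2 \<le> d l"
    have "d i \<le> 1" if "i < n" for i
    proof -
      have "Ps ! i dvd Ps ! l" using that len by (intro invariant_factors_chain[OF Ps]) (auto simp: l_def)
      moreover have "Ps ! l \<noteq> 0" using monic[OF l] by auto
      ultimately have "d i \<le> d l" unfolding d_def by (rule dvd_imp_degree_le)
      with \<open>\<not> 2 \<le> d l\<close> show ?thesis by linarith
    qed
    then have "(\<Sum>i<n. d i) \<le> (\<Sum>i<n. if d i \<noteq> 0 then 1 else 0)" by (intro sum_mono) auto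
    also have "\<dots> = card {i. i < n \<and> degree (Ps ! i) \<noteq> 0}"
      by (simp add: sum.If_cases d_def Int_def)
    finally show False using few sum_d n by linarith
  qed
  obtain R where R: "Ps ! l = [:0,1:] * R"
    using sing unfolding poly_eq_0_iff_dvd l_def by (auto elim: dvdE)
  have "R \<noteq> 0" using R monic[OF l] by auto
  then have degR: "d l = Suc (degree R)" unfolding d_def R by (subst degree_mult_eq) auto
  have monicR: "lead_coeff R = 1" using monic[OF l] unfolding R lead_coeff_mult by simp
  \<comment> \<open>The last factor is X R, so this vector is killed by \<open>A\<close>.\<close>
  define z0 where "z0 = act A n R (h l)"
  have Tz0: "T z0 = 0" using h0[OF l] by (simp add: z0_def R)
  define t where "t = n mod 2"
  define Z where "Z = (if t = 1 then {z0} else {})"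
  \<comment> \<open>For odd \<open>n\<close> the last chain is shortened by one: modulo
    \<open>z0\<close> the generator \<open>h l\<close> is annihilated by \<open>R\<close>, of degree
    one less. The lengths then add up to \<open>2 * s\<close>.\<close>
  define e where "e i = (if i = l then d i - t else d i)" for i
  define s where "s = n div 2"
  have t: "t \<le> 1" "n = 2 * s + t" by (auto simp: t_def s_def)
  have e_le: "e i \<le> d i" for i by (simp add: e_def)
  have top: "(T ^^ e i) (h i) \<in> H.span (Z \<union> (\<lambda>j. (T ^^ j) (h i)) ` {..<e i})" if i: "i < n" for i
  proof (cases "i = l \<and> t = 1")
    case True
    then have "e i = degree R" by (simp add: e_def degR)
    then show ?thesis using monic_top_span[OF monicR, of "h l"] True by (simp add: Z_def z0_def)
  next
    case False
    then have "e i = d i" using t by (auto simp: e_def)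
    then have "(T ^^ e i) (h i) \<in> H.span (insert 0 ((\<lambda>j. (T ^^ j) (h i)) ` {..<e i}))"
      using monic_top_span[OF monic[OF i], of "h i"] h0[OF i] by (simp add: d_def)
    then show ?thesis by (rule span_subsetI[rotated]) (auto intro: H.span_base H.span_zero)
  qed
  define bl where "bl = map (\<lambda>i. (h i, e i)) (filter (\<lambda>i. e i \<noteq> 0) [0..<n])"
  have "(\<Sum>x\<leftarrow>bl. snd x) = (\<Sum>i<n. e i)"
  proof -
    have "(\<Sum>i\<leftarrow>filter (\<lambda>i. e i \<noteq> 0) xs. e i) = (\<Sum>i\<leftarrow>xs. e i)" for xs by (induction xs) auto
    then show ?thesis by (simp add: bl_def o_def sum_list_distinct_conv_sum_set atLeast0LessThan)
  qed
  also have "\<dots> = 2 * s"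
  proof -
    have "(\<Sum>i<n. d i) = (\<Sum>i<n. e i + (if i = l then t else 0))"
      using dl t(1) by (intro sum.cong) (auto simp: e_def)
    then show ?thesis using sum_d t(2) l by (simp add: sum.distrib)
  qed
  finally have sum_bl: "(\<Sum>x\<leftarrow>bl. snd x) = 2 * s" .
  have len_bl: "length bl \<le> s"
  proof -
    have "length bl = card {i. i < n \<and> e i \<noteq> 0}"
      by (simp add: bl_def length_filter_conv_card cong: conj_cong)
    also have "\<dots> \<le> card {i. i < n \<and> degree (Ps ! i) \<noteq> 0}"
    proof (intro card_mono Collect_mono impI)
      fix i assume "i < n \<and> e i \<noteq> 0"
      then show "i < n \<and> degree (Ps ! i) \<noteq> 0" using e_le[of i] by (simp add: d_def)
    qed simp
    finally show ?thesis using few by (simp add: s_def)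
  qed
  have bl: "1 \<le> d' \<and> (T ^^ d') x \<in> H.span (Z \<union> (\<lambda>j. (T ^^ j) x) ` {..<d'})" if "(x,d') \<in> set bl" for x d'
    using that top by (auto simp: bl_def)
  obtain ws where ws: "length ws = s"
    and reach: "\<And>x d' j. (x,d') \<in> set bl \<Longrightarrow> j < d' \<Longrightarrow> (T ^^ j) x \<in> H.span (Z \<union> set ws \<union> T ` set ws)"
    using H.halving[OF bl sum_bl len_bl] by blast
  let ?B = "Z \<union> set ws \<union> T ` set ws"
  have reach_e: "(T ^^ j) (h i) \<in> H.span ?B" if "i < n" "j < e i" for i j
    using that by (intro reach[of "h i" "e i"]) (auto simp: bl_def)
  \<comment> \<open>The vector cut off from the last chain is recovered from \<open>z0\<close> and
    the shorter chain.\<close>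
  have reach_d: "(T ^^ j) (h i) \<in> H.span ?B" if i: "i < n" "j < d i" for i j
  proof (cases "j < e i")
    case False
    then have "j = e i" using i t(1) by (auto simp: e_def split: if_splits)
    then show ?thesis using top[OF i(1)]
      by (elim span_subsetI[rotated] ssubst) (use reach_e i(1) in \<open>auto intro: H.span_base\<close>)
  qed (use reach_e i in blast)
  have full: "x \<in> H.span ?B" if x: "\<forall>i\<ge>n. x i = 0" for x
  proof -
    obtain q where q: "x = (\<Sum>i<n. act A n (q i) (h i))" using gen[OF x] by blast
    have "act A n (q i) (h i) \<in> H.span ?B" if i: "i < n" for i
    proof -
      have "Ps ! i \<noteq> 0" using monic[OF i] by auto
      have "act A n (q i) (h i) = act A n (q i div Ps ! i * Ps ! i + q i mod Ps ! i) (h i)"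
        by (simp only: div_mult_mod_eq)
      also have "\<dots> = act A n (q i mod Ps ! i) (h i)"
        unfolding M.scale_left_distrib M.scale_scale[symmetric] using h0[OF i] by simp
      also have "\<dots> \<in> H.span ((\<lambda>j. (T ^^ j) (h i)) ` {..<d i})"
        using degree_mod_less[OF \<open>Ps ! i \<noteq> 0\<close>, of "q i"] unfolding d_def by (intro act_span) auto
      finally show ?thesis by (rule span_subsetI[rotated]) (use reach_d i in auto)
    qed
    then show ?thesis unfolding q by (intro H.span_sum) auto
  qed
  show ?thesis
  proof (cases "t = 1")
    case False
    then have "t = 0" using t by simp
    then have "Z = {}" by (simp add: Z_def)
    with full have "x \<in> H.span (set ws \<union> T ` set ws \<union> set [])" if "\<forall>i\<ge>n. x i = 0" for x
      using that by simp
    then show ?thesis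
      using ws det t \<open>t = 0\<close> by (intro basis_nilpotent_involution_product[of ws s "[]" 0]) auto
  next
    case True
    then have Z: "Z = {z0}" by (simp add: Z_def)
    have "d l \<le> (\<Sum>i<n. d i)" using l by (intro member_le_sum) auto
    then have "0 < s" using dl sum_d t True by linarith
    have "T (T (ws ! 0)) \<in> H.span (insert z0 (set ws \<union> T ` set ws))"
      using full[of "T (T (ws ! 0))"] by (simp add: Z act_outside[OF A] act_def[OF A])
    then obtain ws' z where "length ws' = length ws"
      and sub: "insert z0 (set ws \<union> T ` set ws) \<subseteq> H.span (set ws' \<union> T ` set ws' \<union> {z})"
      and "T z \<in> H.span (T ` set ws')" "T (T (ws' ! 0)) \<in> H.span (T ` set ws' \<union> {z})"
      using kernel_vector_adjustment[OF Tz0, of ws] ws \<open>0 < s\<close> by metis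
    moreover have "x \<in> H.span (set ws' \<union> T ` set ws' \<union> set [z])" if "\<forall>i\<ge>n. x i = 0" for x
      using span_subsetI[OF sub, of x] full[OF that] by (simp add: Z)
    ultimately show ?thesis
      using ws t True \<open>0 < s\<close> by (intro basis_nilpotent_involution_product[of ws' s "[z]" 1]) auto
  qed
qed

end

section \<open>Singular companion blocks and the equivalence\<close>

lemma pow_mat_zero_mono:
  assumes "N \<in> carrier_mat n n" "N ^\<^sub>m k = 0\<^sub>m n n"
  shows "N ^\<^sub>m (k + l) = 0\<^sub>m n n"
  using assms by (induction l) auto

lemma block_diag_nilpotent_involution_product:
  fixes A B :: "'a::field mat"
  assumes A: "A \<in> carrier_mat n n" and B: "B \<in> carrier_mat m m"
    and "nilpotent_involution_product A" "nilpotent_involution_product B"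
  shows "nilpotent_involution_product (four_block_mat A (0\<^sub>m n m) (0\<^sub>m m n) B)"
proof -
  obtain N U where NU: "N \<in> carrier_mat n n" "U \<in> carrier_mat n n" "nilpotent_mat N" "involutive_mat U" "A = N * U"
    using assms(3) unfolding nilpotent_involution_product_def carrier_matD(1)[OF A] by blast
  obtain N' U' where NU': "N' \<in> carrier_mat m m" "U' \<in> carrier_mat m m" "nilpotent_mat N'" "involutive_mat U'" "B = N' * U'"
    using assms(4) unfolding nilpotent_involution_product_def carrier_matD(1)[OF B] by blast
  obtain k where k: "N ^\<^sub>m k = 0\<^sub>m n n" using NU by (auto simp: nilpotent_mat_def)
  obtain k' where k': "N' ^\<^sub>m k' = 0\<^sub>m m m" using NU' by (auto simp: nilpotent_mat_def)
  let ?diag = "\<lambda>K L. four_block_mat K (0\<^sub>m n m) (0\<^sub>m m n) L"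
  have "?diag N N' ^\<^sub>m (k + k') = ?diag (N ^\<^sub>m (k + k')) (N' ^\<^sub>m (k' + k))"
    using pow_four_block_mat[OF NU(1) NU'(1), of "k + k'"] by (simp add: add.commute)
  also have "\<dots> = 0\<^sub>m (n + m) (n + m)"
    unfolding pow_mat_zero_mono[OF NU(1) k] pow_mat_zero_mono[OF NU'(1) k'] by simp
  finally have "nilpotent_mat (?diag N N')"
    using NU NU' by (auto simp: nilpotent_mat_def intro!: exI[of _ "k + k'"])
  moreover have "?diag U U' * ?diag U U' = 1\<^sub>m (n + m)"
    using NU(2,4) NU'(2,4) four_block_one_mat[of n m]
    by (simp add: mult_four_block_mat[of _ n n _ m _ m _ _ n _ m] involutive_mat_def)
  then have "involutive_mat (?diag U U')" using NU(2) NU'(2) by (simp add: involutive_mat_def)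
  moreover have "?diag A B = ?diag N N' * ?diag U U'"
    using NU(1,2,5) NU'(1,2,5) by (simp add: mult_four_block_mat[of _ n n _ m _ m _ _ n _ m])
  ultimately show ?thesis
    unfolding nilpotent_involution_product_def using A B NU(1,2) NU'(1,2)
    by (intro exI[of _ "?diag N N'"] exI[of _ "?diag U U'"]) auto
qed

text \<open>For \<open>P = X R\<close> the involution fixes all basis vectors but the last, which it sends to \<open>- R(C) e\<^sub>0\<close>,
  a vector of the kernel of the companion matrix \<open>C\<close>.\<close>
lemma singular_companion_nilpotent_involution_product:
  fixes P :: "'a::field poly"
  assumes P: "lead_coeff P = 1" "poly P 0 = 0"
  shows "nilpotent_involution_product (companion_mat P)"
proof -
  define d where "d = degree P"
  have "d \<noteq> 0"
  proof
    assume "d = 0"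
    then obtain a where "P = [:a:]" unfolding d_def by (rule degree_eq_zeroE)
    with P show False by simp
  qed
  have c0: "coeff P 0 = 0" using P(2) by (simp add: poly_0_coeff_0)
  define N where "N = mat d d (\<lambda>(i,j). if i = Suc j then 1 else 0 :: 'a)"
  \<comment> \<open>The index shift in the last column reads off the coefficients of R = P / X. As
    \<open>P\<close> is monic, the last diagonal entry is -1, which makes the square the
    identity.\<close>
  define U where "U = mat d d (\<lambda>(i,j). if Suc j = d then - coeff P (Suc i) else if i = j then 1 else 0)"
  have N: "N \<in> carrier_mat d d" and U: "U \<in> carrier_mat d d" by (simp_all add: N_def U_def)
  have top: "coeff P (Suc i) = 1" if "Suc i = d" for i using that P(1) by (simp add: d_def)
  have "nilpotent_mat N"
  proof (rule nilpotent_matI[OF N])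
    fix v :: "'a vec" assume v: "v \<in> carrier_vec d"
    show "(((*\<^sub>v) N) ^^ d) v = 0\<^sub>v d"
      by (rule strictly_triangular_orbit_vanishes[OF N, of "\<lambda>i. i" d "\<lambda>t. (((*\<^sub>v) N) ^^ t) v" 0])
        (use funpow_mult_vec_carrier[OF N v] in \<open>auto simp: N_def split: if_splits\<close>)
  qed
  moreover have "U * U = 1\<^sub>m d"
  proof (rule eq_matI)
    fix i j assume "i < dim_row (1\<^sub>m d :: 'a mat)" "j < dim_col (1\<^sub>m d :: 'a mat)"
    then have i: "i < d" and j: "j < d" by auto
    have "(U * U) $$ (i,j) = (\<Sum>k<d. U $$ (i,k) * U $$ (k,j))"
      using i j U by (simp add: scalar_prod_def atLeast0LessThan)
    also have "\<dots> = (if i = j then 1 else 0)"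
    proof (cases "Suc j = d")
      case False
      have "(\<Sum>k<d. U $$ (i,k) * U $$ (k,j)) = (\<Sum>k<d. if k = j then U $$ (i,j) else 0)"
        using i j False by (intro sum.cong) (auto simp: U_def)
      then show ?thesis using i j False by (simp add: U_def)
    next
      case True
      have "(\<Sum>k<d. U $$ (i,k) * U $$ (k,j)) =
          (\<Sum>k<d. (if k = i then (if Suc i = d then 0 else - coeff P (Suc i)) else 0) +
            (if k = j then coeff P (Suc i) else 0))"
        using i j True top by (intro sum.cong) (auto simp: U_def)
      then show ?thesis using i j True top by (auto simp: sum.distrib)
    qed
    finally show "(U * U) $$ (i,j) = 1\<^sub>m d $$ (i,j)" using i j by simp
  qed (use U in auto)
  then have "involutive_mat U" using U by (auto simp: involutive_mat_def)
  moreover have "companion_mat P = N * U"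
  proof (rule eq_matI)
    fix i j assume "i < dim_row (N * U)" "j < dim_col (N * U)"
    then have i: "i < d" and j: "j < d" using N U by auto
    have "(N * U) $$ (i,j) = (\<Sum>k<d. N $$ (i,k) * U $$ (k,j))"
      using i j N U by (simp add: scalar_prod_def atLeast0LessThan)
    also have "\<dots> = (\<Sum>k<d. if i = Suc k then U $$ (k,j) else 0)"
      using i by (intro sum.cong) (auto simp: N_def)
    also have "\<dots> = companion_mat P $$ (i,j)"
      using i j c0 by (cases i) (auto simp: companion_mat_def U_def simp flip: d_def)
    finally show "companion_mat P $$ (i,j) = (N * U) $$ (i,j)" ..
  qed (use N U in \<open>auto simp: d_def\<close>)
  ultimately show ?thesis
    unfolding nilpotent_involution_product_def using N U
    by (intro exI[of _ N] exI[of _ U]) (simp add: d_def)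
qed

lemma singular_companion_blocks_nilpotent_involution_product:
  fixes Ps :: "'a::field poly list"
  assumes "\<And>P. P \<in> set Ps \<Longrightarrow> lead_coeff P = 1 \<and> (P = 1 \<or> poly P 0 = 0)"
  shows "nilpotent_involution_product (companion_blocks Ps)"
  using assms
proof (induction Ps)
  case Nil
  have "nilpotent_mat (0\<^sub>m 0 0 :: 'a mat)" "involutive_mat (0\<^sub>m 0 0 :: 'a mat)"
    by (auto simp: nilpotent_mat_def involutive_mat_def intro!: eq_matI)
  then show ?case
    unfolding nilpotent_involution_product_def by (intro exI[of _ "0\<^sub>m 0 0"]) simp
next
  case (Cons P Ps)
  have "companion_blocks (P # Ps) = four_block_mat (companion_mat P)
      (0\<^sub>m (degree P) (\<Sum>P\<leftarrow>Ps. degree P)) (0\<^sub>m (\<Sum>P\<leftarrow>Ps. degree P) (degree P)) (companion_blocks Ps)"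
    by (simp add: Let_def)
  moreover have "nilpotent_involution_product (companion_mat P)"
  proof (cases "P = 1")
    case True
    then have "companion_mat P = companion_blocks []" by (auto simp: companion_mat_def)
    moreover have "nilpotent_mat (0\<^sub>m 0 0 :: 'a mat)" "involutive_mat (0\<^sub>m 0 0 :: 'a mat)"
      by (auto simp: nilpotent_mat_def involutive_mat_def intro!: eq_matI)
    ultimately show ?thesis
      unfolding nilpotent_involution_product_def by (intro exI[of _ "0\<^sub>m 0 0"]) simp
  next
    case False
    then show ?thesis using Cons.prems[of P] by (intro singular_companion_nilpotent_involution_product) auto
  qed
  moreover have "nilpotent_involution_product (companion_blocks Ps)" using Cons by simp
  ultimately show ?case
    using block_diag_nilpotent_involution_product[OF companion_carrier companion_blocks_carrier] by metis
qed

text \<open>With \<open>P = c + X q\<close>, the identity P(C) = 0 becomes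
  \<open>C q(C) = - c\<close>, and the constant term \<open>c\<close> is nonzero.\<close>

lemma det_companion_nonzero:
  fixes P :: "'a::field poly"
  assumes P: "lead_coeff P = 1" "poly P 0 \<noteq> 0"
  shows "det (companion_mat P) \<noteq> 0"
proof -
  let ?C = "companion_mat P" and ?d = "degree P"
  obtain c q where cq: "P = pCons c q" by (rule pCons_cases)
  have c: "c \<noteq> 0" using P(2) by (simp add: cq)
  note car = poly_mat_carrier[OF companion_carrier[of P], of q]
  have zero: "c \<cdot>\<^sub>m 1\<^sub>m ?d + ?C * poly_mat ?C q = 0\<^sub>m ?d ?d"
    using poly_mat_companion_self[OF P(1)] poly_mat_pCons[OF companion_carrier[of P], of c q] cq by simp
  have "c * (if i = j then 1 else 0) + (?C * poly_mat ?C q) $$ (i,j) = 0" if "i < ?d" "j < ?d" for i j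
  proof -
    have "(c \<cdot>\<^sub>m 1\<^sub>m ?d + ?C * poly_mat ?C q) $$ (i,j) = 0" using zero that by simp
    then show ?thesis using that car by (simp del: index_mult_mat(1))
  qed
  then have "(?C * poly_mat ?C q) $$ (i,j) = ((- c) \<cdot>\<^sub>m 1\<^sub>m ?d) $$ (i,j)" if "i < ?d" "j < ?d" for i j
    using that by (auto simp: add_eq_0_iff simp del: index_mult_mat(1))
  then have "?C * poly_mat ?C q = (- c) \<cdot>\<^sub>m 1\<^sub>m ?d"
    using car by (intro eq_matI) auto
  then have "det ?C * det (poly_mat ?C q) = (- c) ^ ?d"
    using det_mult[OF companion_carrier[of P] car] by simp
  then show ?thesis using c by auto
qed

lemma det_companion_blocks_eq_0:
  "det (companion_blocks Ps) = 0 \<Longrightarrow> \<exists>P\<in>set Ps. det (companion_mat P) = 0"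
proof (induction Ps)
  case Nil
  then show ?case using det_dim_zero[of "0\<^sub>m 0 0 :: 'a mat"] by simp
next
  case (Cons P Ps)
  have "companion_blocks (P # Ps) = four_block_mat (companion_mat P)
      (0\<^sub>m (degree P) (\<Sum>P\<leftarrow>Ps. degree P)) (0\<^sub>m (\<Sum>P\<leftarrow>Ps. degree P) (degree P)) (companion_blocks Ps)"
    by (simp add: Let_def)
  then have "det (companion_blocks (P # Ps)) = det (companion_mat P) * det (companion_blocks Ps)"
    using det_four_block_mat_lower_left_zero[OF companion_carrier[of P] zero_carrier_mat refl companion_blocks_carrier[of Ps]]
    by simp
  with Cons show ?case by auto
qed

lemma det_nilpotent_mat:
  assumes N: "N \<in> carrier_mat n n" "nilpotent_mat N" and "0 < n"
  shows "det N = 0"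
proof -
  obtain k where k: "N ^\<^sub>m k = 0\<^sub>m n n" using N by (auto simp: nilpotent_mat_def)
  have "det (N ^\<^sub>m j) = det N ^ j" for j
    using N(1) by (induction j) (simp_all add: det_mult[of _ n] mult.commute)
  from this[of k] have "det N ^ k = 0" using k \<open>0 < n\<close> by simp
  then show ?thesis by simp
qed

text \<open>If 0 is not a root of \<open>p\<close>, the cofactor has all of the multiplicity
  \<open>j\<close> at 0 and thus the full degree, which leaves a constant for
  \<open>p\<close>.\<close>

lemma poly_dvd_monom_cases:
  fixes p :: "'a::field poly"
  assumes dvd: "p dvd monom 1 j" and monic: "lead_coeff p = 1"
  shows "p = 1 \<or> poly p 0 = 0"
proof (cases "poly p 0 = 0")
  case False
  obtain q where q: "monom 1 j = p * q" using dvd by (elim dvdE)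
  have nz: "p * q \<noteq> 0" unfolding q[symmetric] by simp
  then have pq: "p \<noteq> 0" "q \<noteq> 0" by auto
  have "order 0 (p * q) = j" unfolding q[symmetric] by simp
  moreover have "order 0 p = 0" using False by (simp add: order_root)
  ultimately have "order 0 q = j" using order_mult[OF nz, of 0] by simp
  then have "j \<le> degree q" using order_degree[OF pq(2), of 0] by simp
  moreover have "j = degree p + degree q"
    using degree_mult_eq[OF pq] degree_monom_eq[of "1 :: 'a" j] by (simp add: q)
  ultimately have "degree p = 0" by simp
  then obtain a where "p = [:a:]" by (rule degree_eq_zeroE)
  with monic show ?thesis by (simp add: one_pCons)
qed simp

lemma map_poly_to_ac_mult: "map_poly to_ac (p * q) = map_poly to_ac p * map_poly to_ac q"
  by (rule poly_eqI) (simp add: coeff_map_poly coeff_mult to_ac_sum)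

text \<open>Dividing out the full power of X leaves a factor that does not vanish at 0. Were it
  constant, \<open>P\<close> would be 1 or a power of X whose exponent is at most \<open>n\<close>
  by the degree bound.\<close>

lemma root_outside_0:
  fixes P :: "'a::field poly"
  assumes monic: "lead_coeff P = 1" and "P \<noteq> 1" and deg: "degree P \<le> n" and not_monom: "\<forall>j\<in>{1..n}. P \<noteq> monom 1 j"
  obtains l where "l \<noteq> 0" "poly (map_poly to_ac P) l = 0"
proof -
  have "P \<noteq> 0" using monic by auto
  then obtain R where R: "P = monom 1 (order 0 P) * R" "\<not> [:0,1:] dvd R"
    using order_decomp[of P 0] by (auto simp: monom_altdef)
  define k where "k = order 0 P"
  have R0: "poly R 0 \<noteq> 0" using R(2) poly_eq_0_iff_dvd[of R 0] by simp
  have "R \<noteq> 0" using R0 by auto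
  have monicR: "lead_coeff R = 1" using monic R(1) by (metis lead_coeff_mult lead_coeff_monom mult_1)
  have "degree R \<noteq> 0"
  proof
    assume "degree R = 0"
    then obtain a where "R = [:a:]" by (rule degree_eq_zeroE)
    then have P: "P = monom 1 k" using monicR R(1) by (simp add: k_def)
    then have "k \<le> n" using deg by (simp add: degree_monom_eq)
    moreover have "k \<noteq> 0" using P \<open>P \<noteq> 1\<close> by (intro notI) simp
    ultimately show False using not_monom P by auto
  qed
  then have "degree (map_poly to_ac R) > 0" by (subst degree_map_poly) auto
  then obtain l where l: "poly (map_poly to_ac R) l = 0" using alg_closed_imp_poly_has_root by blast
  have "l \<noteq> 0"
  proof
    assume "l = 0"
    with l have "to_ac (coeff R 0) = 0" by (simp add: poly_0_coeff_0 coeff_map_poly)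
    with R0 show False by (simp add: poly_0_coeff_0)
  qed
  moreover have "map_poly to_ac P = map_poly to_ac (monom 1 (order 0 P)) * map_poly to_ac R"
    by (subst R(1)) (rule map_poly_to_ac_mult)
  then have "poly (map_poly to_ac P) l = 0" using l by simp
  ultimately show ?thesis by (rule that)
qed

theorem theorem1p1:
  fixes A :: "'a::field mat" and n :: nat
  assumes "n > 0" and "A \<in> carrier_mat n n"
  shows "(\<exists>N U. N \<in> carrier_mat n n \<and> U \<in> carrier_mat n n \<and>
            nilpotent_mat N \<and> involutive_mat U \<and> A = N * U)
     \<longleftrightarrow>
     (det A = 0 \<and>
      card {i. i < n \<and> invariant_factors A ! i \<noteq> 1 \<and>
               (\<forall>j\<in>{1..n}. invariant_factors A ! i \<noteq> monom 1 j)} \<le> n div 2)"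
proof -
  define Ps where "Ps = invariant_factors A"
  define J where "J = {i. i < n \<and> Ps ! i \<noteq> 1 \<and> (\<forall>j\<in>{1..n}. Ps ! i \<noteq> monom 1 j)}"
  have dA: "dim_row A = n" using assms(2) by simp
  have Ps: "is_invariant_factors A Ps" unfolding Ps_def by (rule invariant_factors[OF assms(2)])
  have len: "length Ps = n" using Ps dA by (simp add: is_invariant_factors_def)
  have sum_deg: "(\<Sum>P\<leftarrow>Ps. degree P) = n" using is_invariant_factors_carrier(2)[OF Ps] len by simp
  have monic: "lead_coeff (Ps ! i) = 1" if "i < n" for i
    using that Ps len by (simp add: is_invariant_factors_def)
  have chain: "Ps ! i dvd Ps ! j" if "i \<le> j" "j < n" for i j
    using invariant_factors_chain[OF Ps] that len by simp
  have sim: "similar_mat A (companion_blocks Ps)" using Ps by (simp add: is_invariant_factors_def)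
  have "nilpotent_involution_product A \<longleftrightarrow> det A = 0 \<and> card J \<le> n div 2"
  proof
    assume prod: "nilpotent_involution_product A"
    then obtain N U where NU: "N \<in> carrier_mat n n" "U \<in> carrier_mat n n" "nilpotent_mat N" "A = N * U"
      unfolding nilpotent_involution_product_def dA by blast
    have "det A = 0"
      using det_mult[OF NU(1,2)] det_nilpotent_mat[OF NU(1,3) assms(1)] NU(4) by simp
    moreover have "card J \<le> n div 2"
    proof (cases "J = {}")
      case False
      \<comment> \<open>By the divisibility chain, all factors indexed by \<open>J\<close> are
        multiples of the earliest one and share its nonzero root.\<close>
      define i where "i = Min J"
      have fin: "finite J" by (simp add: J_def)
      have iJ: "i \<in> J" unfolding i_def using fin False by (rule Min_in)
      then have i: "i < n" by (simp add: J_def)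
      have "degree (Ps ! i) \<le> n"
        unfolding sum_deg[symmetric] using i len by (intro member_le_sum_list) auto
      then obtain l where l: "l \<noteq> 0" "poly (map_poly to_ac (Ps ! i)) l = 0"
        using root_outside_0[of "Ps ! i" n] monic[OF i] iJ unfolding J_def by blast
      have "J \<subseteq> {j. j < length Ps \<and> poly (map_poly to_ac (Ps ! j)) l = 0}"
      proof
        fix j assume j: "j \<in> J"
        then have "i \<le> j" "j < n" unfolding i_def using fin by (auto simp: J_def)
        then obtain q where "Ps ! j = Ps ! i * q" using chain by (metis dvdE)
        then show "j \<in> {j. j < length Ps \<and> poly (map_poly to_ac (Ps ! j)) l = 0}"
          using l(2) \<open>j < n\<close> len by (simp add: map_poly_to_ac_mult)
      qed
      then have "card J \<le> length (filter (\<lambda>P. poly (map_poly to_ac P) l = 0) Ps)"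
        unfolding length_filter_conv_card by (intro card_mono) auto
      with nilpotent_involution_product_bound[OF Ps assms(2) prod l(1)] show ?thesis by linarith
    qed simp
    ultimately show "det A = 0 \<and> card J \<le> n div 2" ..
  next
    assume *: "det A = 0 \<and> card J \<le> n div 2"
    show "nilpotent_involution_product A"
    proof (cases "\<exists>i<n. \<exists>j\<in>{1..n}. Ps ! i = monom 1 j")
      \<comment> \<open>Factors up to the power of X divide it, and later ones are multiples of it,
        so every factor is 1 or vanishes at 0.\<close>
      case True
      then obtain i j where ij: "i < n" "1 \<le> j" "Ps ! i = monom 1 j" by auto
      have "lead_coeff P = 1 \<and> (P = 1 \<or> poly P 0 = 0)" if P: "P \<in> set Ps" for P
      proof -
        obtain k where k: "k < n" "P = Ps ! k" using P len by (metis in_set_conv_nth)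
        show ?thesis
        proof (cases "k \<le> i")
          case True
          have "P dvd monom 1 j" using chain[OF True ij(1)] unfolding k(2) ij(3) .
          moreover have "lead_coeff P = 1" unfolding k(2) by (rule monic[OF k(1)])
          ultimately show ?thesis using poly_dvd_monom_cases by blast
        next
          case False
          then have "Ps ! i dvd Ps ! k" using k(1) by (intro chain) simp_all
          then have "monom 1 j dvd P" unfolding k(2) ij(3) .
          then obtain q where "P = monom 1 j * q" by (elim dvdE)
          then have "poly P 0 = 0" using ij(2) by (simp add: poly_monom)
          then show ?thesis using monic[OF k(1)] k(2) by simp
        qed
      qed
      then have "nilpotent_involution_product (companion_blocks Ps)"
        by (rule singular_companion_blocks_nilpotent_involution_product)
      with sim show ?thesis by (rule similar_nilpotent_involution_product)
    next
      case False
      have "det (companion_blocks Ps) = 0" using * det_similar[OF sim] by simp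
      then obtain i where i: "i < n" "det (companion_mat (Ps ! i)) = 0"
        using det_companion_blocks_eq_0[of Ps] len by (metis in_set_conv_nth)
      then have "poly (Ps ! i) 0 = 0" using det_companion_nonzero[OF monic[OF i(1)]] by blast
      moreover have "Ps ! i dvd Ps ! (n - 1)" using i(1) by (intro chain) auto
      ultimately have "poly (Ps ! (n - 1)) 0 = 0" by (auto elim!: dvdE)
      \<comment> \<open>With no power of X in the list, every factor of positive degree is counted
        by \<open>J\<close>.\<close>
      moreover have "{i. i < n \<and> degree (Ps ! i) \<noteq> 0} \<subseteq> J"
        unfolding J_def using False by (auto simp: degree_1)
      then have "card {i. i < n \<and> degree (Ps ! i) \<noteq> 0} \<le> card J"
        by (intro card_mono) (simp_all add: J_def)
      ultimately show ?thesis
        using * by (intro few_invariant_factors_product[OF assms(2) Ps assms(1)]) auto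
    qed
  qed
  then show ?thesis unfolding nilpotent_involution_product_def dA J_def Ps_def .
qed

end
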